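(* Let $p\ge2$ be an integer, $s\ge0$, $-1\le\alpha\le\min(1,\frac23s+\frac13)$, and let $M$, $T>0$ and $0<c_0<2$ be given. Let $K\ge1$ be an integer. Assume that the exact solution $(y(t),\dot y(t))$ of the system $\ddot y=-\Omega^2y+f(y)$ in $\mathbb C^{\mathcal K}$ (the spectral semi-discretization of $u_{tt}=u_{xx}+u^p$) as well as the exact solution $(z(t),\dot z(t))$ of the equation with modified frequencies and modified initial values $$\ddot z(t)=-\widetilde\Omega^2z(t)+f(z(t)),\qquad z(t_0)=y(t_0),\quad \dot z(t_0)=\operatorname{sinc}(h\widetilde\Omega)^{-1}\dot y(t_0),$$ both satisfy the finite energy assumption $$\|y(t)\|_{s+1}+\|\dot y(t)\|_s\le M\quad\text{and}\quad\|z(t)\|_{s+1}+\|\dot z(t)\|_s\le M\qquad\text{for }0\le t-t_0\le T.$$ Then there exists $h_0>0$ such that for all time step-sizes $0<h\le h_0$ that fulfill the step-size restriction $hK\le c_0<2$, the following error bound holds for the numerical solution $(y^n,\dot y^n)$ computed with the Störmer--Verlet/leapfrog method: $$\|y(t_n)-y^n\|_{s+1-3(1+\alpha)/2}+\|\dot y(t_n)-\dot y^n\|_{s-3(1+\alpha)/2}\le Ch^{1+\alpha}\qquad\text{for }0\le t_n-t_0\le T.$$ The constants $C$ and $h_0$ depend only on $M$, $s$, $p$, $T$ and $c_0$.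
   Context: Spatial semi-discretization. For an integer $K\ge1$ let $\mathcal K=\{-K,\dots,K-1\}$, and let $\mathbb C^{\mathcal K}$ be the set of complex vectors $y=(y_j)_{j\in\mathcal K}$. Let $\Omega=\operatorname{diag}(\omega_j)_{j\in\mathcal K}$ with $\omega_j=|j|$. The discrete convolution is $(y\ast z)_j=\sum_{k,l\in\mathcal K,\ k+l\equiv j \bmod 2K}y_kz_l$ for $j\in\mathcal K$, and $f(y)=y\ast\cdots\ast y$ ($p$ factors). The system $\ddot y=-\Omega^2y+f(y)$ with given initial values $y(t_0),\dot y(t_0)\in\mathbb C^{\mathcal K}$ is the spectral collocation semi-discretization of $u_{tt}=u_{xx}+u^p$ with $2\pi$-periodic boundary conditions in one space dimension. Norms. For $\sigma\in\mathbb R$ and $y\in\mathbb C^{\mathcal K}$, $\|y\|_\sigma=\bigl(\sum_{j\in\mathcal K}\langle j\rangle^{2\sigma}|y_j|^2\bigr)^{1/2}$ with $\langle j\rangle=\max(1,|j|)$. Störmer--Verlet/leapfrog method with step-size $h$, $t_n=t_0+nh$: with $y^0=y(t_0)$, $\dot y^0=\dot y(t_0)$, $$y^{n+1}-2y^n+y^{n-1}=-h^2\Omega^2y^n+h^2f(y^n)\quad(n\ge1),$$ with starting approximation $y^1=y^0+h\dot y^0-\frac12h^2\Omega^2y^0+\frac12h^2f(y^0)$ and velocity approximation $2h\dot y^n=y^{n+1}-y^{n-1}$ for $n\ge1$. Modified frequencies. Under the restriction $hK<2$ (so $h\omega_j<2$ for all $j\in\mathcal K$), $\widetilde\Omega=\operatorname{diag}(\widetilde\omega_j)_{j\in\mathcal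 K}$ where $0\le\widetilde\omega_j<h^{-1}\pi$ is defined by $\cos(h\widetilde\omega_j)=1-\frac12h^2\omega_j^2$. Here $\operatorname{sinc}(\xi)=\sin(\xi)/\xi$, $\operatorname{sinc}(0)=1$, and $\operatorname{sinc}(h\widetilde\Omega)^{-1}$ is the inverse of the diagonal matrix $\operatorname{sinc}(h\widetilde\Omega)$. Note that $(z,\dot z)$ depends on $h$. *)

theory Defs
  imports "HOL-Analysis.Analysis" "HOL-Probability.Sinc_Integral"
begin

text \<open>
  A vector in \<open>\<complex>\<^sup>\<K>\<close> with \<open>\<K> = {-K, \<dots>, K - 1}\<close> is represented by a function
  \<open>int \<Rightarrow> complex\<close>. Values outside \<open>\<K>\<close> are irrelevant: every notion below only reads, and only
  constrains, the entries with index in \<open>\<K>\<close>.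
\<close>

definition freq_idx :: "nat \<Rightarrow> int set" where
  "freq_idx K = {- int K .. int K - 1}"

definition freq :: "int \<Rightarrow> real" where
  "freq j = real_of_int \<bar>j\<bar>"

definition disc_conv :: "nat \<Rightarrow> (int \<Rightarrow> complex) \<Rightarrow> (int \<Rightarrow> complex) \<Rightarrow> int \<Rightarrow> complex" where
  "disc_conv K y z j =
     (\<Sum>(k, l) \<in> {(k, l). k \<in> freq_idx K \<and> l \<in> freq_idx K \<and> (k + l) mod (2 * int K) = j mod (2 * int K)}.
        y k * z l)"

text \<open>The \<open>p\<close>-fold convolution of \<open>y\<close> with itself, for \<open>p \<ge> 1\<close> factors, takes \<open>p - 1\<close> convolutions.\<close>

definition conv_power :: "nat \<Rightarrow> nat \<Rightarrow> (int \<Rightarrow> complex) \<Rightarrow> int \<Rightarrow> complex" where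
  "conv_power K p y = (disc_conv K y ^^ (p - 1)) y"

definition sob_norm :: "nat \<Rightarrow> real \<Rightarrow> (int \<Rightarrow> complex) \<Rightarrow> real" where
  "sob_norm K \<sigma> y =
     sqrt (\<Sum>j\<in>freq_idx K. max 1 (real_of_int \<bar>j\<bar>) powr (2 * \<sigma>) * (cmod (y j))\<^sup>2)"

text \<open>
  \<open>(y, yd)\<close> solves \<open>y'' = - diag(w)\<^sup>2 y + f(y)\<close> on \<open>[t0, t0 + T]\<close> with \<open>yd = y'\<close>,
  with one-sided derivatives at the end points.
\<close>

definition solves_wave ::
  "nat \<Rightarrow> nat \<Rightarrow> (int \<Rightarrow> real) \<Rightarrow> real \<Rightarrow> real \<Rightarrow> (real \<Rightarrow> int \<Rightarrow> complex) \<Rightarrow> (real \<Rightarrow> int \<Rightarrow> complex) \<Rightarrow> bool"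
  where
  "solves_wave K p w t0 T y yd \<longleftrightarrow>
     (\<forall>j\<in>freq_idx K. \<forall>t\<in>{t0..t0 + T}.
        ((\<lambda>\<tau>. y \<tau> j) has_vector_derivative yd t j) (at t within {t0..t0 + T}) \<and>
        ((\<lambda>\<tau>. yd \<tau> j) has_vector_derivative
           (- (complex_of_real (w j))\<^sup>2 * y t j + conv_power K p (y t) j)) (at t within {t0..t0 + T}))"

definition finite_energy ::
  "nat \<Rightarrow> real \<Rightarrow> real \<Rightarrow> real \<Rightarrow> real \<Rightarrow> (real \<Rightarrow> int \<Rightarrow> complex) \<Rightarrow> (real \<Rightarrow> int \<Rightarrow> complex) \<Rightarrow> bool"
  where
  "finite_energy K s M t0 T y yd \<longleftrightarrow>
     (\<forall>t\<in>{t0..t0 + T}. sob_norm K (s + 1) (y t) + sob_norm K s (yd t) \<le> M)"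

text \<open>Meaningful only for \<open>h > 0\<close> and \<open>h * freq j < 2\<close>.\<close>

definition mod_freq :: "real \<Rightarrow> int \<Rightarrow> real" where
  "mod_freq h j = (THE w. 0 \<le> w \<and> w < pi / h \<and> cos (h * w) = 1 - h\<^sup>2 * (freq j)\<^sup>2 / 2)"

lemma mod_freq_unique:
  assumes "0 < h" "h * freq j < 2"
  shows "\<exists>!w. 0 \<le> w \<and> w < pi / h \<and> cos (h * w) = 1 - h\<^sup>2 * (freq j)\<^sup>2 / 2"
proof -
  define c where "c = 1 - h\<^sup>2 * (freq j)\<^sup>2 / 2"
  have "0 \<le> h * freq j" using assms by (simp add: freq_def)
  hence "(h * freq j)\<^sup>2 < 2\<^sup>2" using assms(2) by (intro power_strict_mono) auto
  hence c: "-1 < c" "c \<le> 1" by (auto simp: c_def power_mult_distrib)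
  have a: "0 \<le> arccos c" "cos (arccos c) = c" "arccos c \<le> pi"
    using c by (auto intro: arccos_lbound arccos_ubound cos_arccos)
  moreover have "arccos c \<noteq> pi" using a(2) c(1) by auto
  ultimately have "arccos c < pi" by linarith
  show ?thesis
  proof (rule ex1I[of _ "arccos c / h"])
    show "0 \<le> arccos c / h \<and> arccos c / h < pi / h \<and>
      cos (h * (arccos c / h)) = 1 - h\<^sup>2 * (freq j)\<^sup>2 / 2"
      using a \<open>arccos c < pi\<close> assms(1) by (simp add: divide_strict_right_mono c_def)
  next
    fix w assume w: "0 \<le> w \<and> w < pi / h \<and> cos (h * w) = 1 - h\<^sup>2 * (freq j)\<^sup>2 / 2"
    hence "0 \<le> h * w" "h * w \<le> pi" using assms(1) by (auto simp: field_simps)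
    hence "arccos (cos (h * w)) = h * w" by (rule arccos_cos)
    thus "w = arccos c / h" using w assms(1) by (simp add: c_def)
  qed
qed

definition leapfrog ::
  "nat \<Rightarrow> nat \<Rightarrow> real \<Rightarrow> (int \<Rightarrow> complex) \<Rightarrow> (int \<Rightarrow> complex) \<Rightarrow>
   (nat \<Rightarrow> int \<Rightarrow> complex) \<Rightarrow> (nat \<Rightarrow> int \<Rightarrow> complex) \<Rightarrow> bool"
  where
  "leapfrog K p h y0 yd0 Y Yd \<longleftrightarrow>
     (\<forall>j\<in>freq_idx K.
        Y 0 j = y0 j \<and> Yd 0 j = yd0 j \<and>
        Y 1 j = Y 0 j + of_real h * Yd 0 j - 1/2 * (of_real h)\<^sup>2 * (of_real (freq j))\<^sup>2 * Y 0 j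
                + 1/2 * (of_real h)\<^sup>2 * conv_power K p (Y 0) j \<and>
        (\<forall>n\<ge>1. Y (n + 1) j - 2 * Y n j + Y (n - 1) j
                = - (of_real h)\<^sup>2 * (of_real (freq j))\<^sup>2 * Y n j
                  + (of_real h)\<^sup>2 * conv_power K p (Y n) j) \<and>
        (\<forall>n\<ge>1. 2 * of_real h * Yd n j = Y (n + 1) j - Y (n - 1) j))"

end

theory Submission
  imports Defs
begin

text \<open>
  Two facts about the method drive the proof. First, \<open>cos (h w') = 1 - h\<^sup>2 w\<^sup>2 / 2\<close>, where \<open>w\<close> is a
  frequency and \<open>w'\<close> its modification, says that the leapfrog recursion propagates the linear
  equation with the modified frequencies exactly. Hence the error splits into the distance \<open>y - z\<close>
  of two exact solutions and the error of a trigonometric integrator that is applied to \<open>z\<close>;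
  the numerical velocity approximates the filtered velocity \<open>sinc (h w') z'\<close>. Second, the
  nonlinearity is a convolution, and convolution is bounded from the product of the \<open>(s + 1)\<close>- and
  the \<open>\<sigma>\<close>-norm to the \<open>\<sigma>\<close>-norm for all \<open>\<bar>\<sigma>\<bar> \<le> s + 1\<close>, uniformly in \<open>K\<close>
  (\<open>sob_norm_disc_conv\<close>). Put \<open>\<beta> = 1 + \<alpha>\<close>. The errors of the positions are measured with the index
  \<open>\<sigma> = s + 1 - 3\<beta>/2\<close>, and \<open>\<alpha> \<le> 2s/3 + 1/3\<close> gives just \<open>\<sigma> \<ge> -1\<close>; so the nonlinearity is Lipschitz
  continuous in every norm that occurs.

  The distance \<open>y - z\<close> (\<open>modified_frequency_error\<close>). The squares of the frequencies differ by at most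
  a multiple of \<open>h\<^sup>2 w\<^sup>4\<close>. As a perturbation of the equation this costs three derivatives more than
  the solution provides to the energy, and \<open>h\<^sup>2\<langle>j\<rangle>\<^sup>3\<close> is the number that decides about its size. Where it
  exceeds 1, the perturbation is useless, but there \<open>\<langle>j\<rangle>\<^bsup>-3\<beta>/2\<^esup> \<le> h\<^sup>\<beta>\<close>, and the bounded energy of both
  solutions alone yields the estimate. Where it is at most 1, it is bounded by its power with
  exponent \<open>\<beta>/2\<close>, that is by \<open>h\<^sup>\<beta>\<langle>j\<rangle>\<^bsup>3\<beta>/2\<^esup>\<close>, and an energy estimate with Gronwall's lemma applies.

  The numerical error (\<open>leapfrog_error\<close>). The defects of \<open>z\<close> in the one-step form of the method
  are those of a trapezoidal rule. Along \<open>z\<close>, the nonlinearity and its first and second time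
  derivative are bounded with index \<open>s + 1\<close>, \<open>s\<close> and \<open>s - 1\<close>; this makes the defects \<open>O(h\<^sup>2)\<close> in
  the energy norm and \<open>O(h\<^sup>3)\<close> with one derivative less. Since the linear flow of a step is almost an
  isometry, the global errors are \<open>O(h)\<close> without loss of derivatives, which also bounds the numerical
  solution for small \<open>h\<close>, and \<open>O(h\<^sup>2)\<close> with the loss of one derivative. Interpolation between both
  gives \<open>O(h\<^sup>\<beta>)\<close> in a norm that is stronger than required (\<open>leapfrog_error_interpolated\<close>).
\<close>

section \<open>Weighted norms\<close>

definition bracket :: "int \<Rightarrow> real" where
  "bracket j = max 1 (real_of_int \<bar>j\<bar>)"

lemma bracket_ge_1: "1 \<le> bracket j"
  and bracket_pos: "0 < bracket j"
  and bracket_nonneg [simp]: "0 \<le> bracket j"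
  by (auto simp: bracket_def)

lemma finite_freq_idx [simp]: "finite (freq_idx K)"
  by (simp add: freq_idx_def)

lemma sob_norm_L2_set:
  "sob_norm K \<sigma> y = L2_set (\<lambda>j. bracket j powr \<sigma> * cmod (y j)) (freq_idx K)"
proof -
  have "max 1 (real_of_int \<bar>j\<bar>) powr (2 * \<sigma>) * (cmod (y j))\<^sup>2 = (bracket j powr \<sigma> * cmod (y j))\<^sup>2" for j
    using bracket_pos[of j]
    by (simp add: bracket_def power_mult_distrib powr_power mult.commute)
  thus ?thesis by (simp add: sob_norm_def L2_set_def)
qed

lemma sob_norm_nonneg [simp]: "0 \<le> sob_norm K \<sigma> y"
  by (simp add: sob_norm_L2_set)

lemma sob_norm_zero [simp]: "sob_norm K \<sigma> (\<lambda>j. 0) = 0"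
  by (simp add: sob_norm_L2_set L2_set_def)

lemma sob_norm_cong: "(\<And>j. j \<in> freq_idx K \<Longrightarrow> y j = z j) \<Longrightarrow> sob_norm K \<sigma> y = sob_norm K \<sigma> z"
  by (simp add: sob_norm_def)

lemma L2_set_le_combination:
  assumes "\<And>j. j \<in> I \<Longrightarrow> 0 \<le> f j" "\<And>j. j \<in> I \<Longrightarrow> f j \<le> A * g j + B * k j"
    "0 \<le> A" "0 \<le> B"
  shows "L2_set f I \<le> A * L2_set g I + B * L2_set k I"
proof -
  have "L2_set f I \<le> L2_set (\<lambda>j. A * g j + B * k j) I"
    by (rule L2_set_mono) (use assms in auto)
  also have "\<dots> \<le> L2_set (\<lambda>j. A * g j) I + L2_set (\<lambda>j. B * k j) I"
    by (rule L2_set_triangle_ineq)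
  finally show ?thesis by (simp add: L2_set_right_distrib assms)
qed

lemma sob_norm_le_combination:
  assumes "\<And>j. j \<in> freq_idx K \<Longrightarrow> bracket j powr \<sigma> * cmod (y j)
      \<le> A * (bracket j powr \<tau> * cmod (u j)) + B * (bracket j powr \<rho> * cmod (v j))"
    and "0 \<le> A" "0 \<le> B"
  shows "sob_norm K \<sigma> y \<le> A * sob_norm K \<tau> u + B * sob_norm K \<rho> v"
  unfolding sob_norm_L2_set by (rule L2_set_le_combination) (use assms in auto)

lemma sob_norm_le_multiple:
  assumes "\<And>j. j \<in> freq_idx K \<Longrightarrow> bracket j powr \<sigma> * cmod (y j) \<le> A * (bracket j powr \<tau> * cmod (u j))"
    and "0 \<le> A"
  shows "sob_norm K \<sigma> y \<le> A * sob_norm K \<tau> u"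
  using sob_norm_le_combination[of K \<sigma> y A \<tau> u 0 \<tau> u] assms by simp

lemma sob_norm_triangle: "sob_norm K \<sigma> (\<lambda>j. y j + z j) \<le> sob_norm K \<sigma> y + sob_norm K \<sigma> z"
proof -
  have "bracket j powr \<sigma> * cmod (y j + z j)
      \<le> 1 * (bracket j powr \<sigma> * cmod (y j)) + 1 * (bracket j powr \<sigma> * cmod (z j))" for j
    using mult_left_mono[OF norm_triangle_ineq[of "y j" "z j"], of "bracket j powr \<sigma>"]
    by (simp add: distrib_left)
  from sob_norm_le_combination[OF this] show ?thesis by simp
qed

lemma sob_norm_minus: "sob_norm K \<sigma> (\<lambda>j. y j - z j) = sob_norm K \<sigma> (\<lambda>j. z j - y j)"
  by (simp add: sob_norm_L2_set norm_minus_commute)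

lemma sob_norm_triangle_diff:
  "sob_norm K \<sigma> (\<lambda>j. y j - z j) \<le> sob_norm K \<sigma> y + sob_norm K \<sigma> z"
proof -
  have "sob_norm K \<sigma> (\<lambda>j. - z j) = sob_norm K \<sigma> z" by (simp add: sob_norm_L2_set)
  thus ?thesis using sob_norm_triangle[of K \<sigma> y "\<lambda>j. - z j"] by simp
qed

lemma sob_norm_triangle_diff3:
  "sob_norm K \<sigma> (\<lambda>j. x j - z j) \<le> sob_norm K \<sigma> (\<lambda>j. x j - y j) + sob_norm K \<sigma> (\<lambda>j. y j - z j)"
  using sob_norm_triangle[of K \<sigma> "\<lambda>j. x j - y j" "\<lambda>j. y j - z j"] by simp

text \<open>
  The linear part of the problem is diagonal, so that its operators are Fourier multipliers; their
  only effect on the norms is a shift of the index by their order \<open>\<mu>\<close>.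
\<close>
lemma sob_norm_multiplier:
  assumes "\<And>j. j \<in> freq_idx K \<Longrightarrow> cmod (y j) \<le> A * (bracket j powr \<mu> * cmod (u j))"
    and "0 \<le> A" "\<sigma> + \<mu> \<le> \<tau>"
  shows "sob_norm K \<sigma> y \<le> A * sob_norm K \<tau> u"
proof (rule sob_norm_le_multiple)
  fix j assume j: "j \<in> freq_idx K"
  have "bracket j powr \<sigma> * cmod (y j) \<le> bracket j powr \<sigma> * (A * (bracket j powr \<mu> * cmod (u j)))"
    by (intro mult_left_mono assms j) simp
  also have "\<dots> = A * (bracket j powr (\<sigma> + \<mu>) * cmod (u j))"
    by (simp add: powr_add)
  also have "\<dots> \<le> A * (bracket j powr \<tau> * cmod (u j))"
    using assms bracket_ge_1 by (intro mult_left_mono mult_right_mono powr_mono) auto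
  finally show "bracket j powr \<sigma> * cmod (y j) \<le> A * (bracket j powr \<tau> * cmod (u j))" .
qed (use assms in auto)

lemma sob_norm_bounded_multiplier:
  assumes "\<And>j. j \<in> freq_idx K \<Longrightarrow> cmod (y j) \<le> A * cmod (u j)" and "0 \<le> A" "\<sigma> \<le> \<tau>"
  shows "sob_norm K \<sigma> y \<le> A * sob_norm K \<tau> u"
proof (rule sob_norm_multiplier[where \<mu> = 0])
  show "cmod (y j) \<le> A * (bracket j powr 0 * cmod (u j))" if "j \<in> freq_idx K" for j
    using assms(1)[OF that] bracket_pos[of j] by simp
qed (use assms in auto)

lemma sob_norm_mono: "\<sigma> \<le> \<tau> \<Longrightarrow> sob_norm K \<sigma> y \<le> sob_norm K \<tau> y"
  using sob_norm_bounded_multiplier[of K y 1 y \<sigma> \<tau>] by simp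

lemma sob_norm_scale: "sob_norm K \<sigma> (\<lambda>j. c * y j) = cmod c * sob_norm K \<sigma> y"
  by (simp add: sob_norm_L2_set L2_set_right_distrib norm_mult mult.left_commute)

text \<open>
  A mode with \<open>h\<langle>j\<rangle> \<ge> 1\<close> is controlled by the stronger norm, one with \<open>h\<langle>j\<rangle> \<le> 1\<close> by the
  weaker norm; so a power of \<open>h\<close> can be traded for derivatives continuously.
\<close>
lemma sob_norm_interpolate:
  assumes "0 < h" "0 \<le> \<theta>" "\<theta> \<le> 1"
  shows "sob_norm K (r + 1 - \<theta>) e \<le> h powr \<theta> * (sob_norm K (r + 1) e + sob_norm K r e / h)"
proof -
  have "bracket j powr (r + 1 - \<theta>) * cmod (e j)
     \<le> h powr \<theta> * (bracket j powr (r + 1) * cmod (e j)) + (h powr \<theta> / h) * (bracket j powr r * cmod (e j))" for j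
  proof -
    define b where "b = bracket j"
    have b: "0 < b" using bracket_pos by (simp add: b_def)
    have "(1 / (h * b)) powr \<theta> \<le> 1 + 1 / (h * b)"
    proof (cases "1 / (h * b) \<le> 1")
      case True
      hence "(1 / (h * b)) powr \<theta> \<le> 1 powr \<theta>"
        by (intro powr_mono2) (use assms b in auto)
      moreover have "0 \<le> 1 / (h * b)" using assms b by simp
      ultimately show ?thesis unfolding powr_one_eq_one by linarith
    next
      case False
      hence "(1 / (h * b)) powr \<theta> \<le> (1 / (h * b)) powr 1"
        by (intro powr_mono) (use assms b in auto)
      thus ?thesis using False by (simp add: assms b less_imp_le)
    qed
    also have "(1 / (h * b)) powr \<theta> = b powr (- \<theta>) / h powr \<theta>"
      using assms b by (simp add: powr_divide powr_mult powr_minus field_simps)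
    finally have "b powr (- \<theta>) \<le> h powr \<theta> * (1 + 1 / (h * b))"
      using assms by (simp add: field_simps)
    hence "b powr (r + 1) * cmod (e j) * b powr (- \<theta>)
        \<le> b powr (r + 1) * cmod (e j) * (h powr \<theta> * (1 + 1 / (h * b)))"
      by (intro mult_left_mono) auto
    moreover have "b powr (r + 1) * cmod (e j) * b powr (- \<theta>) = b powr (r + 1 - \<theta>) * cmod (e j)"
      by (simp add: mult_ac flip: powr_add)
    moreover have "b powr (r + 1) * cmod (e j) * (h powr \<theta> * (1 + 1 / (h * b)))
        = h powr \<theta> * (b powr (r + 1) * cmod (e j)) + (h powr \<theta> / h) * (b powr (r + 1) / b * cmod (e j))"
      using b assms by (simp add: field_simps)
    moreover have "b powr (r + 1) / b = b powr r"
      using b by (simp add: powr_add)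
    ultimately show ?thesis unfolding b_def[symmetric] by simp
  qed
  from sob_norm_le_combination[OF this] assms show ?thesis
    by (simp add: distrib_left)
qed

text \<open>
  The mean value inequality holds for the norm because it holds for every linear functional; the
  functional that represents the increment in the weighted inner product attains its norm.
\<close>
lemma sob_norm_mean_value:
  fixes v v' :: "real \<Rightarrow> int \<Rightarrow> complex"
  assumes "a \<le> b"
    and deriv: "\<And>j t. j \<in> freq_idx K \<Longrightarrow> t \<in> {a..b} \<Longrightarrow>
      ((\<lambda>\<tau>. v \<tau> j) has_vector_derivative v' t j) (at t within {a..b})"
    and bound: "\<And>t. t \<in> {a..b} \<Longrightarrow> sob_norm K \<sigma> (v' t) \<le> B"
  shows "sob_norm K \<sigma> (\<lambda>j. v b j - v a j) \<le> B * (b - a)"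
proof -
  define u where "u = (\<lambda>j. v b j - v a j)"
  define w where "w = (\<lambda>j. of_real ((bracket j powr \<sigma>)\<^sup>2) * cnj (u j))"
  define S where "S = sob_norm K \<sigma> u"
  have B: "0 \<le> B" using bound[of a] assms(1) order_trans[OF sob_norm_nonneg] by auto
  let ?F = "\<lambda>t. \<Sum>j\<in>freq_idx K. w j * v t j"
  have "(?F has_vector_derivative (\<Sum>j\<in>freq_idx K. w j * v' t j)) (at t within {a..b})"
    if "t \<in> {a..b}" for t
    by (intro has_vector_derivative_sum has_vector_derivative_mult_right deriv that)
  hence dF: "(?F has_derivative (\<lambda>x. x *\<^sub>R (\<Sum>j\<in>freq_idx K. w j * v' t j))) (at t within {a..b})"
    if "t \<in> {a..b}" for t using that by (simp add: has_vector_derivative_def)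
  have bF: "cmod (\<Sum>j\<in>freq_idx K. w j * v' t j) \<le> S * B" if "t \<in> {a..b}" for t
  proof -
    have "cmod (\<Sum>j\<in>freq_idx K. w j * v' t j)
       \<le> (\<Sum>j\<in>freq_idx K. \<bar>bracket j powr \<sigma> * cmod (u j)\<bar> * \<bar>bracket j powr \<sigma> * cmod (v' t j)\<bar>)"
      by (rule order_trans[OF norm_sum])
        (simp add: w_def norm_mult power2_eq_square mult_ac abs_mult)
    also have "\<dots> \<le> S * sob_norm K \<sigma> (v' t)"
      unfolding S_def sob_norm_L2_set by (rule L2_set_mult_ineq)
    also have "\<dots> \<le> S * B" by (intro mult_left_mono bound that) (simp add: S_def)
    finally show ?thesis .
  qed
  have "cmod (?F b - ?F a) \<le> S * B * norm (b - a)"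
  proof (rule differentiable_bound[OF _ dF])
    show "onorm (\<lambda>x. x *\<^sub>R (\<Sum>j\<in>freq_idx K. w j * v' t j)) \<le> S * B" if "t \<in> {a..b}" for t
      by (rule onorm_le) (use bF[OF that] in \<open>auto simp: mult.commute intro!: mult_left_mono\<close>)
  qed (use assms(1) in auto)
  also have "?F b - ?F a = (\<Sum>j\<in>freq_idx K. w j * u j)"
    by (simp add: u_def algebra_simps flip: sum_subtractf)
  also have "\<dots> = of_real (S\<^sup>2)"
  proof -
    have "w j * u j = of_real ((bracket j powr \<sigma> * cmod (u j))\<^sup>2)" for j
      using complex_norm_square[of "u j"] by (simp add: w_def power_mult_distrib mult_ac)
    moreover have "S\<^sup>2 = (\<Sum>j\<in>freq_idx K. (bracket j powr \<sigma> * cmod (u j))\<^sup>2)"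
      by (simp add: S_def sob_norm_L2_set L2_set_def sum_nonneg)
    ultimately show ?thesis by simp
  qed
  finally have "S * S \<le> S * (B * (b - a))" 
    using assms(1) by (simp add: power2_eq_square norm_mult mult_ac)
  moreover have "0 \<le> S" by (simp add: S_def)
  ultimately have "S \<le> B * (b - a)"
    using B assms(1) by (cases "S = 0") auto
  thus ?thesis by (simp add: S_def u_def)
qed

lemma le_of_square_le_mult:
  fixes S B :: real
  shows "0 \<le> S \<Longrightarrow> 0 \<le> B \<Longrightarrow> S * S \<le> S * B \<Longrightarrow> S \<le> B"
  by (cases "S = 0") (auto simp: mult_le_cancel_left)

section \<open>Discrete convolution\<close>

text \<open>
  The representative modulo \<open>2K\<close> in the index set.
\<close>
definition residue_idx :: "nat \<Rightarrow> int \<Rightarrow> int" where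
  "residue_idx K m = (m + int K) mod (2 * int K) - int K"

lemma residue_idx_in: "1 \<le> K \<Longrightarrow> residue_idx K m \<in> freq_idx K"
  using pos_mod_bound[of "2 * int K" "m + int K"] pos_mod_sign[of "2 * int K" "m + int K"]
  by (auto simp: residue_idx_def freq_idx_def)

lemma residue_idx_id: "j \<in> freq_idx K \<Longrightarrow> residue_idx K j = j"
  by (simp add: residue_idx_def freq_idx_def mod_pos_pos_trivial)

lemma residue_idx_mod: "residue_idx K m mod (2 * int K) = m mod (2 * int K)"
  unfolding residue_idx_def by (simp add: mod_diff_left_eq)

lemma residue_idx_cong:
  assumes "m mod (2 * int K) = n mod (2 * int K)"
  shows "residue_idx K m = residue_idx K n"
  unfolding residue_idx_def using mod_add_cong[OF assms refl, of "int K"] by simp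

lemma residue_idx_diff_residue [simp]:
  "residue_idx K (m - residue_idx K n) = residue_idx K (m - n)"
  by (rule residue_idx_cong) (metis residue_idx_mod mod_diff_right_eq)

lemma residue_idx_residue_diff [simp]:
  "residue_idx K (residue_idx K m - n) = residue_idx K (m - n)"
  by (rule residue_idx_cong) (metis residue_idx_mod mod_diff_left_eq)

lemma residue_idx_residue_add [simp]:
  "residue_idx K (residue_idx K m + n) = residue_idx K (m + n)"
  by (rule residue_idx_cong) (metis residue_idx_mod mod_add_left_eq)

lemma residue_idx_add_residue [simp]:
  "residue_idx K (m + residue_idx K n) = residue_idx K (m + n)"
  by (rule residue_idx_cong) (metis residue_idx_mod mod_add_right_eq)

text \<open>
  The index set consists of representatives of smallest modulus, so aliasing never raises a
  frequency. Therefore the discrete convolution satisfies the same product estimates as the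
  product of functions, with constants independent of \<open>K\<close>.
\<close>
lemma abs_residue_idx_le: "1 \<le> K \<Longrightarrow> \<bar>residue_idx K m\<bar> \<le> \<bar>m\<bar>"
proof (cases "m \<in> freq_idx K")
  case False
  assume "1 \<le> K"
  hence "residue_idx K m \<in> freq_idx K" by (rule residue_idx_in)
  with False show ?thesis by (auto simp: freq_idx_def)
qed (simp add: residue_idx_id)

lemma bracket_residue_minus:
  assumes "1 \<le> K" "k \<in> freq_idx K"
  shows "bracket (residue_idx K (- k)) = bracket k"
proof -
  have "\<bar>residue_idx K (- k)\<bar> \<le> \<bar>k\<bar>" using abs_residue_idx_le[OF assms(1), of "- k"] by simp
  moreover have "\<bar>residue_idx K (- residue_idx K (- k))\<bar> \<le> \<bar>residue_idx K (- k)\<bar>"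
    using abs_residue_idx_le[OF assms(1), of "- residue_idx K (- k)"] by simp
  moreover have "residue_idx K (- residue_idx K (- k)) = k"
    using residue_idx_diff_residue[of K 0 "- k"] residue_idx_id[OF assms(2)] by simp
  ultimately show ?thesis by (simp add: bracket_def)
qed

lemma bracket_le_sum:
  assumes "1 \<le> K" "j \<in> freq_idx K"
  shows "bracket j \<le> bracket k + bracket (residue_idx K (j - k))"
proof -
  have "\<bar>residue_idx K (k + residue_idx K (j - k))\<bar> \<le> \<bar>k + residue_idx K (j - k)\<bar>"
    by (rule abs_residue_idx_le[OF assms(1)])
  hence "\<bar>j\<bar> \<le> \<bar>k\<bar> + \<bar>residue_idx K (j - k)\<bar>" by (simp add: residue_idx_id[OF assms(2)])
  thus ?thesis unfolding bracket_def by linarith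
qed

lemma sum_residue_reflect:
  assumes "1 \<le> K"
  shows "(\<Sum>k\<in>freq_idx K. g (residue_idx K (m - k)) k) = (\<Sum>k\<in>freq_idx K. g k (residue_idx K (m - k)))"
  by (rule sum.reindex_bij_witness[where i = "\<lambda>k. residue_idx K (m - k)" and j = "\<lambda>k. residue_idx K (m - k)"])
    (use assms in \<open>auto simp: residue_idx_in residue_idx_id\<close>)

lemma sum_residue_shift:
  assumes "1 \<le> K"
  shows "(\<Sum>j\<in>freq_idx K. g j (residue_idx K (j - k))) = (\<Sum>l\<in>freq_idx K. g (residue_idx K (l + k)) l)"
  by (rule sum.reindex_bij_witness[where i = "\<lambda>l. residue_idx K (l + k)" and j = "\<lambda>j. residue_idx K (j - k)"])
    (use assms in \<open>auto simp: residue_idx_in residue_idx_id\<close>)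

lemma disc_conv_altdef:
  assumes "1 \<le> K"
  shows "disc_conv K y z j = (\<Sum>k\<in>freq_idx K. y k * z (residue_idx K (j - k)))"
proof -
  have eq: "{(k, l). k \<in> freq_idx K \<and> l \<in> freq_idx K \<and> (k + l) mod (2 * int K) = j mod (2 * int K)}
     = (\<lambda>k. (k, residue_idx K (j - k))) ` freq_idx K" (is "?A = ?B")
  proof (intro set_eqI iffI)
    fix x assume "x \<in> ?A"
    then obtain k l where x: "x = (k, l)" "k \<in> freq_idx K" "l \<in> freq_idx K"
      "(k + l) mod (2 * int K) = j mod (2 * int K)" by auto
    have "l mod (2 * int K) = (j - k) mod (2 * int K)"
      using x(4) by (metis add_diff_cancel_left' mod_diff_left_eq)
    hence "l = residue_idx K (j - k)" using residue_idx_cong residue_idx_id[OF x(3)] by metis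
    thus "x \<in> ?B" using x by auto
  next
    fix x assume "x \<in> ?B"
    then obtain k where k: "x = (k, residue_idx K (j - k))" "k \<in> freq_idx K" by auto
    have "(k + residue_idx K (j - k)) mod (2 * int K) = j mod (2 * int K)"
      by (metis add.commute diff_add_cancel mod_add_right_eq residue_idx_mod)
    thus "x \<in> ?A" using k residue_idx_in[OF assms] by auto
  qed
  show ?thesis unfolding disc_conv_def eq
    by (subst sum.reindex) (auto simp: inj_on_def)
qed

lemma disc_conv_commute: "disc_conv K y z = disc_conv K z y"
  unfolding disc_conv_def
  by (rule ext, rule sum.reindex_bij_witness[where i = prod.swap and j = prod.swap])
    (auto simp: add.commute mult.commute)

lemma disc_conv_diff:
  "disc_conv K y u j - disc_conv K z v j
     = disc_conv K y (\<lambda>j. u j - v j) j + disc_conv K (\<lambda>j. y j - z j) v j"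
  unfolding disc_conv_def
  by (simp add: algebra_simps sum.distrib sum_subtractf case_prod_unfold flip: sum.distrib)

lemma sum_bracket_inverse_square_le:
  "(\<Sum>k\<in>freq_idx K. (1 / bracket k)\<^sup>2) \<le> 5"
proof -
  \<comment> \<open>The differences of \<open>3/K\<close> dominate the two terms that enter with each new \<open>K\<close>.\<close>
  have "K \<ge> 1 \<Longrightarrow> (\<Sum>k\<in>freq_idx K. (1 / bracket k)\<^sup>2) \<le> 5 - 3 / real K"
  proof (induction K rule: nat_induct_at_least)
    case base
    have "freq_idx 1 = {-1, 0}" by (auto simp: freq_idx_def)
    thus ?case by (simp add: bracket_def)
  next
    case (Suc n)
    have split: "freq_idx (Suc n) = insert (- int n - 1) (insert (int n) (freq_idx n))"
      by (auto simp: freq_idx_def)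
    have "bracket (- int n - 1) = real n + 1" "bracket (int n) = real n"
      using Suc.hyps by (auto simp: bracket_def)
    moreover have "- int n - 1 \<noteq> int n" "- int n - 1 \<notin> freq_idx n" "int n \<notin> freq_idx n"
      by (auto simp: freq_idx_def)
    ultimately have "(\<Sum>k\<in>freq_idx (Suc n). (1 / bracket k)\<^sup>2)
        = (1 / (real n + 1))\<^sup>2 + ((1 / real n)\<^sup>2 + (\<Sum>k\<in>freq_idx n. (1 / bracket k)\<^sup>2))"
      unfolding split by simp
    also have "\<dots> \<le> (1 / (real n + 1))\<^sup>2 + ((1 / real n)\<^sup>2 + (5 - 3 / real n))"
      using Suc.IH by simp
    also have "\<dots> \<le> 5 - 3 / real (Suc n)"
    proof -
      have "(1 / (real n + 1))\<^sup>2 + (1 / real n)\<^sup>2 \<le> 3 / real n - 3 / (real n + 1)"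
      proof -
        have n: "1 \<le> real n" using Suc.hyps by simp
        have "3 / real n - 3 / (real n + 1) - ((1 / (real n + 1))\<^sup>2 + (1 / real n)\<^sup>2)
          = (real n * real n + real n - 1) / ((real n)\<^sup>2 * (real n + 1)\<^sup>2)"
          using n by (simp add: divide_simps) (simp add: power2_eq_square algebra_simps)
        also have "\<dots> \<ge> 0" using n mult_mono[of 1 "real n" 1 "real n"] by auto
        finally show ?thesis by simp
      qed
      thus ?thesis by (simp add: add.commute)
    qed
    finally show ?case .
  qed
  moreover have "freq_idx 0 = {}" by (auto simp: freq_idx_def)
  moreover have "0 \<le> 3 / real K" by simp
  ultimately show ?thesis by (cases "K = 0") (simp, linarith)
qed

text \<open>
  At least one of the two input frequencies is half the output frequency \<open>x\<close> or larger, and its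
  weight pays for \<open>x\<^sup>\<sigma>\<close>. What then remains is a weight of order at least one on the smaller
  input frequency; its square is summable.
\<close>
lemma convolution_weight_le:
  fixes x y z :: real
  assumes "0 < x" "x \<le> y + z" "1 \<le> y" "1 \<le> z" "0 \<le> \<sigma>" "\<sigma> \<le> a" "1 \<le> a"
  shows "(x powr \<sigma> * y powr (- a) * z powr (- \<sigma>))\<^sup>2 \<le> 4 powr a * ((1 / y)\<^sup>2 + (1 / z)\<^sup>2)"
proof -
  have weight: "m powr \<sigma> * y powr (- a) * z powr (- \<sigma>) \<le> max (1 / y) (1 / z)" if m: "m = max y z" for m
  proof (cases "y \<le> z")
    case True
    have "m powr \<sigma> * y powr (- a) * z powr (- \<sigma>) = y powr (- a)"
      using True assms m by (simp add: powr_minus field_simps)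
    also have "\<dots> \<le> y powr (- 1)" by (rule powr_mono) (use assms in auto)
    finally show ?thesis using assms by (simp add: powr_minus_divide)
  next
    case False
    have "m powr \<sigma> * y powr (- a) * z powr (- \<sigma>) = y powr (\<sigma> - a) * z powr (- \<sigma>)"
      using False assms m by (simp add: powr_diff powr_minus field_simps)
    also have "\<dots> \<le> z powr (\<sigma> - a) * z powr (- \<sigma>)"
      by (intro mult_right_mono powr_mono2') (use False assms in auto)
    also have "\<dots> = z powr (- a)" by (simp flip: powr_add)
    also have "\<dots> \<le> z powr (- 1)" by (rule powr_mono) (use assms in auto)
    finally show ?thesis using assms by (simp add: powr_minus_divide)
  qed
  define m where "m = max y z"
  have "x powr \<sigma> \<le> (2 * m) powr \<sigma>" by (rule powr_mono2) (use assms m_def in auto)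
  also have "\<dots> = 2 powr \<sigma> * m powr \<sigma>" by (rule powr_mult)
  also have "\<dots> \<le> 2 powr a * m powr \<sigma>"
    by (intro mult_right_mono powr_mono) (use assms in auto)
  finally have "x powr \<sigma> * (y powr (- a) * z powr (- \<sigma>)) \<le> 2 powr a * m powr \<sigma> * (y powr (- a) * z powr (- \<sigma>))"
    by (rule mult_right_mono) simp
  also have "\<dots> \<le> 2 powr a * max (1 / y) (1 / z)"
    using mult_left_mono[OF weight[OF m_def], of "2 powr a"] by (simp add: mult_ac)
  finally have "(x powr \<sigma> * (y powr (- a) * z powr (- \<sigma>)))\<^sup>2 \<le> (2 powr a * max (1 / y) (1 / z))\<^sup>2"
    by (rule power_mono) simp
  also have "\<dots> = 4 powr a * (max (1 / y) (1 / z))\<^sup>2"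
    using powr_mult[of 2 2 a] by (simp add: power2_eq_square mult_ac)
  also have "\<dots> \<le> 4 powr a * ((1 / y)\<^sup>2 + (1 / z)\<^sup>2)"
    by (intro mult_left_mono) (auto simp: max_def)
  finally show ?thesis by (simp add: mult_ac)
qed

text \<open>
  By the Cauchy-Schwarz inequality in each output mode, against the square summable weights of
  the preceding lemma. The remaining double sum factorizes.
\<close>
lemma sob_norm_disc_conv_nonneg_index:
  assumes "1 \<le> K" "1 \<le> a" "0 \<le> \<sigma>" "\<sigma> \<le> a"
  shows "sob_norm K \<sigma> (disc_conv K u e) \<le> 4 * 2 powr a * sob_norm K a u * sob_norm K \<sigma> e"
proof -
  let ?I = "freq_idx K" and ?r = "residue_idx K"
  define U E where "U = (\<lambda>k. bracket k powr a * cmod (u k))"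
    and "E = (\<lambda>l. bracket l powr \<sigma> * cmod (e l))"
  have pw: "bracket j powr \<sigma> * cmod (disc_conv K u e j)
      \<le> (4 * 2 powr a) * L2_set (\<lambda>k. U k * E (?r (j - k))) ?I" if j: "j \<in> ?I" for j
  proof -
    define W where "W = (\<lambda>k. bracket j powr \<sigma> * bracket k powr (- a) * bracket (?r (j - k)) powr (- \<sigma>))"
    have "bracket j powr \<sigma> * cmod (disc_conv K u e j)
        \<le> bracket j powr \<sigma> * (\<Sum>k\<in>?I. cmod (u k * e (?r (j - k))))"
      unfolding disc_conv_altdef[OF assms(1)] by (intro mult_left_mono norm_sum) simp
    also have "\<dots> = (\<Sum>k\<in>?I. \<bar>W k\<bar> * \<bar>U k * E (?r (j - k))\<bar>)"
      unfolding sum_distrib_left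
      by (rule sum.cong) (use bracket_pos in \<open>simp_all add: W_def U_def E_def norm_mult abs_mult powr_minus field_simps less_imp_neq[symmetric]\<close>)
    also have "\<dots> \<le> L2_set W ?I * L2_set (\<lambda>k. U k * E (?r (j - k))) ?I"
      by (rule L2_set_mult_ineq)
    also have "\<dots> \<le> (4 * 2 powr a) * L2_set (\<lambda>k. U k * E (?r (j - k))) ?I"
    proof (rule mult_right_mono)
      have "(\<Sum>k\<in>?I. (W k)\<^sup>2) \<le> (\<Sum>k\<in>?I. 4 powr a * ((1 / bracket k)\<^sup>2 + (1 / bracket (?r (j - k)))\<^sup>2))"
        unfolding W_def
        by (intro sum_mono convolution_weight_le) (use assms j bracket_pos bracket_ge_1 bracket_le_sum in auto)
      also have "\<dots> = 4 powr a * ((\<Sum>k\<in>?I. (1 / bracket k)\<^sup>2) + (\<Sum>k\<in>?I. (1 / bracket (?r (j - k)))\<^sup>2))"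
        by (simp add: sum_distrib_left sum.distrib distrib_left)
      also have "(\<Sum>k\<in>?I. (1 / bracket (?r (j - k)))\<^sup>2) = (\<Sum>k\<in>?I. (1 / bracket k)\<^sup>2)"
        using sum_residue_reflect[OF assms(1), of "\<lambda>l k. (1 / bracket l)\<^sup>2" j] by simp
      also have "4 powr a * ((\<Sum>k\<in>?I. (1 / bracket k)\<^sup>2) + (\<Sum>k\<in>?I. (1 / bracket k)\<^sup>2)) \<le> 4 powr a * 16"
        using sum_bracket_inverse_square_le[of K] by (intro mult_left_mono) auto
      also have "\<dots> = (4 * 2 powr a)\<^sup>2"
        using powr_mult[of 2 2 a] by (simp add: power2_eq_square mult_ac)
      finally show "L2_set W ?I \<le> 4 * 2 powr a"
        unfolding L2_set_def by (rule real_le_lsqrt[rotated]) simp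
    qed simp
    finally show ?thesis .
  qed
  have "sob_norm K \<sigma> (disc_conv K u e) \<le> (4 * 2 powr a) * L2_set (\<lambda>j. L2_set (\<lambda>k. U k * E (?r (j - k))) ?I) ?I"
    unfolding sob_norm_L2_set
    using L2_set_mono[of ?I, OF pw] by (simp add: L2_set_right_distrib)
  also have "L2_set (\<lambda>j. L2_set (\<lambda>k. U k * E (?r (j - k))) ?I) ?I = L2_set U ?I * L2_set E ?I"
  proof -
    have "(\<Sum>j\<in>?I. \<Sum>k\<in>?I. (U k * E (?r (j - k)))\<^sup>2) = (\<Sum>k\<in>?I. \<Sum>j\<in>?I. (U k * E (?r (j - k)))\<^sup>2)"
      by (rule sum.swap)
    also have "\<dots> = (\<Sum>k\<in>?I. \<Sum>l\<in>?I. (U k * E l)\<^sup>2)"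
      by (intro sum.cong sum_residue_shift[OF assms(1), of "\<lambda>j l. (U _ * E l)\<^sup>2"] refl)
    also have "\<dots> = (\<Sum>k\<in>?I. (U k)\<^sup>2) * (\<Sum>l\<in>?I. (E l)\<^sup>2)"
      by (simp add: power_mult_distrib sum_product)
    finally show ?thesis by (simp add: L2_set_def sum_nonneg real_sqrt_mult)
  qed
  finally show ?thesis by (simp add: U_def E_def sob_norm_L2_set mult_ac)
qed

text \<open>
  The weights of the preceding proof are not summable for negative \<open>\<sigma>\<close>. But the adjoint of the
  convolution with \<open>u\<close> is the convolution with a reflection of \<open>u\<close>, which has the same norm, so this
  case is dual to the case of positive \<open>\<sigma>\<close>.
\<close>
lemma sob_norm_disc_conv:
  assumes "1 \<le> K" "1 \<le> a" "\<bar>\<sigma>\<bar> \<le> a"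
  shows "sob_norm K \<sigma> (disc_conv K u e) \<le> 4 * 2 powr a * sob_norm K a u * sob_norm K \<sigma> e"
proof (cases "0 \<le> \<sigma>")
  case True
  thus ?thesis using sob_norm_disc_conv_nonneg_index assms by simp
next
  case False
  let ?I = "freq_idx K" and ?r = "residue_idx K"
  define v where "v = disc_conv K u e"
  define S where "S = sob_norm K \<sigma> v"
  \<comment> \<open>The dual vector that attains the norm of \<open>v\<close>.\<close>
  define w where "w = (\<lambda>j. complex_of_real ((bracket j powr \<sigma>)\<^sup>2 * cmod (v j)))"
  define u' where "u' = (\<lambda>k. complex_of_real (cmod (u (?r (- k)))))"
  have cw: "cmod (w j) = (bracket j powr \<sigma>)\<^sup>2 * cmod (v j)" for j
    unfolding w_def norm_of_real by simp
  have w_norm: "sob_norm K (- \<sigma>) w = S"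
  proof -
    have "bracket j powr (- \<sigma>) * cmod (w j) = bracket j powr \<sigma> * cmod (v j)" for j
      using bracket_pos[of j] by (simp add: cw powr_minus power2_eq_square)
    thus ?thesis by (simp add: S_def sob_norm_L2_set)
  qed
  have u'_norm: "sob_norm K a u' = sob_norm K a u"
  proof -
    have "(\<Sum>k\<in>?I. (bracket k powr a * cmod (u' k))\<^sup>2)
      = (\<Sum>k\<in>?I. (bracket (?r (0 - k)) powr a * cmod (u (?r (0 - k))))\<^sup>2)"
      by (intro sum.cong) (simp_all add: u'_def bracket_residue_minus[OF assms(1)])
    also have "\<dots> = (\<Sum>k\<in>?I. (bracket k powr a * cmod (u k))\<^sup>2)"
      by (rule sum_residue_reflect[OF assms(1), of "\<lambda>l k. (bracket l powr a * cmod (u l))\<^sup>2" 0])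
    finally show ?thesis by (simp add: sob_norm_L2_set L2_set_def)
  qed
  have "S\<^sup>2 = (\<Sum>j\<in>?I. cmod (w j) * cmod (v j))"
    by (simp add: S_def sob_norm_L2_set L2_set_def sum_nonneg cw power_mult_distrib power2_eq_square mult_ac)
  also have "\<dots> \<le> (\<Sum>j\<in>?I. cmod (w j) * (\<Sum>k\<in>?I. cmod (u k) * cmod (e (?r (j - k)))))"
    unfolding v_def disc_conv_altdef[OF assms(1)]
    by (intro sum_mono mult_left_mono order_trans[OF norm_sum]) (auto simp: norm_mult)
  also have "\<dots> = (\<Sum>k\<in>?I. \<Sum>j\<in>?I. cmod (w j) * (cmod (u k) * cmod (e (?r (j - k)))))"
    unfolding sum_distrib_left by (rule sum.swap)
  also have "\<dots> = (\<Sum>k\<in>?I. \<Sum>l\<in>?I. cmod (w (?r (l + k))) * (cmod (u k) * cmod (e l)))"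
    by (intro sum.cong sum_residue_shift[OF assms(1), of "\<lambda>j l. cmod (w j) * (cmod (u _) * cmod (e l))"] refl)
  also have "\<dots> = (\<Sum>l\<in>?I. cmod (e l) * (\<Sum>k\<in>?I. cmod (u k) * cmod (w (?r (l + k)))))"
    unfolding sum_distrib_left by (subst sum.swap) (simp add: mult_ac)
  also have "\<dots> = (\<Sum>l\<in>?I. cmod (e l) * cmod (disc_conv K u' w l))"
  proof (intro sum.cong refl arg_cong2[of _ _ _ _ "(*)"])
    fix l assume l: "l \<in> ?I"
    define X where "X = (\<Sum>k\<in>?I. cmod (u k) * cmod (w (?r (l + k))))"
    have w_real: "w m = of_real (cmod (w m))" for m
      unfolding cw by (simp add: w_def)
    have "disc_conv K u' w l = (\<Sum>k\<in>?I. of_real (cmod (u (?r (0 - k))) * cmod (w (?r (l - k)))))"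
      unfolding disc_conv_altdef[OF assms(1)] by (subst w_real) (simp add: u'_def)
    also have "\<dots> = of_real (\<Sum>k\<in>?I. cmod (u (?r (0 - k))) * cmod (w (?r (l + ?r (0 - k)))))"
      by simp
    also have "(\<Sum>k\<in>?I. cmod (u (?r (0 - k))) * cmod (w (?r (l + ?r (0 - k))))) = X"
      unfolding X_def
      by (rule sum_residue_reflect[OF assms(1), of "\<lambda>k _. cmod (u k) * cmod (w (?r (l + k)))"])
    finally have "cmod (disc_conv K u' w l) = \<bar>X\<bar>"
      by (simp only: norm_of_real)
    moreover have "0 \<le> X" by (simp add: X_def sum_nonneg)
    ultimately show "(\<Sum>k\<in>?I. cmod (u k) * cmod (w (?r (l + k)))) = cmod (disc_conv K u' w l)"
      by (simp add: X_def)
  qed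
  also have "\<dots> = (\<Sum>l\<in>?I. \<bar>bracket l powr \<sigma> * cmod (e l)\<bar> * \<bar>bracket l powr (- \<sigma>) * cmod (disc_conv K u' w l)\<bar>)"
    using bracket_pos by (intro sum.cong) (simp_all add: abs_mult powr_minus field_simps less_imp_neq[symmetric])
  also have "\<dots> \<le> sob_norm K \<sigma> e * sob_norm K (- \<sigma>) (disc_conv K u' w)"
    unfolding sob_norm_L2_set by (rule L2_set_mult_ineq)
  also have "\<dots> \<le> sob_norm K \<sigma> e * (4 * 2 powr a * sob_norm K a u' * sob_norm K (- \<sigma>) w)"
    by (intro mult_left_mono sob_norm_disc_conv_nonneg_index) (use assms False in auto)
  finally have "S * S \<le> S * (4 * 2 powr a * sob_norm K a u * sob_norm K \<sigma> e)"
    by (simp add: w_norm u'_norm power2_eq_square mult_ac)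
  moreover have "0 \<le> S" "0 \<le> 4 * 2 powr a * sob_norm K a u * sob_norm K \<sigma> e"
    by (simp_all add: S_def)
  ultimately have "S \<le> 4 * 2 powr a * sob_norm K a u * sob_norm K \<sigma> e"
    using le_of_square_le_mult by blast
  thus ?thesis by (simp only: S_def v_def)
qed

text \<open>
  For small \<open>s\<close> the \<open>s\<close>-norm is too weak for a product estimate without loss. However, the modes of
  the convolution are bounded by the Cauchy-Schwarz inequality, even with the weight of order \<open>s\<close>,
  and with the weight \<open>1/\<langle>j\<rangle>\<close> a bounded sequence becomes square summable.
\<close>
lemma sob_norm_disc_conv_low:
  assumes "1 \<le> K" "0 \<le> s"
  shows "sob_norm K (s - 1) (disc_conv K v w) \<le> 3 * 2 powr s * sob_norm K s v * sob_norm K s w"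
proof -
  let ?I = "freq_idx K" and ?r = "residue_idx K"
  define B where "B = 2 powr s * sob_norm K s v * sob_norm K s w"
  have B: "0 \<le> B" by (simp add: B_def)
  have pw: "bracket j powr s * cmod (disc_conv K v w j) \<le> B" if j: "j \<in> ?I" for j
  proof -
    have "bracket j powr s \<le> 2 powr s * (bracket k powr s * bracket (?r (j - k)) powr s)" for k
    proof -
      have "bracket j \<le> bracket k + bracket (?r (j - k))" by (rule bracket_le_sum[OF assms(1) j])
      also have "\<dots> \<le> 2 * (bracket k * bracket (?r (j - k)))"
        using mult_left_mono[OF bracket_ge_1[of "?r (j - k)"] bracket_nonneg[of k]]
          mult_right_mono[OF bracket_ge_1[of k] bracket_nonneg[of "?r (j - k)"]] by simp
      finally have "bracket j powr s \<le> (2 * (bracket k * bracket (?r (j - k)))) powr s"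
        by (intro powr_mono2) (use assms in auto)
      thus ?thesis by (simp add: powr_mult)
    qed
    note bj = this
    have "bracket j powr s * cmod (disc_conv K v w j) \<le> (\<Sum>k\<in>?I. bracket j powr s * cmod (v k * w (?r (j - k))))"
      unfolding disc_conv_altdef[OF assms(1)] sum_distrib_left[symmetric] by (intro mult_left_mono norm_sum) simp
    also have "\<dots> \<le> (\<Sum>k\<in>?I. (2 powr s * (bracket k powr s * bracket (?r (j - k)) powr s)) * cmod (v k * w (?r (j - k))))"
      by (intro sum_mono mult_right_mono bj) simp
    also have "\<dots> = 2 powr s * (\<Sum>k\<in>?I. \<bar>bracket k powr s * cmod (v k)\<bar> * \<bar>bracket (?r (j - k)) powr s * cmod (w (?r (j - k)))\<bar>)"
      by (simp add: sum_distrib_left norm_mult abs_mult mult_ac)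
    also have "\<dots> \<le> 2 powr s * (sob_norm K s v * L2_set (\<lambda>k. bracket (?r (j - k)) powr s * cmod (w (?r (j - k)))) ?I)"
      unfolding sob_norm_L2_set[of K s v] by (intro mult_left_mono L2_set_mult_ineq) simp
    also have "L2_set (\<lambda>k. bracket (?r (j - k)) powr s * cmod (w (?r (j - k)))) ?I = sob_norm K s w"
      unfolding sob_norm_L2_set L2_set_def
      using sum_residue_reflect[OF assms(1), of "\<lambda>l k. (bracket l powr s * cmod (w l))\<^sup>2" j] by simp
    finally show ?thesis by (simp add: B_def)
  qed
  have "sob_norm K (s - 1) (disc_conv K v w) \<le> L2_set (\<lambda>j. B * (1 / bracket j)) ?I"
    unfolding sob_norm_L2_set
  proof (rule L2_set_mono)
    fix j assume "j \<in> ?I"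
    from pw[OF this] show "bracket j powr (s - 1) * cmod (disc_conv K v w j) \<le> B * (1 / bracket j)"
      using bracket_pos[of j] by (simp add: powr_diff divide_right_mono)
  qed simp
  also have "\<dots> = B * sqrt (\<Sum>k\<in>?I. (1 / bracket k)\<^sup>2)"
    unfolding L2_set_right_distrib[OF B, symmetric] L2_set_def ..
  also have "\<dots> \<le> B * 3"
    using sum_bracket_inverse_square_le[of K] by (intro mult_left_mono B real_le_lsqrt) auto
  finally show ?thesis by (simp add: B_def mult_ac)
qed

section \<open>The nonlinearity\<close>

text \<open>
  Indexed by the number of convolutions, so that \<open>conv_iter K n y\<close> has \<open>n + 1\<close> factors.
\<close>
definition conv_iter :: "nat \<Rightarrow> nat \<Rightarrow> (int \<Rightarrow> complex) \<Rightarrow> int \<Rightarrow> complex" where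
  "conv_iter K n y = (disc_conv K y ^^ n) y"

lemma conv_iter_simps [simp]:
  "conv_iter K 0 y = y" "conv_iter K (Suc n) y = disc_conv K y (conv_iter K n y)"
  by (simp_all add: conv_iter_def)

lemma conv_power_eq_conv_iter: "conv_power K p y = conv_iter K (p - 1) y"
  by (simp add: conv_power_def conv_iter_def)

lemma sob_norm_conv_iter:
  assumes "1 \<le> K" "1 \<le> a" "sob_norm K a y \<le> R"
  shows "sob_norm K a (conv_iter K n y) \<le> (4 * 2 powr a * R) ^ n * R"
proof (induction n)
  case (Suc n)
  have R: "0 \<le> R" using assms(3) order_trans[OF sob_norm_nonneg] by auto
  have "sob_norm K a (conv_iter K (Suc n) y)
      \<le> 4 * 2 powr a * sob_norm K a y * sob_norm K a (conv_iter K n y)"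
    using sob_norm_disc_conv[OF assms(1,2)] assms(2) by simp
  also have "\<dots> \<le> 4 * 2 powr a * R * ((4 * 2 powr a * R) ^ n * R)"
    using R by (intro mult_mono Suc.IH assms mult_left_mono) auto
  finally show ?case by (simp add: mult_ac)
qed (use assms in simp)

text \<open>
  By the splitting \<open>y\<^bsup>n+1\<^esup> - z\<^bsup>n+1\<^esup> = y (y\<^sup>n - z\<^sup>n) + (y - z) z\<^sup>n\<close>. Boundedness is needed with the
  fixed index \<open>a\<close> only, while the distance may be measured in any norm between \<open>- a\<close> and \<open>a\<close>,
  and with the same constant.
\<close>
lemma sob_norm_conv_iter_diff:
  assumes "1 \<le> K" "1 \<le> a" "\<bar>\<sigma>\<bar> \<le> a" "sob_norm K a y \<le> R" "sob_norm K a z \<le> R"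
  shows "sob_norm K \<sigma> (\<lambda>j. conv_iter K n y j - conv_iter K n z j)
    \<le> real (Suc n) * (4 * 2 powr a * R) ^ n * sob_norm K \<sigma> (\<lambda>j. y j - z j)"
proof (induction n)
  case (Suc n)
  define C where "C = 4 * 2 powr a"
  have R: "0 \<le> R" using assms(4) order_trans[OF sob_norm_nonneg] by auto
  have C: "0 \<le> C" by (simp add: C_def)
  let ?d = "sob_norm K \<sigma> (\<lambda>j. y j - z j)"
  have "sob_norm K \<sigma> (\<lambda>j. conv_iter K (Suc n) y j - conv_iter K (Suc n) z j)
      \<le> sob_norm K \<sigma> (disc_conv K y (\<lambda>j. conv_iter K n y j - conv_iter K n z j))
       + sob_norm K \<sigma> (disc_conv K (\<lambda>j. y j - z j) (conv_iter K n z))"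
    unfolding conv_iter_simps disc_conv_diff by (rule sob_norm_triangle)
  also have "\<dots> \<le> C * R * (real (Suc n) * (C * R) ^ n * ?d) + C * ((C * R) ^ n * R) * ?d"
  proof (rule add_mono)
    have "sob_norm K \<sigma> (disc_conv K y (\<lambda>j. conv_iter K n y j - conv_iter K n z j))
        \<le> C * sob_norm K a y * sob_norm K \<sigma> (\<lambda>j. conv_iter K n y j - conv_iter K n z j)"
      unfolding C_def by (rule sob_norm_disc_conv[OF assms(1-3)])
    also have "\<dots> \<le> C * R * (real (Suc n) * (C * R) ^ n * ?d)"
      using R C Suc.IH unfolding C_def[symmetric] by (intro mult_mono assms) auto
    finally show "sob_norm K \<sigma> (disc_conv K y (\<lambda>j. conv_iter K n y j - conv_iter K n z j))
        \<le> C * R * (real (Suc n) * (C * R) ^ n * ?d)" .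
    have "sob_norm K \<sigma> (disc_conv K (\<lambda>j. y j - z j) (conv_iter K n z))
        \<le> C * sob_norm K a (conv_iter K n z) * ?d"
      using sob_norm_disc_conv[OF assms(1-3)] unfolding C_def disc_conv_commute[of K "\<lambda>j. y j - z j"] .
    also have "\<dots> \<le> C * ((C * R) ^ n * R) * ?d"
      using sob_norm_conv_iter[OF assms(1,2,5)] C unfolding C_def[symmetric]
      by (intro mult_right_mono mult_left_mono) auto
    finally show "sob_norm K \<sigma> (disc_conv K (\<lambda>j. y j - z j) (conv_iter K n z)) \<le> C * ((C * R) ^ n * R) * ?d" .
  qed
  also have "\<dots> = real (Suc (Suc n)) * (C * R) ^ Suc n * ?d"
    by (simp add: algebra_simps)
  finally show ?case by (simp add: C_def)
qed simp

text \<open>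
  The first and the second time derivative of \<open>conv_iter\<close> along a curve with the derivatives \<open>y1\<close>
  and \<open>y2\<close>.
\<close>
primrec conv_iter_d1 :: "nat \<Rightarrow> nat \<Rightarrow> (int \<Rightarrow> complex) \<Rightarrow> (int \<Rightarrow> complex) \<Rightarrow> int \<Rightarrow> complex" where
  "conv_iter_d1 K 0 y y1 = y1"
| "conv_iter_d1 K (Suc n) y y1 =
     (\<lambda>j. disc_conv K y1 (conv_iter K n y) j + disc_conv K y (conv_iter_d1 K n y y1) j)"

primrec conv_iter_d2 ::
  "nat \<Rightarrow> nat \<Rightarrow> (int \<Rightarrow> complex) \<Rightarrow> (int \<Rightarrow> complex) \<Rightarrow> (int \<Rightarrow> complex) \<Rightarrow> int \<Rightarrow> complex" where
  "conv_iter_d2 K 0 y y1 y2 = y2"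
| "conv_iter_d2 K (Suc n) y y1 y2 =
     (\<lambda>j. (disc_conv K y2 (conv_iter K n y) j + disc_conv K y1 (conv_iter_d1 K n y y1) j)
        + (disc_conv K y1 (conv_iter_d1 K n y y1) j + disc_conv K y (conv_iter_d2 K n y y1 y2) j))"

lemma has_vector_derivative_disc_conv:
  assumes "\<And>k. k \<in> freq_idx K \<Longrightarrow> ((\<lambda>\<tau>. u \<tau> k) has_vector_derivative u' k) (at t within S)"
    and "\<And>k. k \<in> freq_idx K \<Longrightarrow> ((\<lambda>\<tau>. v \<tau> k) has_vector_derivative v' k) (at t within S)"
  shows "((\<lambda>\<tau>. disc_conv K (u \<tau>) (v \<tau>) j) has_vector_derivative
    (disc_conv K u' (v t) j + disc_conv K (u t) v' j)) (at t within S)"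
proof -
  have "((\<lambda>\<tau>. disc_conv K (u \<tau>) (v \<tau>) j) has_vector_derivative
     (\<Sum>(k, l) \<in> {(k, l). k \<in> freq_idx K \<and> l \<in> freq_idx K \<and> (k + l) mod (2 * int K) = j mod (2 * int K)}.
       u t k * v' l + u' k * v t l)) (at t within S)"
    unfolding disc_conv_def case_prod_unfold
    by (intro has_vector_derivative_sum has_vector_derivative_mult) (auto intro: assms)
  thus ?thesis
    by (simp add: disc_conv_def case_prod_unfold add.commute flip: sum.distrib)
qed

lemma has_vector_derivative_conv_iter:
  assumes "\<And>k. k \<in> freq_idx K \<Longrightarrow> ((\<lambda>\<tau>. y \<tau> k) has_vector_derivative y1 k) (at t within S)"
    and "j \<in> freq_idx K"
  shows "((\<lambda>\<tau>. conv_iter K n (y \<tau>) j) has_vector_derivative conv_iter_d1 K n (y t) y1 j) (at t within S)"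
  using assms(2)
proof (induction n arbitrary: j)
  case (Suc n)
  show ?case unfolding conv_iter_simps conv_iter_d1.simps
    by (intro has_vector_derivative_disc_conv assms(1) Suc.IH)
qed (simp add: assms(1))

lemma has_vector_derivative_conv_iter_d1:
  assumes "\<And>k. k \<in> freq_idx K \<Longrightarrow> ((\<lambda>\<tau>. y \<tau> k) has_vector_derivative y1 t k) (at t within S)"
    and "\<And>k. k \<in> freq_idx K \<Longrightarrow> ((\<lambda>\<tau>. y1 \<tau> k) has_vector_derivative y2 k) (at t within S)"
    and "j \<in> freq_idx K"
  shows "((\<lambda>\<tau>. conv_iter_d1 K n (y \<tau>) (y1 \<tau>) j) has_vector_derivative
    conv_iter_d2 K n (y t) (y1 t) y2 j) (at t within S)"
  using assms(3)
proof (induction n arbitrary: j)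
  case (Suc n)
  show ?case unfolding conv_iter_d1.simps conv_iter_d2.simps
    by (intro has_vector_derivative_add has_vector_derivative_disc_conv assms(1,2) Suc.IH
        has_vector_derivative_conv_iter)
qed (simp add: assms(2))

lemma sob_norm_conv_iter_d1:
  assumes "0 \<le> s" "0 \<le> R"
  shows "\<exists>B\<ge>0. \<forall>K y y1. 1 \<le> K \<longrightarrow> sob_norm K (s + 1) y \<le> R \<longrightarrow> sob_norm K s y1 \<le> R \<longrightarrow>
    sob_norm K s (conv_iter_d1 K n y y1) \<le> B"
proof (induction n)
  case 0
  show ?case using assms by auto
next
  case (Suc n)
  define C where "C = 4 * 2 powr (s + 1)"
  have C: "0 \<le> C" by (simp add: C_def)
  from Suc obtain B where B: "0 \<le> B"
    "\<And>K y y1. 1 \<le> K \<Longrightarrow> sob_norm K (s + 1) y \<le> R \<Longrightarrow> sob_norm K s y1 \<le> R \<Longrightarrow>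
      sob_norm K s (conv_iter_d1 K n y y1) \<le> B" by blast
  have "sob_norm K s (conv_iter_d1 K (Suc n) y y1) \<le> C * ((C * R) ^ n * R) * R + C * R * B"
    if K: "1 \<le> K" and y: "sob_norm K (s + 1) y \<le> R" and y1: "sob_norm K s y1 \<le> R" for K y y1
  proof -
    have "sob_norm K s (disc_conv K y1 (conv_iter K n y)) \<le> C * sob_norm K (s + 1) (conv_iter K n y) * sob_norm K s y1"
      unfolding C_def disc_conv_commute[of K y1] by (rule sob_norm_disc_conv) (use K assms in auto)
    also have "\<dots> \<le> C * ((C * R) ^ n * R) * R"
      using sob_norm_conv_iter[OF K _ y, of n] y1 C assms unfolding C_def[symmetric]
      by (intro mult_mono) auto
    finally have 1: "sob_norm K s (disc_conv K y1 (conv_iter K n y)) \<le> C * ((C * R) ^ n * R) * R" .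
    have "sob_norm K s (disc_conv K y (conv_iter_d1 K n y y1)) \<le> C * sob_norm K (s + 1) y * sob_norm K s (conv_iter_d1 K n y y1)"
      unfolding C_def by (rule sob_norm_disc_conv) (use K assms in auto)
    also have "\<dots> \<le> C * R * B"
      using B(2)[OF K y y1] y C assms by (intro mult_mono) auto
    finally show ?thesis using 1 unfolding conv_iter_d1.simps
      by (intro order_trans[OF sob_norm_triangle] add_mono)
  qed
  moreover have "0 \<le> C * ((C * R) ^ n * R) * R + C * R * B" using C B(1) assms by simp
  ultimately show ?case by blast
qed

text \<open>
  Two time derivatives cost two space derivatives. The critical term is the product of two first
  derivatives, which lie in the \<open>s\<close>-space only; it loses one derivative, even for \<open>s = 0\<close>.
\<close>
lemma sob_norm_conv_iter_d2:
  assumes "0 \<le> s" "0 \<le> R"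
  shows "\<exists>B\<ge>0. \<forall>K y y1 y2. 1 \<le> K \<longrightarrow> sob_norm K (s + 1) y \<le> R \<longrightarrow> sob_norm K s y1 \<le> R \<longrightarrow>
    sob_norm K (s - 1) y2 \<le> R \<longrightarrow> sob_norm K (s - 1) (conv_iter_d2 K n y y1 y2) \<le> B"
proof (induction n)
  case 0
  show ?case using assms by auto
next
  case (Suc n)
  define C where "C = 4 * 2 powr (s + 1)"
  have C: "0 \<le> C" by (simp add: C_def)
  from Suc obtain B where B: "0 \<le> B"
    "\<And>K y y1 y2. 1 \<le> K \<Longrightarrow> sob_norm K (s + 1) y \<le> R \<Longrightarrow> sob_norm K s y1 \<le> R \<Longrightarrow>
      sob_norm K (s - 1) y2 \<le> R \<Longrightarrow> sob_norm K (s - 1) (conv_iter_d2 K n y y1 y2) \<le> B" by blast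
  from sob_norm_conv_iter_d1[OF assms, of n] obtain B1 where B1: "0 \<le> B1"
    "\<And>K y y1. 1 \<le> K \<Longrightarrow> sob_norm K (s + 1) y \<le> R \<Longrightarrow> sob_norm K s y1 \<le> R \<Longrightarrow>
      sob_norm K s (conv_iter_d1 K n y y1) \<le> B1" by blast
  define D where "D = (C * ((C * R) ^ n * R) * R + 3 * 2 powr s * R * B1) + (3 * 2 powr s * R * B1 + C * R * B)"
  have "sob_norm K (s - 1) (conv_iter_d2 K (Suc n) y y1 y2) \<le> D"
    if K: "1 \<le> K" and y: "sob_norm K (s + 1) y \<le> R" and y1: "sob_norm K s y1 \<le> R"
      and y2: "sob_norm K (s - 1) y2 \<le> R" for K y y1 y2
  proof -
    have "sob_norm K (s - 1) (disc_conv K y2 (conv_iter K n y)) \<le> C * sob_norm K (s + 1) (conv_iter K n y) * sob_norm K (s - 1) y2"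
      unfolding C_def disc_conv_commute[of K y2] by (rule sob_norm_disc_conv) (use K assms in auto)
    also have "\<dots> \<le> C * ((C * R) ^ n * R) * R"
      using sob_norm_conv_iter[OF K _ y, of n] y2 C assms unfolding C_def[symmetric]
      by (intro mult_mono) auto
    finally have 1: "sob_norm K (s - 1) (disc_conv K y2 (conv_iter K n y)) \<le> C * ((C * R) ^ n * R) * R" .
    have "sob_norm K (s - 1) (disc_conv K y1 (conv_iter_d1 K n y y1)) \<le> 3 * 2 powr s * sob_norm K s y1 * sob_norm K s (conv_iter_d1 K n y y1)"
      by (rule sob_norm_disc_conv_low) (use K assms in auto)
    also have "\<dots> \<le> 3 * 2 powr s * R * B1"
      using B1(2)[OF K y y1] y1 assms by (intro mult_mono) auto
    finally have 2: "sob_norm K (s - 1) (disc_conv K y1 (conv_iter_d1 K n y y1)) \<le> 3 * 2 powr s * R * B1" .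
    have "sob_norm K (s - 1) (disc_conv K y (conv_iter_d2 K n y y1 y2)) \<le> C * sob_norm K (s + 1) y * sob_norm K (s - 1) (conv_iter_d2 K n y y1 y2)"
      unfolding C_def by (rule sob_norm_disc_conv) (use K assms in auto)
    also have "\<dots> \<le> C * R * B"
      using B(2)[OF K y y1 y2] y C assms by (intro mult_mono) auto
    finally show ?thesis using 1 2 unfolding conv_iter_d2.simps D_def
      by (intro order_trans[OF sob_norm_triangle] add_mono) 
  qed
  moreover have "0 \<le> D" using C B(1) B1(1) assms by (simp add: D_def)
  ultimately show ?case by blast
qed

section \<open>Modified frequencies\<close>

lemma mult_cos_le_sin:
  fixes x :: real
  assumes "0 \<le> x" "x \<le> pi"
  shows "x * cos x \<le> sin x"
proof -
  have "((\<lambda>x. sin x - x * cos x) has_real_derivative t * sin t) (at t)" for t :: real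
    by (auto intro!: derivative_eq_intros)
  moreover have "0 \<le> t * sin t" if "0 \<le> t" "t \<le> x" for t
    using that assms by (simp add: sin_ge_zero)
  ultimately have "(\<lambda>x. sin x - x * cos x) 0 \<le> (\<lambda>x. sin x - x * cos x) x"
    by (intro DERIV_nonneg_imp_nondecreasing[OF assms(1)]) blast
  thus ?thesis by simp
qed

lemma freq_nonneg [simp]: "0 \<le> freq j" by (simp add: freq_def)

lemma freq_le_bracket: "freq j \<le> bracket j" by (simp add: freq_def bracket_def)

lemma bracket_square_le: "(bracket j)\<^sup>2 \<le> (freq j)\<^sup>2 + 1"
  by (auto simp: bracket_def freq_def max_def)

definition freq_filter :: "real \<Rightarrow> int \<Rightarrow> real" where
  "freq_filter h j = sinc (h * mod_freq h j)"

locale resolved_step =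
  fixes h c0 :: real and K :: nat
  assumes h_pos: "0 < h" and K_ge_1: "1 \<le> K" and hK: "h * real K \<le> c0" and c0_less: "c0 < 2"
begin

text \<open>
  If \<open>w\<close> is the modified frequency, then \<open>sin (h w / 2)\<close> is at most \<open>c0 / 2\<close>, so this is a lower
  bound for the square of \<open>cos (h w / 2)\<close>. It measures how far the phases \<open>h w\<close> stay away from the
  resonance at \<open>\<pi>\<close>, and all constants depend on \<open>c0\<close> through it.
\<close>

definition gap :: real where
  "gap = 1 - c0\<^sup>2 / 4"

lemma c0_pos: "0 < c0"
  using h_pos K_ge_1 hK order.strict_trans2[of 0 "h * real K" c0] by simp

lemma gap_pos: "0 < gap" and gap_le_1: "gap \<le> 1"
proof -
  have "c0\<^sup>2 < 2\<^sup>2" by (rule power_strict_mono) (use c0_pos c0_less in auto)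
  thus "0 < gap" "gap \<le> 1" by (auto simp: gap_def)
qed

context
  fixes j assumes j: "j \<in> freq_idx K"
begin

lemma h_freq: "h * freq j \<le> c0"
proof -
  have "freq j \<le> real K" using j by (auto simp: freq_def freq_idx_def abs_le_iff)
  thus ?thesis using h_pos hK mult_left_mono[of "freq j" "real K" h] by linarith
qed

lemma h_freq_square: "h\<^sup>2 * (freq j)\<^sup>2 \<le> c0\<^sup>2"
  using power_mono[OF h_freq, of 2] h_pos freq_nonneg by (simp add: power_mult_distrib)

lemma mod_freq_nonneg: "0 \<le> mod_freq h j"
  and mod_freq_less: "h * mod_freq h j < pi"
  and cos_mod_freq: "cos (h * mod_freq h j) = 1 - h\<^sup>2 * (freq j)\<^sup>2 / 2"
proof -
  have "0 \<le> mod_freq h j \<and> mod_freq h j < pi / h \<and> cos (h * mod_freq h j) = 1 - h\<^sup>2 * (freq j)\<^sup>2 / 2"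
    unfolding mod_freq_def
    by (rule theI'[OF mod_freq_unique]) (use h_pos h_freq c0_less in auto)
  thus "0 \<le> mod_freq h j" "h * mod_freq h j < pi" "cos (h * mod_freq h j) = 1 - h\<^sup>2 * (freq j)\<^sup>2 / 2"
    using h_pos by (auto simp: field_simps)
qed

lemma half_phase: "0 \<le> (h * mod_freq h j / 2)" "(h * mod_freq h j / 2) \<le> pi / 2"
  using mod_freq_nonneg mod_freq_less h_pos by auto

lemma cos_half_nonneg: "0 \<le> cos (h * mod_freq h j / 2)"
  using half_phase by (intro cos_ge_zero) auto

lemma sin_half: "sin (h * mod_freq h j / 2) = h * freq j / 2"
proof -
  have "1 - 2 * (sin (h * mod_freq h j / 2))\<^sup>2 = cos (h * mod_freq h j)" using cos_double_sin[of "h * mod_freq h j / 2"] by simp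
  hence "(sin (h * mod_freq h j / 2))\<^sup>2 = (h * freq j / 2)\<^sup>2" using cos_mod_freq by (simp add: power_mult_distrib power_divide)
  moreover have "0 \<le> sin (h * mod_freq h j / 2)" using half_phase by (intro sin_ge_zero) auto
  ultimately show ?thesis using h_pos freq_nonneg by (simp add: power2_eq_iff_nonneg)
qed

lemma cos_half_square: "(cos (h * mod_freq h j / 2))\<^sup>2 = 1 - h\<^sup>2 * (freq j)\<^sup>2 / 4"
  by (simp add: cos_squared_eq sin_half power_mult_distrib power_divide)

lemma gap_le_cos_half_square: "gap \<le> (cos (h * mod_freq h j / 2))\<^sup>2"
  unfolding cos_half_square gap_def using h_freq_square by simp

lemma freq_le_mod_freq: "freq j \<le> mod_freq h j"
  using sin_x_le_x[OF half_phase(1)] h_pos by (simp add: sin_half)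

text \<open>
  All comparisons of \<open>w = freq j\<close> with \<open>w' = mod_freq h j\<close> come from \<open>sin (h w' / 2) = h w / 2\<close> and
  \<open>x cos x \<le> sin x \<le> x\<close> at the half phase \<open>x = h w' / 2\<close>.
\<close>
lemma mod_freq_cos_le: "mod_freq h j * cos (h * mod_freq h j / 2) \<le> freq j"
proof -
  have "(h * mod_freq h j / 2) * cos (h * mod_freq h j / 2) \<le> sin (h * mod_freq h j / 2)" using half_phase by (intro mult_cos_le_sin) auto
  thus ?thesis using h_pos by (simp add: sin_half mult.assoc)
qed

lemma mod_freq_square_le: "gap * (mod_freq h j)\<^sup>2 \<le> (freq j)\<^sup>2"
proof -
  have "gap * (mod_freq h j)\<^sup>2 \<le> (cos (h * mod_freq h j / 2))\<^sup>2 * (mod_freq h j)\<^sup>2"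
    using gap_le_cos_half_square by (rule mult_right_mono) simp
  also have "\<dots> = (mod_freq h j * cos (h * mod_freq h j / 2))\<^sup>2" by (simp add: power_mult_distrib)
  also have "\<dots> \<le> (freq j)\<^sup>2"
    using mod_freq_cos_le mod_freq_nonneg cos_half_nonneg by (intro power_mono) auto
  finally show ?thesis .
qed

lemma mod_freq_square_le_bracket: "(mod_freq h j)\<^sup>2 \<le> (bracket j)\<^sup>2 / gap"
proof -
  have "(mod_freq h j)\<^sup>2 \<le> (freq j)\<^sup>2 / gap" using mod_freq_square_le gap_pos by (simp add: field_simps)
  also have "\<dots> \<le> (bracket j)\<^sup>2 / gap"
    using gap_pos freq_le_bracket freq_nonneg by (intro divide_right_mono power_mono) auto
  finally show ?thesis .
qed

lemma mod_freq_square_diff: "0 \<le> (mod_freq h j)\<^sup>2 - (freq j)\<^sup>2"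
  "(mod_freq h j)\<^sup>2 - (freq j)\<^sup>2 \<le> h\<^sup>2 * freq j ^ 4 / (2 * gap)"
proof -
  show "0 \<le> (mod_freq h j)\<^sup>2 - (freq j)\<^sup>2" using freq_le_mod_freq freq_nonneg by (simp add: power_mono)
  have "(cos (h * mod_freq h j / 2))\<^sup>2 \<le> cos (h * mod_freq h j / 2)"
    using cos_half_nonneg cos_le_one[of "h * mod_freq h j / 2"] by (simp add: power2_eq_square mult_left_le)
  hence "1 - cos (h * mod_freq h j / 2) \<le> h\<^sup>2 * (freq j)\<^sup>2 / 4" using cos_half_square by linarith
  hence "mod_freq h j * (1 - cos (h * mod_freq h j / 2)) \<le> mod_freq h j * (h\<^sup>2 * (freq j)\<^sup>2 / 4)"
    by (rule mult_left_mono) (rule mod_freq_nonneg)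
  hence diff: "mod_freq h j - freq j \<le> mod_freq h j * (h\<^sup>2 * (freq j)\<^sup>2 / 4)" using mod_freq_cos_le by (simp add: right_diff_distrib)
  have "(mod_freq h j)\<^sup>2 - (freq j)\<^sup>2 = (mod_freq h j - freq j) * (mod_freq h j + freq j)" by (simp add: power2_eq_square algebra_simps)
  also have "\<dots> \<le> (mod_freq h j * (h\<^sup>2 * (freq j)\<^sup>2 / 4)) * (2 * mod_freq h j)"
    using diff freq_le_mod_freq freq_nonneg mod_freq_nonneg by (intro mult_mono) auto
  also have "\<dots> = (mod_freq h j)\<^sup>2 * (h\<^sup>2 * (freq j)\<^sup>2 / 2)" by (simp add: power2_eq_square)
  also have "\<dots> \<le> ((freq j)\<^sup>2 / gap) * (h\<^sup>2 * (freq j)\<^sup>2 / 2)"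
    using mod_freq_square_le gap_pos by (intro mult_right_mono) (auto simp: field_simps)
  also have "\<dots> = h\<^sup>2 * freq j ^ 4 / (2 * gap)" by (simp add: power2_eq_square power4_eq_xxxx mult_ac)
  finally show "(mod_freq h j)\<^sup>2 - (freq j)\<^sup>2 \<le> h\<^sup>2 * freq j ^ 4 / (2 * gap)" .
qed

lemma sin_mod_freq: "sin (h * mod_freq h j) = h * mod_freq h j * freq_filter h j"
  using h_pos by (simp add: freq_filter_def)

lemma freq_filter_le_1: "freq_filter h j \<le> 1"
  using sin_x_le_x[of "h * mod_freq h j"] h_pos mod_freq_nonneg by (simp add: freq_filter_def divide_le_eq)

lemma one_minus_freq_filter: "1 - freq_filter h j \<le> h\<^sup>2 * (freq j)\<^sup>2 / 2"
proof (cases "mod_freq h j = 0")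
  case False
  hence "0 < h * mod_freq h j" using h_pos mod_freq_nonneg by simp
  moreover have "(h * mod_freq h j) * cos (h * mod_freq h j) \<le> sin (h * mod_freq h j)"
    using mod_freq_nonneg mod_freq_less h_pos by (intro mult_cos_le_sin) auto
  ultimately have "cos (h * mod_freq h j) \<le> freq_filter h j"
    by (simp add: freq_filter_def pos_le_divide_eq mult.commute)
  thus ?thesis using cos_mod_freq by linarith
qed (simp add: freq_filter_def)

lemma gap_le_freq_filter: "gap \<le> freq_filter h j"
proof (cases "mod_freq h j = 0")
  case False
  hence pos: "0 < h * mod_freq h j" using h_pos mod_freq_nonneg by simp
  have "(cos (h * mod_freq h j / 2))\<^sup>2 * (h * mod_freq h j) = 2 * ((h * mod_freq h j / 2) * cos (h * mod_freq h j / 2)) * cos (h * mod_freq h j / 2)" by (simp add: power2_eq_square)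
  also have "\<dots> \<le> 2 * sin (h * mod_freq h j / 2) * cos (h * mod_freq h j / 2)"
    using half_phase by (intro mult_right_mono mult_left_mono mult_cos_le_sin cos_half_nonneg) auto
  also have "\<dots> = sin (h * mod_freq h j)" using sin_double[of "h * mod_freq h j / 2"] by simp
  finally have "(cos (h * mod_freq h j / 2))\<^sup>2 \<le> freq_filter h j"
    using pos by (simp add: freq_filter_def pos_le_divide_eq)
  thus ?thesis using gap_le_cos_half_square by linarith
qed (simp add: freq_filter_def gap_le_1)

lemma freq_filter_pos: "0 < freq_filter h j"
  using gap_pos gap_le_freq_filter by linarith

lemma inverse_freq_filter: "0 \<le> inverse (freq_filter h j) - 1"
  "inverse (freq_filter h j) - 1 \<le> h\<^sup>2 * (freq j)\<^sup>2 / (2 * gap)"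
  "inverse (freq_filter h j) \<le> 1 / gap"
proof -
  have k: "0 < freq_filter h j" by (rule freq_filter_pos)
  have eq: "inverse (freq_filter h j) - 1 = (1 - freq_filter h j) / freq_filter h j"
    using k by (simp add: field_simps)
  show "0 \<le> inverse (freq_filter h j) - 1"
    unfolding eq using k freq_filter_le_1 by simp
  have "(1 - freq_filter h j) / freq_filter h j \<le> (h\<^sup>2 * (freq j)\<^sup>2 / 2) / gap"
    using k one_minus_freq_filter gap_pos gap_le_freq_filter by (intro frac_le) auto
  thus "inverse (freq_filter h j) - 1 \<le> h\<^sup>2 * (freq j)\<^sup>2 / (2 * gap)" unfolding eq by simp
  show "inverse (freq_filter h j) \<le> 1 / gap"
    using gap_pos gap_le_freq_filter by (simp add: inverse_eq_divide frac_le)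
qed

lemma sin_mod_freq_square: "(sin (h * mod_freq h j))\<^sup>2 = h\<^sup>2 * (freq j)\<^sup>2 * (cos (h * mod_freq h j / 2))\<^sup>2"
  unfolding sin_squared_eq cos_mod_freq cos_half_square by (simp add: power2_eq_square algebra_simps)

end

end

section \<open>Influence of the frequencies on the exact solution\<close>

lemma gronwall_linear:
  fixes Q Q' :: "real \<Rightarrow> real"
  assumes "\<And>t. t \<in> {a..b} \<Longrightarrow> (Q has_real_derivative Q' t) (at t within {a..b})"
    and "\<And>t. t \<in> {a..b} \<Longrightarrow> Q' t \<le> A * Q t + B"
    and "1 \<le> A" "0 \<le> B" "t \<in> {a..b}"
  shows "Q t \<le> (Q a + B) * exp (A * (t - a))"
proof -
  let ?R = "\<lambda>t. (Q t + B / A) * exp (- A * (t - a))"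
  have dR: "(?R has_real_derivative (Q' u - A * Q u - B) * exp (- A * (u - a))) (at u within {a..b})"
    if "u \<in> {a..b}" for u
    using assms(3) by (auto intro!: derivative_eq_intros assms(1)[OF that] simp: field_simps)
  have "?R t \<le> ?R a"
  proof -
    have "(?R has_derivative (*) ((Q' u - A * Q u - B) * exp (- A * (u - a)))) (at u within {a..t})"
      if "a \<le> u" "u \<le> t" for u
      unfolding has_field_derivative_def[symmetric]
      by (rule DERIV_subset[OF dR]) (use that assms(5) in auto)
    moreover have "a \<le> t" using assms(5) by simp
    ultimately have "\<exists>u\<in>{a..t}. ?R t - ?R a = (Q' u - A * Q u - B) * exp (- A * (u - a)) * (t - a)"
      using mvt_very_simple[of a t ?R "\<lambda>u. (*) ((Q' u - A * Q u - B) * exp (- A * (u - a)))"] by blast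
    then obtain u where u: "u \<in> {a..t}"
      "?R t - ?R a = (Q' u - A * Q u - B) * exp (- A * (u - a)) * (t - a)" by blast
    have "(Q' u - A * Q u - B) * exp (- A * (u - a)) * (t - a) \<le> 0"
      using assms(2)[of u] u(1) assms(5) by (intro mult_nonpos_nonneg) auto
    thus ?thesis using u(2) by linarith
  qed
  hence "(Q t + B / A) * exp (- (A * (t - a))) * exp (A * (t - a)) \<le> (Q a + B / A) * exp (A * (t - a))"
    by simp
  hence "Q t + B / A \<le> (Q a + B / A) * exp (A * (t - a))"
    by (simp add: mult.assoc flip: exp_add)
  moreover have "B / A \<le> B" "0 \<le> B / A" using assms(3,4) by (auto simp: divide_le_eq mult_left_le_one_le mult_le_cancel_left1)
  moreover have "(Q a + B / A) * exp (A * (t - a)) \<le> (Q a + B) * exp (A * (t - a))"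
    using \<open>B / A \<le> B\<close> by simp
  ultimately show ?thesis by linarith
qed

lemma has_real_derivative_cmod_square:
  assumes "(e has_vector_derivative e') (at t within S)"
  shows "((\<lambda>\<tau>. (cmod (e \<tau>))\<^sup>2) has_real_derivative 2 * (e t \<bullet> e')) (at t within S)"
proof -
  have "(e has_derivative (\<lambda>x. x *\<^sub>R e')) (at t within S)"
    using assms by (simp add: has_vector_derivative_def)
  from has_derivative_inner[OF this this]
  have "((\<lambda>x. e x \<bullet> e x) has_derivative (\<lambda>x. 2 * (e t \<bullet> e') * x)) (at t within S)"
    by (rule has_derivative_eq_rhs) (auto simp: inner_commute algebra_simps)
  thus ?thesis unfolding has_field_derivative_def power2_norm_eq_inner .
qed

text \<open>
  This is where the exponents of the final estimate come from: with \<open>x = h\<^sup>2\<langle>j\<rangle>\<^sup>3\<close>, the inequality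
  \<open>min 1 x \<le> x\<^bsup>\<beta>/2\<^esup>\<close> trades \<open>3\<beta>/2\<close> derivatives for \<open>h\<^sup>\<beta>\<close>.
\<close>
lemma sob_norm_trade:
  assumes "0 < h" "0 \<le> \<beta>" "\<beta> \<le> 2" "0 \<le> c"
    and "\<And>j. j \<in> freq_idx K \<Longrightarrow>
      cmod (v j) \<le> c * (min 1 (h\<^sup>2 * bracket j ^ 3) * (bracket j powr \<mu> * cmod (u j)))"
  shows "sob_norm K (r - 3 * \<beta> / 2) v \<le> c * h powr \<beta> * sob_norm K (r + \<mu>) u"
proof (rule sob_norm_le_multiple)
  fix j assume j: "j \<in> freq_idx K"
  define b where "b = bracket j"
  have b: "0 < b" using bracket_pos by (simp add: b_def)
  define x where "x = h\<^sup>2 * b ^ 3"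
  have x: "0 < x" using b assms(1) by (simp add: x_def)
  have "min 1 x \<le> x powr (\<beta> / 2)"
  proof (cases "x \<le> 1")
    case True
    hence "x powr 1 \<le> x powr (\<beta> / 2)" using x assms by (intro powr_mono') auto
    thus ?thesis using True x by simp
  next
    case False
    thus ?thesis using assms by (simp add: ge_one_powr_ge_zero)
  qed
  also have "x powr (\<beta> / 2) = h powr \<beta> * b powr (3 * \<beta> / 2)"
  proof -
    have "x = h powr 2 * b powr 3"
      using b assms(1) powr_realpow[of h 2] powr_realpow[of b 3] by (simp add: x_def)
    thus ?thesis unfolding \<open>x = h powr 2 * b powr 3\<close> powr_mult powr_powr by simp
  qed
  finally have m: "min 1 x \<le> h powr \<beta> * b powr (3 * \<beta> / 2)" .
  have "b powr (r - 3 * \<beta> / 2) * cmod (v j)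
     \<le> b powr (r - 3 * \<beta> / 2) * (c * (min 1 x * (b powr \<mu> * cmod (u j))))"
    using assms(5)[OF j] by (intro mult_left_mono) (simp_all add: b_def x_def)
  also have "\<dots> \<le> b powr (r - 3 * \<beta> / 2) * (c * ((h powr \<beta> * b powr (3 * \<beta> / 2)) * (b powr \<mu> * cmod (u j))))"
    using m assms by (intro mult_left_mono mult_right_mono) auto
  also have "\<dots> = c * h powr \<beta> * ((b powr (r - 3 * \<beta> / 2) * b powr (3 * \<beta> / 2) * b powr \<mu>) * cmod (u j))"
    by (simp add: mult_ac)
  also have "b powr (r - 3 * \<beta> / 2) * b powr (3 * \<beta> / 2) * b powr \<mu> = b powr (r + \<mu>)"
    by (simp flip: powr_add)
  finally show "bracket j powr (r - 3 * \<beta> / 2) * cmod (v j)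
      \<le> c * h powr \<beta> * (bracket j powr (r + \<mu>) * cmod (u j))" by (simp add: b_def)
qed (use assms in auto)

definition mode_cut :: "int set \<Rightarrow> (int \<Rightarrow> complex) \<Rightarrow> int \<Rightarrow> complex" where
  "mode_cut J v = (\<lambda>j. if j \<in> J then v j else 0)"

lemma sob_norm_mode_cut:
  assumes "J \<subseteq> freq_idx K"
  shows "sob_norm K \<sigma> (mode_cut J v) = L2_set (\<lambda>j. bracket j powr \<sigma> * cmod (v j)) J"
proof -
  have "(\<Sum>j\<in>freq_idx K. (bracket j powr \<sigma> * cmod (mode_cut J v j))\<^sup>2)
      = (\<Sum>j\<in>J. (bracket j powr \<sigma> * cmod (v j))\<^sup>2)"
    by (rule sum.mono_neutral_cong_right) (use assms in \<open>auto simp: mode_cut_def\<close>)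
  thus ?thesis by (simp add: sob_norm_L2_set L2_set_def)
qed

lemma sob_norm_mode_cut_le: "sob_norm K \<sigma> (mode_cut J v) \<le> sob_norm K \<sigma> v"
  using sob_norm_bounded_multiplier[of K "mode_cut J v" 1 v \<sigma> \<sigma>] by (simp add: mode_cut_def)

lemma finite_energyD:
  assumes "finite_energy K s M t0 T y yd" "t \<in> {t0..t0 + T}"
  shows "sob_norm K (s + 1) (y t) \<le> M" "sob_norm K s (yd t) \<le> M"
proof -
  have "sob_norm K (s + 1) (y t) + sob_norm K s (yd t) \<le> M"
    using assms by (auto simp: finite_energy_def)
  thus "sob_norm K (s + 1) (y t) \<le> M" "sob_norm K s (yd t) \<le> M"
    using sob_norm_nonneg[of K "s + 1" "y t"] sob_norm_nonneg[of K s "yd t"] by linarith+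
qed

lemma solves_waveD:
  assumes "solves_wave K p w t0 T y yd" "t \<in> {t0..t0 + T}" "j \<in> freq_idx K"
  shows "((\<lambda>\<tau>. y \<tau> j) has_vector_derivative yd t j) (at t within {t0..t0 + T})"
    "((\<lambda>\<tau>. yd \<tau> j) has_vector_derivative
        (conv_power K p (y t) j - of_real ((w j)\<^sup>2) * y t j)) (at t within {t0..t0 + T})"
  using assms unfolding solves_wave_def by (auto simp: algebra_simps)

context resolved_step
begin

text \<open>
  A difference of the frequencies of size \<open>h\<^sup>2 w\<^sup>3\<close> shifts the phases by an amount that is not small
  for the modes outside \<open>J\<close>; for these the energy bound on both solutions suffices. The modes in
  \<open>J\<close> of the difference solve the equation with the modified frequencies and the perturbations \<open>q\<close>
  (from the frequencies) and \<open>g\<close> (from the nonlinearity). In the derivative of their energy \<open>Q\<close> the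
  terms with the squared frequencies cancel. The modes outside \<open>J\<close> enter it through \<open>g\<close> only, as
  a source of the admissible size \<open>h\<^sup>\<beta>\<close>.
\<close>
lemma modified_frequency_error:
  fixes s \<beta> \<sigma> M T L t0 :: real and y yd z zd :: "real \<Rightarrow> int \<Rightarrow> complex"
  defines "G \<equiv> 2 * M * L + M / (2 * gap)"
  defines "E \<equiv> sqrt (((M / gap)\<^sup>2 + G\<^sup>2) * exp ((3 + 2 * L) * T))"
  assumes \<beta>: "0 \<le> \<beta>" "\<beta> \<le> 2" and \<sigma>: "\<sigma> = s + 1 - 3 * \<beta> / 2"
    and L: "0 \<le> L" and M: "0 \<le> M"
    and lipschitz: "\<And>u v. sob_norm K (s + 1) u \<le> M \<Longrightarrow> sob_norm K (s + 1) v \<le> M \<Longrightarrow>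
      sob_norm K \<sigma> (\<lambda>j. conv_power K p u j - conv_power K p v j) \<le> L * sob_norm K \<sigma> (\<lambda>j. u j - v j)"
    and y: "solves_wave K p freq t0 T y yd" and ey: "finite_energy K s M t0 T y yd"
    and z: "solves_wave K p (mod_freq h) t0 T z zd" and ez: "finite_energy K s M t0 T z zd"
    and init: "\<And>j. j \<in> freq_idx K \<Longrightarrow> z t0 j = y t0 j \<and>
      zd t0 j = inverse (complex_of_real (freq_filter h j)) * yd t0 j"
    and t: "t \<in> {t0..t0 + T}"
  shows "sob_norm K \<sigma> (\<lambda>j. y t j - z t j) + sob_norm K (\<sigma> - 1) (\<lambda>j. yd t j - zd t j)
    \<le> (2 * E + 4 * M) * h powr \<beta>"
proof -
  define J where "J = {j \<in> freq_idx K. h\<^sup>2 * bracket j ^ 3 \<le> 1}"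
  define H where "H = h powr \<beta>"
  have J: "J \<subseteq> freq_idx K" and finJ: "finite J" by (auto simp: J_def)
  have H: "0 \<le> H" by (simp add: H_def)
  have G: "0 \<le> G" unfolding G_def using M L gap_pos by (simp add: less_imp_le)
  have \<sigma>1: "\<sigma> - 1 = s - 3 * \<beta> / 2" using \<sigma> by simp
  define e where "e = (\<lambda>t j. z t j - y t j)"
  define d where "d = (\<lambda>t j. zd t j - yd t j)"
  define g where "g = (\<lambda>t j. conv_power K p (z t) j - conv_power K p (y t) j)"
  define q where "q = (\<lambda>t j. of_real ((freq j)\<^sup>2 - (mod_freq h j)\<^sup>2) * y t j)"
  define \<rho> where "\<rho> = (\<lambda>j. (bracket j powr (\<sigma> - 1))\<^sup>2)"
  define Q where "Q = (\<lambda>t. \<Sum>j\<in>J. \<rho> j * (((mod_freq h j)\<^sup>2 + 1) * (cmod (e t j))\<^sup>2 + (cmod (d t j))\<^sup>2))"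
  define Q' where "Q' = (\<lambda>t. \<Sum>j\<in>J. \<rho> j * (2 * (d t j \<bullet> (e t j + (q t j + g t j)))))"

  \<comment> \<open>The modes above the threshold are small without any dynamics.\<close>
  have high: "sob_norm K (r - 3 * \<beta> / 2) (\<lambda>j. v j - u j)
      \<le> sob_norm K (r - 3 * \<beta> / 2) (mode_cut J (\<lambda>j. v j - u j)) + 2 * M * H"
    if "sob_norm K r v \<le> M" "sob_norm K r u \<le> M" for r v u
  proof -
    let ?x = "\<lambda>j. v j - u j"
    have "sob_norm K (r - 3 * \<beta> / 2) (mode_cut (- J) ?x) \<le> 1 * h powr \<beta> * sob_norm K (r + 0) ?x"
    proof (rule sob_norm_trade[OF h_pos \<beta>])
      fix j assume "j \<in> freq_idx K"
      thus "cmod (mode_cut (- J) ?x j) \<le> 1 * (min 1 (h\<^sup>2 * bracket j ^ 3) * (bracket j powr 0 * cmod (?x j)))"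
        using bracket_pos[of j] h_pos by (auto simp: mode_cut_def J_def)
    qed simp
    also have "\<dots> \<le> H * (2 * M)"
      using sob_norm_triangle_diff[of K r v u] that H by (auto simp: H_def intro!: mult_left_mono)
    finally have "sob_norm K (r - 3 * \<beta> / 2) (mode_cut (- J) ?x) \<le> 2 * M * H" by (simp add: mult_ac)
    moreover have "?x = (\<lambda>j. mode_cut J ?x j + mode_cut (- J) ?x j)" by (auto simp: mode_cut_def)
    ultimately show ?thesis
      using sob_norm_triangle[of K "r - 3 * \<beta> / 2" "mode_cut J ?x" "mode_cut (- J) ?x"] by simp
  qed
  have rho: "0 \<le> \<rho> j" for j by (simp add: \<rho>_def)
  have Q_nonneg: "0 \<le> Q t" for t
    unfolding Q_def by (intro sum_nonneg mult_nonneg_nonneg rho add_nonneg_nonneg) auto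
  have low_e: "sob_norm K \<sigma> (mode_cut J (e t)) \<le> sqrt (Q t)" for t
    unfolding sob_norm_mode_cut[OF J] L2_set_def Q_def
  proof (intro real_sqrt_le_mono sum_mono)
    fix j assume "j \<in> J"
    hence j: "j \<in> freq_idx K" using J by auto
    have "bracket j powr \<sigma> = bracket j powr (\<sigma> - 1) * bracket j"
      using bracket_pos[of j] by (simp add: powr_diff)
    hence "(bracket j powr \<sigma> * cmod (e t j))\<^sup>2 = \<rho> j * ((bracket j)\<^sup>2 * (cmod (e t j))\<^sup>2)"
      by (simp add: \<rho>_def power_mult_distrib)
    also have "\<dots> \<le> \<rho> j * (((mod_freq h j)\<^sup>2 + 1) * (cmod (e t j))\<^sup>2 + (cmod (d t j))\<^sup>2)"
    proof (intro mult_left_mono rho)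
      have "(bracket j)\<^sup>2 \<le> (mod_freq h j)\<^sup>2 + 1"
        using bracket_square_le[of j] mod_freq_square_diff(1)[OF j] by simp
      hence "(bracket j)\<^sup>2 * (cmod (e t j))\<^sup>2 \<le> ((mod_freq h j)\<^sup>2 + 1) * (cmod (e t j))\<^sup>2"
        by (rule mult_right_mono) simp
      thus "(bracket j)\<^sup>2 * (cmod (e t j))\<^sup>2 \<le> ((mod_freq h j)\<^sup>2 + 1) * (cmod (e t j))\<^sup>2 + (cmod (d t j))\<^sup>2"
        by (simp add: add_increasing2)
    qed
    finally show "(bracket j powr \<sigma> * cmod (e t j))\<^sup>2
        \<le> \<rho> j * (((mod_freq h j)\<^sup>2 + 1) * (cmod (e t j))\<^sup>2 + (cmod (d t j))\<^sup>2)" .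
  qed
  have low_d: "sob_norm K (\<sigma> - 1) (mode_cut J (d t)) \<le> sqrt (Q t)" for t
    unfolding sob_norm_mode_cut[OF J] L2_set_def Q_def
    by (intro real_sqrt_le_mono sum_mono) (simp add: \<rho>_def power_mult_distrib distrib_left)
  have e_le: "sob_norm K \<sigma> (e t) \<le> sqrt (Q t) + 2 * M * H"
    and d_le: "sob_norm K (\<sigma> - 1) (d t) \<le> sqrt (Q t) + 2 * M * H" if "t \<in> {t0..t0 + T}" for t
    using high[of "s + 1" "z t" "y t"] high[of s "zd t" "yd t"] finite_energyD[OF ey that] finite_energyD[OF ez that]
      low_e[of t] low_d[of t] unfolding \<sigma>[symmetric] \<sigma>1[symmetric] e_def d_def by linarith+
  have q_le: "sob_norm K (\<sigma> - 1) (mode_cut J (q t)) \<le> M / (2 * gap) * H" if "t \<in> {t0..t0 + T}" for t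
  proof -
    have "sob_norm K (\<sigma> - 1) (mode_cut J (q t)) \<le> 1 / (2 * gap) * h powr \<beta> * sob_norm K (s + 1) (y t)"
      unfolding \<sigma>1
    proof (rule sob_norm_trade[OF h_pos \<beta>])
      fix j assume j: "j \<in> freq_idx K"
      show "cmod (mode_cut J (q t) j)
          \<le> 1 / (2 * gap) * (min 1 (h\<^sup>2 * bracket j ^ 3) * (bracket j powr 1 * cmod (y t j)))"
      proof (cases "j \<in> J")
        case True
        have "\<bar>(freq j)\<^sup>2 - (mod_freq h j)\<^sup>2\<bar> \<le> h\<^sup>2 * freq j ^ 4 / (2 * gap)"
          using mod_freq_square_diff[OF j] by simp
        also have "\<dots> \<le> h\<^sup>2 * bracket j ^ 4 / (2 * gap)"
          using freq_le_bracket[of j] gap_pos by (intro divide_right_mono mult_left_mono power_mono) auto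
        also have "\<dots> = 1 / (2 * gap) * (h\<^sup>2 * bracket j ^ 3 * bracket j)"
          by (simp add: power4_eq_xxxx power3_eq_cube mult_ac)
        finally have "\<bar>(freq j)\<^sup>2 - (mod_freq h j)\<^sup>2\<bar> * cmod (y t j)
            \<le> 1 / (2 * gap) * (h\<^sup>2 * bracket j ^ 3 * bracket j) * cmod (y t j)"
          by (rule mult_right_mono) simp
        moreover have "cmod (q t j) = \<bar>(freq j)\<^sup>2 - (mod_freq h j)\<^sup>2\<bar> * cmod (y t j)"
          unfolding q_def norm_mult norm_of_real ..
        moreover have "min 1 (h\<^sup>2 * bracket j ^ 3) = h\<^sup>2 * bracket j ^ 3" using True by (simp add: J_def)
        ultimately show ?thesis using True by (simp add: mode_cut_def mult_ac)
      qed (use gap_pos h_pos in \<open>simp add: mode_cut_def\<close>)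
    qed (use gap_pos in auto)
    also have "\<dots> \<le> 1 / (2 * gap) * H * M"
      unfolding H_def using finite_energyD[OF ey that] gap_pos by (intro mult_left_mono) auto
    finally show ?thesis by (simp add: mult_ac)
  qed
  have g_le: "sob_norm K (\<sigma> - 1) (mode_cut J (g t)) \<le> L * sqrt (Q t) + 2 * M * L * H"
    if "t \<in> {t0..t0 + T}" for t
  proof -
    have "sob_norm K (\<sigma> - 1) (mode_cut J (g t)) \<le> sob_norm K \<sigma> (g t)"
      by (rule order_trans[OF sob_norm_mode_cut_le sob_norm_mono]) simp
    also have "\<dots> \<le> L * sob_norm K \<sigma> (e t)"
      unfolding g_def e_def by (rule lipschitz) (use finite_energyD[OF ey that] finite_energyD[OF ez that] in auto)
    also have "\<dots> \<le> L * (sqrt (Q t) + 2 * M * H)" by (intro mult_left_mono e_le that L)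
    finally show ?thesis by (simp add: algebra_simps)
  qed
  have "(Q has_real_derivative Q' t) (at t within {t0..t0 + T})" if "t \<in> {t0..t0 + T}" for t
    unfolding Q_def Q'_def
  proof (rule DERIV_sum)
    fix j assume "j \<in> J"
    hence j: "j \<in> freq_idx K" using J by auto
    note dy = solves_waveD[OF y that j] and dz = solves_waveD[OF z that j]
    have de: "((\<lambda>\<tau>. e \<tau> j) has_vector_derivative d t j) (at t within {t0..t0 + T})"
      unfolding e_def d_def by (intro has_vector_derivative_diff dy dz)
    have dd: "((\<lambda>\<tau>. d \<tau> j) has_vector_derivative
        (q t j + g t j - of_real ((mod_freq h j)\<^sup>2) * e t j)) (at t within {t0..t0 + T})"
    proof -
      have "(conv_power K p (z t) j - of_real ((mod_freq h j)\<^sup>2) * z t j)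
          - (conv_power K p (y t) j - of_real ((freq j)\<^sup>2) * y t j)
        = q t j + g t j - of_real ((mod_freq h j)\<^sup>2) * e t j"
        by (simp add: q_def g_def e_def algebra_simps)
      thus ?thesis unfolding d_def using has_vector_derivative_diff[OF dz(2) dy(2)] by simp
    qed
    have "d t j \<bullet> (q t j + g t j - of_real ((mod_freq h j)\<^sup>2) * e t j)
        = d t j \<bullet> (q t j + g t j) - (mod_freq h j)\<^sup>2 * (e t j \<bullet> d t j)"
      by (simp add: inner_diff_right inner_commute flip: scaleR_conv_of_real of_real_power)
    hence eq: "\<rho> j * (2 * (d t j \<bullet> (e t j + (q t j + g t j)))) =
        \<rho> j * (((mod_freq h j)\<^sup>2 + 1) * (2 * (e t j \<bullet> d t j))
          + 2 * (d t j \<bullet> (q t j + g t j - of_real ((mod_freq h j)\<^sup>2) * e t j)))"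
      by (simp add: inner_add_right inner_commute algebra_simps)
    show "((\<lambda>t. \<rho> j * (((mod_freq h j)\<^sup>2 + 1) * (cmod (e t j))\<^sup>2 + (cmod (d t j))\<^sup>2)) has_real_derivative
        \<rho> j * (2 * (d t j \<bullet> (e t j + (q t j + g t j))))) (at t within {t0..t0 + T})"
      unfolding eq by (intro DERIV_cmult DERIV_add has_real_derivative_cmod_square de dd)
  qed
  moreover have "Q' t \<le> (3 + 2 * L) * Q t + (G * H)\<^sup>2" if "t \<in> {t0..t0 + T}" for t
  proof -
    define S where "S = sqrt (Q t)"
    have S: "0 \<le> S" "S\<^sup>2 = Q t" using Q_nonneg by (auto simp: S_def)
    let ?f = "\<lambda>j. e t j + (q t j + g t j)"
    have "Q' t \<le> (\<Sum>j\<in>J. 2 * (\<bar>bracket j powr (\<sigma> - 1) * cmod (d t j)\<bar> * \<bar>bracket j powr (\<sigma> - 1) * cmod (?f j)\<bar>))"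
      unfolding Q'_def
    proof (intro sum_mono)
      fix j
      have "\<rho> j * (2 * (d t j \<bullet> ?f j)) \<le> \<rho> j * (2 * (cmod (d t j) * cmod (?f j)))"
        by (intro mult_left_mono norm_cauchy_schwarz rho) auto
      thus "\<rho> j * (2 * (d t j \<bullet> ?f j))
          \<le> 2 * (\<bar>bracket j powr (\<sigma> - 1) * cmod (d t j)\<bar> * \<bar>bracket j powr (\<sigma> - 1) * cmod (?f j)\<bar>)"
        by (simp add: \<rho>_def power2_eq_square abs_mult mult_ac)
    qed
    also have "\<dots> \<le> 2 * (sob_norm K (\<sigma> - 1) (mode_cut J (d t)) * sob_norm K (\<sigma> - 1) (mode_cut J ?f))"
      unfolding sum_distrib_left[symmetric] sob_norm_mode_cut[OF J] by (intro mult_left_mono L2_set_mult_ineq) simp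
    also have "\<dots> \<le> 2 * (S * (S + (M / (2 * gap) * H + (L * S + 2 * M * L * H))))"
    proof (intro mult_left_mono mult_mono)
      show "sob_norm K (\<sigma> - 1) (mode_cut J (d t)) \<le> S" unfolding S_def by (rule low_d)
      have "mode_cut J ?f = (\<lambda>j. mode_cut J (e t) j + (mode_cut J (q t) j + mode_cut J (g t) j))"
        by (auto simp: mode_cut_def)
      moreover have "sob_norm K (\<sigma> - 1) (mode_cut J (e t)) \<le> S"
        unfolding S_def by (rule order_trans[OF sob_norm_mono low_e]) simp
      ultimately show "sob_norm K (\<sigma> - 1) (mode_cut J ?f) \<le> S + (M / (2 * gap) * H + (L * S + 2 * M * L * H))"
        using q_le[OF that] g_le[OF that] unfolding S_def
        by (auto intro!: order_trans[OF sob_norm_triangle] add_mono)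
    qed (use S in auto)
    also have "\<dots> = (2 + 2 * L) * S\<^sup>2 + 2 * S * (G * H)"
      by (simp add: G_def power2_eq_square algebra_simps)
    also have "\<dots> \<le> (2 + 2 * L) * S\<^sup>2 + (S\<^sup>2 + (G * H)\<^sup>2)"
      using sum_squares_bound[of S "G * H"] by simp
    finally show ?thesis using S by (simp add: algebra_simps)
  qed
  ultimately have "Q t \<le> (Q t0 + (G * H)\<^sup>2) * exp ((3 + 2 * L) * (t - t0))"
    using t L by (intro gronwall_linear[where Q' = Q']) auto
  also have "\<dots> \<le> ((M / gap * H)\<^sup>2 + (G * H)\<^sup>2) * exp ((3 + 2 * L) * T)"
  proof (intro mult_mono add_right_mono)
    have t0: "t0 \<in> {t0..t0 + T}" using t by simp
    have "Q t0 = (sob_norm K (\<sigma> - 1) (mode_cut J (d t0)))\<^sup>2"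
    proof -
      have "e t0 j = 0" if "j \<in> J" for j using init[of j] that J by (auto simp: e_def)
      thus ?thesis unfolding sob_norm_mode_cut[OF J] L2_set_def Q_def
        by (simp add: sum_nonneg \<rho>_def power_mult_distrib)
    qed
    also have "\<dots> \<le> (M / gap * H)\<^sup>2"
    proof (intro power_mono)
      have "sob_norm K (\<sigma> - 1) (mode_cut J (d t0)) \<le> sob_norm K (\<sigma> - 1) (d t0)"
        by (rule sob_norm_mode_cut_le)
      also have "\<dots> \<le> 1 / gap * h powr \<beta> * sob_norm K (s + 0) (yd t0)"
        unfolding \<sigma>1
      proof (rule sob_norm_trade[OF h_pos \<beta>])
        fix j assume j: "j \<in> freq_idx K"
        have "inverse (freq_filter h j) - 1 \<le> h\<^sup>2 * (freq j)\<^sup>2 / (2 * gap)"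
          by (rule inverse_freq_filter(2)[OF j])
        also have "\<dots> \<le> h\<^sup>2 * bracket j ^ 3 / gap"
        proof (rule frac_le)
          have "(freq j)\<^sup>2 \<le> (bracket j)\<^sup>2" using freq_le_bracket by (intro power_mono) auto
          also have "\<dots> \<le> bracket j ^ 3" using bracket_ge_1 by (intro power_increasing) auto
          finally show "h\<^sup>2 * (freq j)\<^sup>2 \<le> h\<^sup>2 * bracket j ^ 3" by (intro mult_left_mono) auto
        qed (use gap_pos in auto)
        finally have "inverse (freq_filter h j) - 1 \<le> 1 / gap * min 1 (h\<^sup>2 * bracket j ^ 3)"
          using inverse_freq_filter(3)[OF j] by (auto simp: min_def)
        hence "\<bar>inverse (freq_filter h j) - 1\<bar> * cmod (yd t0 j)
            \<le> 1 / gap * min 1 (h\<^sup>2 * bracket j ^ 3) * cmod (yd t0 j)"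
          using inverse_freq_filter(1)[OF j] by (intro mult_right_mono) auto
        moreover have "d t0 j = of_real (inverse (freq_filter h j) - 1) * yd t0 j"
          using init[OF j] by (simp add: d_def algebra_simps)
        ultimately show "cmod (d t0 j) \<le> 1 / gap * (min 1 (h\<^sup>2 * bracket j ^ 3) * (bracket j powr 0 * cmod (yd t0 j)))"
          using bracket_pos[of j] by (simp only: norm_mult norm_of_real mult.assoc) simp
      qed (use gap_pos in auto)
      also have "\<dots> \<le> 1 / gap * H * M"
        unfolding H_def using finite_energyD[OF ey t0] gap_pos by (intro mult_left_mono) auto
      finally show "sob_norm K (\<sigma> - 1) (mode_cut J (d t0)) \<le> M / gap * H" by (simp add: mult_ac)
    qed simp
    finally show "Q t0 \<le> (M / gap * H)\<^sup>2" .
  qed (use t L in \<open>auto intro!: mult_left_mono\<close>)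
  also have "\<dots> = (E * H)\<^sup>2"
    by (simp add: E_def power_mult_distrib power_divide distrib_right)
  finally have "sqrt (Q t) \<le> E * H"
    using H by (intro real_le_lsqrt) (simp_all add: E_def)
  thus ?thesis
    using e_le[OF t] d_le[OF t] sob_norm_minus[of K \<sigma> "y t" "z t"] sob_norm_minus[of K "\<sigma> - 1" "yd t" "zd t"]
    unfolding e_def d_def H_def[symmetric] by (simp add: algebra_simps)
qed

end

section \<open>Local errors\<close>

lemma has_vector_derivative_of_real_mult:
  fixes g :: "real \<Rightarrow> complex"
  assumes "(f has_real_derivative f') (at t within S)" "(g has_vector_derivative g') (at t within S)"
  shows "((\<lambda>\<tau>. of_real (f \<tau>) * g \<tau>) has_vector_derivative (of_real (f t) * g' + of_real f' * g t))
    (at t within S)"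
  using has_vector_derivative_scaleR[OF assms] by (simp add: scaleR_conv_of_real)

lemma sob_norm_mean_value_sub:
  fixes v v' :: "real \<Rightarrow> int \<Rightarrow> complex"
  assumes "\<And>j t. j \<in> freq_idx K \<Longrightarrow> t \<in> {a..b} \<Longrightarrow>
      ((\<lambda>\<tau>. v \<tau> j) has_vector_derivative v' t j) (at t within {a..b})"
    and "\<And>t. t \<in> {a..b} \<Longrightarrow> sob_norm K \<sigma> (v' t) \<le> B"
    and "a \<le> c" "c \<le> d" "d \<le> b"
  shows "sob_norm K \<sigma> (\<lambda>j. v d j - v c j) \<le> B * (d - c)"
  by (rule sob_norm_mean_value[where v' = v'])
    (use assms in \<open>auto intro: has_vector_derivative_within_subset[of _ _ _ "{a..b}"]\<close>)

text \<open>
  Two versions of the error of the trapezoidal rule for the integral of \<open>g\<close> are needed, as the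
  second derivative of \<open>g\<close> is controlled in a weaker norm than the first.
\<close>
lemma trapezoidal_rule_first_order:
  fixes V g g1 :: "real \<Rightarrow> int \<Rightarrow> complex"
  assumes dV: "\<And>j t. j \<in> freq_idx K \<Longrightarrow> t \<in> {a..b} \<Longrightarrow>
      ((\<lambda>\<tau>. V \<tau> j) has_vector_derivative g t j) (at t within {a..b})"
    and dg: "\<And>j t. j \<in> freq_idx K \<Longrightarrow> t \<in> {a..b} \<Longrightarrow>
      ((\<lambda>\<tau>. g \<tau> j) has_vector_derivative g1 t j) (at t within {a..b})"
    and bound: "\<And>t. t \<in> {a..b} \<Longrightarrow> sob_norm K \<sigma> (g1 t) \<le> B" and "a \<le> b"
  shows "sob_norm K \<sigma> (\<lambda>j. V b j - V a j - of_real ((b - a) / 2) * (g a j + g b j)) \<le> B * (b - a)\<^sup>2"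
proof -
  have B: "0 \<le> B" using bound[of a] assms(4) order_trans[OF sob_norm_nonneg] by auto
  define E where "E = (\<lambda>t j. V t j - of_real (t / 2) * (g a j + g b j))"
  define E' where "E' = (\<lambda>t j. (g t j - g a j) / 2 + (g t j - g b j) / 2)"
  have "sob_norm K \<sigma> (\<lambda>j. E b j - E a j) \<le> (B * (b - a)) * (b - a)"
  proof (rule sob_norm_mean_value[where v' = E', OF assms(4)])
    fix j t assume j: "j \<in> freq_idx K" and t: "t \<in> {a..b}"
    have "((\<lambda>\<tau>. E \<tau> j) has_vector_derivative
        g t j - (of_real (t / 2) * 0 + of_real (1 / 2) * (g a j + g b j))) (at t within {a..b})"
      unfolding E_def
      by (intro has_vector_derivative_diff dV j t has_vector_derivative_of_real_mult has_vector_derivative_const)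
        (auto intro!: derivative_eq_intros)
    moreover have "g t j - (of_real (t / 2) * 0 + of_real (1 / 2) * (g a j + g b j)) = E' t j"
      by (simp add: E'_def field_simps)
    ultimately show "((\<lambda>\<tau>. E \<tau> j) has_vector_derivative E' t j) (at t within {a..b})" by simp
  next
    fix t assume t: "t \<in> {a..b}"
    have "sob_norm K \<sigma> (\<lambda>j. g t j - g a j) \<le> B * (t - a)" "sob_norm K \<sigma> (\<lambda>j. g b j - g t j) \<le> B * (b - t)"
      using t by (auto intro!: sob_norm_mean_value_sub[OF dg bound])
    moreover have "sob_norm K \<sigma> (E' t)
        \<le> sob_norm K \<sigma> (\<lambda>j. (1/2) * (g t j - g a j)) + sob_norm K \<sigma> (\<lambda>j. (1/2) * (g t j - g b j))"
      unfolding E'_def by (rule order_trans[OF _ sob_norm_triangle]) simp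
    moreover have "sob_norm K \<sigma> (\<lambda>j. (1/2) * (g t j - v j)) = sob_norm K \<sigma> (\<lambda>j. g t j - v j) / 2" for v
      unfolding sob_norm_scale by simp
    note this[of "g a"] this[of "g b"]
    ultimately have "sob_norm K \<sigma> (E' t) \<le> B * (t - a) / 2 + B * (b - t) / 2"
      using sob_norm_minus[of K \<sigma> "g t" "g b"] by linarith
    also have "\<dots> \<le> B * (b - a)"
    proof -
      have "B * (t - a) \<le> B * (b - a)" "B * (b - t) \<le> B * (b - a)"
        using B t by (auto intro!: mult_left_mono)
      thus ?thesis by linarith
    qed
    finally show "sob_norm K \<sigma> (E' t) \<le> B * (b - a)" .
  qed
  also have "(\<lambda>j. E b j - E a j) = (\<lambda>j. V b j - V a j - of_real ((b - a) / 2) * (g a j + g b j))"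
    by (auto simp: E_def field_simps)
  finally show ?thesis by (simp add: power2_eq_square mult_ac)
qed

lemma trapezoidal_rule_second_order:
  fixes V g g1 g2 :: "real \<Rightarrow> int \<Rightarrow> complex"
  assumes dV: "\<And>j t. j \<in> freq_idx K \<Longrightarrow> t \<in> {a..b} \<Longrightarrow>
      ((\<lambda>\<tau>. V \<tau> j) has_vector_derivative g t j) (at t within {a..b})"
    and dg: "\<And>j t. j \<in> freq_idx K \<Longrightarrow> t \<in> {a..b} \<Longrightarrow>
      ((\<lambda>\<tau>. g \<tau> j) has_vector_derivative g1 t j) (at t within {a..b})"
    and dg1: "\<And>j t. j \<in> freq_idx K \<Longrightarrow> t \<in> {a..b} \<Longrightarrow>
      ((\<lambda>\<tau>. g1 \<tau> j) has_vector_derivative g2 t j) (at t within {a..b})"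
    and bound: "\<And>t. t \<in> {a..b} \<Longrightarrow> sob_norm K \<sigma> (g2 t) \<le> B" and "a \<le> b"
  shows "sob_norm K \<sigma> (\<lambda>j. V b j - V a j - of_real ((b - a) / 2) * (g a j + g b j)) \<le> B / 2 * (b - a) ^ 3"
proof -
  have B: "0 \<le> B" using bound[of a] assms(5) order_trans[OF sob_norm_nonneg] by auto
  define E where "E = (\<lambda>t j. V t j - of_real ((t - a) / 2) * (g a j + g t j))"
  define E1 where "E1 = (\<lambda>t j. (g t j - g a j) / 2 - of_real ((t - a) / 2) * g1 t j)"
  define E2 where "E2 = (\<lambda>t j. of_real (- (t - a) / 2) * g2 t j)"
  have dE: "((\<lambda>\<tau>. E \<tau> j) has_vector_derivative E1 t j) (at t within {a..b})"
    and dE1: "((\<lambda>\<tau>. E1 \<tau> j) has_vector_derivative E2 t j) (at t within {a..b})"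
    if j: "j \<in> freq_idx K" and t: "t \<in> {a..b}" for j t
  proof -
    have lin: "((\<lambda>t. (t - a) / 2) has_real_derivative 1 / 2) (at t within {a..b})"
      by (auto intro!: derivative_eq_intros)
    have "((\<lambda>\<tau>. E \<tau> j) has_vector_derivative
        g t j - (of_real ((t - a) / 2) * (0 + g1 t j) + of_real (1 / 2) * (g a j + g t j))) (at t within {a..b})"
      unfolding E_def
      by (intro has_vector_derivative_diff has_vector_derivative_of_real_mult has_vector_derivative_add
          has_vector_derivative_const dV dg j t lin)
    moreover have "g t j - (of_real ((t - a) / 2) * (0 + g1 t j) + of_real (1 / 2) * (g a j + g t j)) = E1 t j"
      by (simp add: E1_def field_simps)
    ultimately show "((\<lambda>\<tau>. E \<tau> j) has_vector_derivative E1 t j) (at t within {a..b})" by simp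
    have "((\<lambda>\<tau>. (g \<tau> j - g a j) / 2 - of_real ((\<tau> - a) / 2) * g1 \<tau> j) has_vector_derivative
        (g1 t j - 0) / 2 - (of_real ((t - a) / 2) * g2 t j + of_real (1 / 2) * g1 t j)) (at t within {a..b})"
      by (intro has_vector_derivative_diff has_vector_derivative_of_real_mult has_vector_derivative_divide
          has_vector_derivative_const dg dg1 j t lin)
    moreover have "(g1 t j - 0) / 2 - (of_real ((t - a) / 2) * g2 t j + of_real (1 / 2) * g1 t j) = E2 t j"
      by (simp add: E2_def field_simps)
    ultimately show "((\<lambda>\<tau>. E1 \<tau> j) has_vector_derivative E2 t j) (at t within {a..b})"
      unfolding E1_def by simp
  qed
  have E2: "sob_norm K \<sigma> (E2 t) \<le> (b - a) / 2 * B" if t: "t \<in> {a..b}" for t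
  proof -
    have "sob_norm K \<sigma> (E2 t) = \<bar>- (t - a) / 2\<bar> * sob_norm K \<sigma> (g2 t)"
      unfolding E2_def sob_norm_scale norm_of_real ..
    also have "\<dots> \<le> (b - a) / 2 * B"
      using bound[OF t] t by (intro mult_mono) auto
    finally show ?thesis .
  qed
  have E1: "sob_norm K \<sigma> (E1 t) \<le> (b - a) / 2 * B * (b - a)" if t: "t \<in> {a..b}" for t
  proof -
    have "sob_norm K \<sigma> (\<lambda>j. E1 t j - E1 a j) \<le> (b - a) / 2 * B * (t - a)"
      by (rule sob_norm_mean_value_sub[OF dE1 E2]) (use t in auto)
    also have "\<dots> \<le> (b - a) / 2 * B * (b - a)" using B t assms(5) by (intro mult_left_mono) auto
    finally show ?thesis by (simp add: E1_def)
  qed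
  have "sob_norm K \<sigma> (\<lambda>j. E b j - E a j) \<le> (b - a) / 2 * B * (b - a) * (b - a)"
    by (rule sob_norm_mean_value[OF assms(5) dE E1])
  thus ?thesis by (simp add: E_def power3_eq_cube algebra_simps)
qed

context resolved_step
begin

lemma mod_freq_le_bracket:
  assumes j: "j \<in> freq_idx K"
  shows "mod_freq h j \<le> 1 / gap * bracket j"
proof -
  have "gap * mod_freq h j \<le> bracket j"
  proof (rule power2_le_imp_le)
    have "(gap * mod_freq h j)\<^sup>2 = gap * (gap * (mod_freq h j)\<^sup>2)" by (simp add: power2_eq_square)
    also have "\<dots> \<le> 1 * (freq j)\<^sup>2"
      using mod_freq_square_le[OF j] gap_pos gap_le_1 by (intro mult_mono) auto
    also have "\<dots> \<le> (bracket j)\<^sup>2" using freq_le_bracket[of j] by (simp add: power_mono)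
    finally show "(gap * mod_freq h j)\<^sup>2 \<le> (bracket j)\<^sup>2" .
  qed simp
  thus ?thesis using gap_pos by (simp add: field_simps)
qed

text \<open>
  The kernel \<open>sin (\<rho> w) / w\<close> of the variation-of-constants formula, extended continuously to \<open>w = 0\<close>.
\<close>
definition sin_kernel :: "int \<Rightarrow> real \<Rightarrow> real" where
  "sin_kernel j \<rho> = (if mod_freq h j = 0 then \<rho> else sin (\<rho> * mod_freq h j) / mod_freq h j)"

lemma sin_kernel_zero [simp]: "sin_kernel j 0 = 0"
  by (simp add: sin_kernel_def)

lemma sin_kernel_h: "j \<in> freq_idx K \<Longrightarrow> sin_kernel j h = h * freq_filter h j"
  using h_pos by (simp add: sin_kernel_def freq_filter_def)

lemma mod_freq_sin_kernel: "mod_freq h j * sin_kernel j \<rho> = sin (\<rho> * mod_freq h j)"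
  by (simp add: sin_kernel_def)

lemma has_derivative_sin_kernel:
  "((\<lambda>\<tau>. sin_kernel j (b - \<tau>)) has_real_derivative - cos ((b - t) * mod_freq h j)) (at t within S)"
  unfolding sin_kernel_def by (cases "mod_freq h j = 0") (auto intro!: derivative_eq_intros)

lemma sin_kernel_bounds:
  assumes j: "j \<in> freq_idx K" and \<rho>: "0 \<le> \<rho>" "\<rho> \<le> h"
  shows "\<bar>sin_kernel j \<rho>\<bar> \<le> h" "\<bar>sin_kernel j \<rho> - \<rho>\<bar> \<le> h\<^sup>2 / gap * bracket j"
proof -
  let ?w = "mod_freq h j"
  have w: "0 \<le> ?w" by (rule mod_freq_nonneg[OF j])
  have x: "0 \<le> \<rho> * ?w" "\<rho> * ?w \<le> pi"
    using \<rho> w mod_freq_less[OF j] mult_right_mono[OF \<rho>(2) w] by auto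
  have kernel: "\<rho> * cos (\<rho> * ?w) \<le> sin_kernel j \<rho>" "sin_kernel j \<rho> \<le> \<rho>" "0 \<le> sin_kernel j \<rho>"
    using mult_cos_le_sin[OF x] sin_x_le_x[OF x(1)] sin_ge_zero[OF x] w \<rho>
    by (auto simp: sin_kernel_def field_simps)
  show "\<bar>sin_kernel j \<rho>\<bar> \<le> h" using kernel \<rho> by simp
  have "1 - cos (\<rho> * ?w) = 2 * sin (\<rho> * ?w / 2) * sin (\<rho> * ?w / 2)"
    using cos_double_sin[of "\<rho> * ?w / 2"] by (simp add: power2_eq_square)
  also have "\<dots> \<le> 2 * (\<rho> * ?w / 2) * 1"
    using x by (intro mult_mono sin_x_le_x sin_ge_zero) auto
  finally have "\<rho> * (1 - cos (\<rho> * ?w)) \<le> \<rho> * (\<rho> * ?w)" using \<rho> by (intro mult_left_mono) auto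
  hence "\<bar>sin_kernel j \<rho> - \<rho>\<bar> \<le> \<rho> * (\<rho> * ?w)" using kernel by (simp add: right_diff_distrib)
  also have "\<dots> \<le> h * (h * (1 / gap * bracket j))"
    using \<rho> w h_pos gap_pos mod_freq_le_bracket[OF j] by (intro mult_mono) auto
  finally show "\<bar>sin_kernel j \<rho> - \<rho>\<bar> \<le> h\<^sup>2 / gap * bracket j" by (simp add: power2_eq_square)
qed

text \<open>
  The residuals of an exact solution in the one-step form of the leapfrog method. Here \<open>\<phi>\<close> is the
  nonlinearity along the solution, and the velocity is multiplied by the filter, because the
  numerical velocity approximates this product.
\<close>
definition position_defect :: "(real \<Rightarrow> int \<Rightarrow> complex) \<Rightarrow> (real \<Rightarrow> int \<Rightarrow> complex) \<Rightarrow>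
    (real \<Rightarrow> int \<Rightarrow> complex) \<Rightarrow> real \<Rightarrow> int \<Rightarrow> complex" where
  "position_defect z zd \<phi> t = (\<lambda>j. z (t + h) j - of_real (cos (h * mod_freq h j)) * z t j
     - of_real (h * freq_filter h j) * zd t j - of_real (h\<^sup>2 / 2) * \<phi> t j)"

definition velocity_defect :: "(real \<Rightarrow> int \<Rightarrow> complex) \<Rightarrow> (real \<Rightarrow> int \<Rightarrow> complex) \<Rightarrow>
    (real \<Rightarrow> int \<Rightarrow> complex) \<Rightarrow> real \<Rightarrow> int \<Rightarrow> complex" where
  "velocity_defect z zd \<phi> t = (\<lambda>j. of_real (freq_filter h j) * zd (t + h) j
     + of_real ((sin (h * mod_freq h j))\<^sup>2 / h) * z t j
     - of_real (cos (h * mod_freq h j) * freq_filter h j) * zd t j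
     - of_real (h / 2) * (of_real (cos (h * mod_freq h j)) * \<phi> t j + \<phi> (t + h) j))"

context
  fixes z zd \<phi> \<phi>1 \<phi>2 :: "real \<Rightarrow> int \<Rightarrow> complex" and t s B :: real
  assumes dz: "\<And>j \<tau>. j \<in> freq_idx K \<Longrightarrow> \<tau> \<in> {t..t + h} \<Longrightarrow>
      ((\<lambda>\<tau>. z \<tau> j) has_vector_derivative zd \<tau> j) (at \<tau> within {t..t + h})"
    and dzd: "\<And>j \<tau>. j \<in> freq_idx K \<Longrightarrow> \<tau> \<in> {t..t + h} \<Longrightarrow>
      ((\<lambda>\<tau>. zd \<tau> j) has_vector_derivative (\<phi> \<tau> j - of_real ((mod_freq h j)\<^sup>2) * z \<tau> j)) (at \<tau> within {t..t + h})"
    and d\<phi>: "\<And>j \<tau>. j \<in> freq_idx K \<Longrightarrow> \<tau> \<in> {t..t + h} \<Longrightarrow>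
      ((\<lambda>\<tau>. \<phi> \<tau> j) has_vector_derivative \<phi>1 \<tau> j) (at \<tau> within {t..t + h})"
    and d\<phi>1: "\<And>j \<tau>. j \<in> freq_idx K \<Longrightarrow> \<tau> \<in> {t..t + h} \<Longrightarrow>
      ((\<lambda>\<tau>. \<phi>1 \<tau> j) has_vector_derivative \<phi>2 \<tau> j) (at \<tau> within {t..t + h})"
    and \<phi>_bound: "\<And>\<tau>. \<tau> \<in> {t..t + h} \<Longrightarrow> sob_norm K (s + 1) (\<phi> \<tau>) \<le> B"
    and \<phi>1_bound: "\<And>\<tau>. \<tau> \<in> {t..t + h} \<Longrightarrow> sob_norm K s (\<phi>1 \<tau>) \<le> B"
    and \<phi>2_bound: "\<And>\<tau>. \<tau> \<in> {t..t + h} \<Longrightarrow> sob_norm K (s - 1) (\<phi>2 \<tau>) \<le> B"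
begin

lemma B_nonneg: "0 \<le> B"
  using \<phi>_bound[of t] h_pos order_trans[OF sob_norm_nonneg] by auto

lemma B_le_gap: "B \<le> B / gap"
  using B_nonneg gap_pos gap_le_1 by (simp add: pos_le_divide_eq mult_left_le)

text \<open>
  The curve \<open>X\<close> follows the linear flow backwards from the end of the step, so that only the
  nonlinearity is left in its derivative: the kernel times \<open>\<phi> \<tau>\<close>, from which the method differs by
  the replacement of the kernel by \<open>b - \<tau>\<close> and of \<open>\<phi> \<tau>\<close> by \<open>\<phi> t\<close>. Both replacements gain a factor \<open>h\<close>
  at the price of one derivative.
\<close>
lemma position_defect_bounds:
  "sob_norm K (s + 1) (position_defect z zd \<phi> t) \<le> 2 * B / gap * h\<^sup>2"
  "sob_norm K s (position_defect z zd \<phi> t) \<le> 2 * B / gap * h ^ 3"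
proof -
  define b where "b = t + h"
  define X where "X = (\<lambda>\<tau> j. of_real (cos ((b - \<tau>) * mod_freq h j)) * z \<tau> j
    + of_real (sin_kernel j (b - \<tau>)) * zd \<tau> j + of_real ((b - \<tau>)\<^sup>2 / 2) * \<phi> t j)"
  define X' where "X' = (\<lambda>\<tau> j. of_real (sin_kernel j (b - \<tau>)) * \<phi> \<tau> j - of_real (b - \<tau>) * \<phi> t j)"
  have tb: "t \<le> b" using h_pos by (simp add: b_def)
  have dX: "((\<lambda>\<tau>. X \<tau> j) has_vector_derivative X' \<tau> j) (at \<tau> within {t..b})"
    if j: "j \<in> freq_idx K" and \<tau>: "\<tau> \<in> {t..b}" for j \<tau>
  proof -
    let ?w = "mod_freq h j"
    have 1: "((\<lambda>\<tau>. cos ((b - \<tau>) * ?w)) has_real_derivative ?w * sin ((b - \<tau>) * ?w)) (at \<tau> within {t..b})"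
      by (auto intro!: derivative_eq_intros)
    have 2: "((\<lambda>\<tau>. (b - \<tau>)\<^sup>2 / 2) has_real_derivative - (b - \<tau>)) (at \<tau> within {t..b})"
      by (auto intro!: derivative_eq_intros)
    have 3: "((\<lambda>\<tau>. X \<tau> j) has_vector_derivative
        ((of_real (cos ((b - \<tau>) * ?w)) * zd \<tau> j + of_real (?w * sin ((b - \<tau>) * ?w)) * z \<tau> j)
        + (of_real (sin_kernel j (b - \<tau>)) * (\<phi> \<tau> j - of_real (?w\<^sup>2) * z \<tau> j)
          + of_real (- cos ((b - \<tau>) * ?w)) * zd \<tau> j)
        + (of_real ((b - \<tau>)\<^sup>2 / 2) * 0 + of_real (- (b - \<tau>)) * \<phi> t j))) (at \<tau> within {t..b})"
      unfolding X_def
      by (intro has_vector_derivative_add has_vector_derivative_of_real_mult 1 2 has_derivative_sin_kernel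
          has_vector_derivative_const dz[folded b_def] dzd[folded b_def] j \<tau>)
    have "?w * sin ((b - \<tau>) * ?w) = sin_kernel j (b - \<tau>) * ?w\<^sup>2"
      unfolding mod_freq_sin_kernel[symmetric] by (simp add: power2_eq_square)
    from 3[unfolded this] show ?thesis by (simp add: X'_def algebra_simps)
  qed
  have X_incr: "(\<lambda>j. X b j - X t j) = (\<lambda>j. z b j - of_real (cos (h * mod_freq h j)) * z t j
     - of_real (sin_kernel j h) * zd t j - of_real (h\<^sup>2 / 2) * \<phi> t j)"
    by (simp add: X_def b_def fun_eq_iff)
  have incr: "sob_norm K \<sigma> (position_defect z zd \<phi> t) = sob_norm K \<sigma> (\<lambda>j. X b j - X t j)" for \<sigma>
    unfolding X_incr position_defect_def
    by (rule sob_norm_cong) (simp add: sin_kernel_h b_def)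
  have bt: "b - t = h" by (simp add: b_def)
  have t_in: "t \<in> {t..t + h}" using h_pos by simp
  have 1: "sob_norm K (s + 1) (X' \<tau>) \<le> 2 * B * h" if \<tau>: "\<tau> \<in> {t..b}" for \<tau>
  proof -
    have \<tau>': "\<tau> \<in> {t..t + h}" "0 \<le> b - \<tau>" "b - \<tau> \<le> h" using \<tau> by (auto simp: b_def)
    have "sob_norm K (s + 1) (\<lambda>j. of_real (sin_kernel j (b - \<tau>)) * \<phi> \<tau> j) \<le> h * sob_norm K (s + 1) (\<phi> \<tau>)"
      using \<tau>' h_pos sin_kernel_bounds(1)
      by (intro sob_norm_bounded_multiplier) (auto simp: norm_mult intro!: mult_right_mono)
    moreover have "sob_norm K (s + 1) (\<lambda>j. of_real (b - \<tau>) * \<phi> t j) \<le> h * sob_norm K (s + 1) (\<phi> t)"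
      unfolding sob_norm_scale norm_of_real using \<tau>' by (intro mult_right_mono) auto
    moreover have "h * sob_norm K (s + 1) (\<phi> \<tau>) \<le> h * B" "h * sob_norm K (s + 1) (\<phi> t) \<le> h * B"
      using \<phi>_bound[OF \<tau>'(1)] \<phi>_bound[OF t_in] h_pos by auto
    ultimately have "sob_norm K (s + 1) (X' \<tau>) \<le> h * B + h * B"
      unfolding X'_def by (intro order_trans[OF sob_norm_triangle_diff] add_mono) linarith+
    thus ?thesis by simp
  qed
  have "sob_norm K (s + 1) (\<lambda>j. X b j - X t j) \<le> 2 * B * h * (b - t)"
    by (rule sob_norm_mean_value[OF tb dX 1])
  also have "\<dots> \<le> 2 * B / gap * h\<^sup>2"
    using mult_right_mono[OF B_le_gap, of "2 * h\<^sup>2"] by (simp add: bt power2_eq_square mult_ac)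
  finally show "sob_norm K (s + 1) (position_defect z zd \<phi> t) \<le> 2 * B / gap * h\<^sup>2"
    unfolding incr .
  have 2: "sob_norm K s (X' \<tau>) \<le> 2 * B / gap * h\<^sup>2" if \<tau>: "\<tau> \<in> {t..b}" for \<tau>
  proof -
    have \<tau>': "\<tau> \<in> {t..t + h}" "0 \<le> b - \<tau>" "b - \<tau> \<le> h" using \<tau> by (auto simp: b_def)
    have "sob_norm K s (\<lambda>j. of_real (sin_kernel j (b - \<tau>) - (b - \<tau>)) * \<phi> \<tau> j) \<le> h\<^sup>2 / gap * sob_norm K (s + 1) (\<phi> \<tau>)"
    proof (rule sob_norm_multiplier[where \<mu> = 1])
      fix j assume j: "j \<in> freq_idx K"
      show "cmod (of_real (sin_kernel j (b - \<tau>) - (b - \<tau>)) * \<phi> \<tau> j) \<le> h\<^sup>2 / gap * (bracket j powr 1 * cmod (\<phi> \<tau> j))"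
        unfolding norm_mult norm_of_real
        using mult_right_mono[OF sin_kernel_bounds(2)[OF j \<tau>'(2,3)], of "cmod (\<phi> \<tau> j)"] by (simp add: mult_ac)
    qed (use gap_pos in auto)
    also have "\<dots> \<le> h\<^sup>2 / gap * B"
      using \<phi>_bound[OF \<tau>'(1)] gap_pos by (intro mult_left_mono) auto
    finally have a: "sob_norm K s (\<lambda>j. of_real (sin_kernel j (b - \<tau>) - (b - \<tau>)) * \<phi> \<tau> j) \<le> h\<^sup>2 / gap * B" .
    have "sob_norm K s (\<lambda>j. \<phi> \<tau> j - \<phi> t j) \<le> B * (\<tau> - t)"
      by (rule sob_norm_mean_value_sub[OF d\<phi> \<phi>1_bound]) (use \<tau>' in auto)
    also have "\<dots> \<le> B * h" using \<tau>' B_nonneg by (intro mult_left_mono) auto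
    finally have "sob_norm K s (\<lambda>j. of_real (b - \<tau>) * (\<phi> \<tau> j - \<phi> t j)) \<le> h * (B * h)"
      unfolding sob_norm_scale norm_of_real using \<tau>' h_pos by (intro mult_mono) auto
    moreover have "X' \<tau> = (\<lambda>j. of_real (sin_kernel j (b - \<tau>) - (b - \<tau>)) * \<phi> \<tau> j + of_real (b - \<tau>) * (\<phi> \<tau> j - \<phi> t j))"
      by (simp add: X'_def algebra_simps)
    ultimately have "sob_norm K s (X' \<tau>) \<le> h\<^sup>2 / gap * B + h * (B * h)"
      using a by (auto intro!: order_trans[OF sob_norm_triangle] add_mono)
    also have "h\<^sup>2 / gap * B + h * (B * h) = B / gap * h\<^sup>2 + B * h\<^sup>2"
      by (simp add: power2_eq_square)
    also have "\<dots> \<le> B / gap * h\<^sup>2 + B / gap * h\<^sup>2"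
      by (intro add_left_mono mult_right_mono B_le_gap) simp
    finally show ?thesis by simp
  qed
  have "sob_norm K s (\<lambda>j. X b j - X t j) \<le> 2 * B / gap * h\<^sup>2 * (b - t)"
    by (rule sob_norm_mean_value[OF tb dX 2])
  thus "sob_norm K s (position_defect z zd \<phi> t) \<le> 2 * B / gap * h ^ 3"
    unfolding incr bt by (simp add: power2_eq_square power3_eq_cube mult_ac)
qed

text \<open>
  The curve \<open>V\<close> has the derivative \<open>g\<close>, and the method applies the trapezoidal rule to \<open>g\<close>, up to the
  factor \<open>1 - freq_filter h j\<close> in the remainder \<open>R\<close>. This factor is bounded by \<open>h\<langle>j\<rangle>\<close> as well as by
  \<open>(h\<langle>j\<rangle>)\<^sup>2\<close>, as needed for the two orders.
\<close>
lemma velocity_defect_bounds: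
  "sob_norm K s (velocity_defect z zd \<phi> t) \<le> 3 * B / gap * h\<^sup>2"
  "sob_norm K (s - 1) (velocity_defect z zd \<phi> t) \<le> 3 * B / gap * h ^ 3"
proof -
  define b where "b = t + h"
  have tb: "t \<le> b" and bt: "b - t = h" using h_pos by (auto simp: b_def)
  define c S where "c = (\<lambda>\<tau> j. cos ((b - \<tau>) * mod_freq h j))"
    and "S = (\<lambda>\<tau> j. mod_freq h j * sin ((b - \<tau>) * mod_freq h j))"
  define V where "V = (\<lambda>\<tau> j. of_real (c \<tau> j) * zd \<tau> j - of_real (S \<tau> j) * z \<tau> j)"
  define g where "g = (\<lambda>\<tau> j. of_real (c \<tau> j) * \<phi> \<tau> j)"
  define g1 where "g1 = (\<lambda>\<tau> j. of_real (c \<tau> j) * \<phi>1 \<tau> j + of_real (S \<tau> j) * \<phi> \<tau> j)"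
  define g2 where "g2 = (\<lambda>\<tau> j. (of_real (c \<tau> j) * \<phi>2 \<tau> j + of_real (S \<tau> j) * \<phi>1 \<tau> j)
     + (of_real (S \<tau> j) * \<phi>1 \<tau> j + of_real (- (mod_freq h j)\<^sup>2 * c \<tau> j) * \<phi> \<tau> j))"
  have dc: "((\<lambda>\<tau>. c \<tau> j) has_real_derivative S \<tau> j) (at \<tau> within U)"
    and dS: "((\<lambda>\<tau>. S \<tau> j) has_real_derivative - (mod_freq h j)\<^sup>2 * c \<tau> j) (at \<tau> within U)" for j \<tau> U
    unfolding c_def S_def by (auto intro!: derivative_eq_intros simp: power2_eq_square)
  have dV: "((\<lambda>\<tau>. V \<tau> j) has_vector_derivative g \<tau> j) (at \<tau> within {t..b})"
    and dg: "((\<lambda>\<tau>. g \<tau> j) has_vector_derivative g1 \<tau> j) (at \<tau> within {t..b})"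
    and dg1: "((\<lambda>\<tau>. g1 \<tau> j) has_vector_derivative g2 \<tau> j) (at \<tau> within {t..b})"
    if j: "j \<in> freq_idx K" and \<tau>: "\<tau> \<in> {t..b}" for j \<tau>
  proof -
    have "((\<lambda>\<tau>. V \<tau> j) has_vector_derivative
      (of_real (c \<tau> j) * (\<phi> \<tau> j - of_real ((mod_freq h j)\<^sup>2) * z \<tau> j) + of_real (S \<tau> j) * zd \<tau> j)
      - (of_real (S \<tau> j) * zd \<tau> j + of_real (- (mod_freq h j)\<^sup>2 * c \<tau> j) * z \<tau> j)) (at \<tau> within {t..b})"
      unfolding V_def
      by (intro has_vector_derivative_diff has_vector_derivative_of_real_mult dc dS
          dz[folded b_def] dzd[folded b_def] j \<tau>)
    thus "((\<lambda>\<tau>. V \<tau> j) has_vector_derivative g \<tau> j) (at \<tau> within {t..b})"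
      by (simp add: g_def algebra_simps)
    show "((\<lambda>\<tau>. g \<tau> j) has_vector_derivative g1 \<tau> j) (at \<tau> within {t..b})"
      unfolding g_def g1_def by (intro has_vector_derivative_of_real_mult dc d\<phi>[folded b_def] j \<tau>)
    show "((\<lambda>\<tau>. g1 \<tau> j) has_vector_derivative g2 \<tau> j) (at \<tau> within {t..b})"
      unfolding g1_def g2_def
      by (intro has_vector_derivative_add has_vector_derivative_of_real_mult dc dS
          d\<phi>[folded b_def] d\<phi>1[folded b_def] j \<tau>)
  qed
  have c_le: "\<bar>c \<tau> j\<bar> \<le> 1" for \<tau> j by (simp add: c_def)
  have S_le: "\<bar>S \<tau> j\<bar> \<le> 1 / gap * bracket j" if "j \<in> freq_idx K" for \<tau> j
  proof -
    have "\<bar>S \<tau> j\<bar> \<le> mod_freq h j * 1"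
      unfolding S_def abs_mult using mod_freq_nonneg[OF that] by (intro mult_mono) auto
    thus ?thesis using mod_freq_le_bracket[OF that] by simp
  qed
  have c_mult: "sob_norm K \<sigma> (\<lambda>j. of_real (c \<tau> j) * v j) \<le> sob_norm K \<sigma> v" for \<sigma> \<tau> v
    using sob_norm_bounded_multiplier[of K "\<lambda>j. of_real (c \<tau> j) * v j" 1 v \<sigma> \<sigma>] c_le
    by (simp add: norm_mult mult_left_le_one_le)
  have S_mult: "sob_norm K (\<sigma> - 1) (\<lambda>j. of_real (S \<tau> j) * v j) \<le> 1 / gap * sob_norm K \<sigma> v" for \<sigma> \<tau> v
  proof (rule sob_norm_multiplier[where \<mu> = 1])
    fix j assume "j \<in> freq_idx K"
    thus "cmod (of_real (S \<tau> j) * v j) \<le> 1 / gap * (bracket j powr 1 * cmod (v j))"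
      unfolding norm_mult norm_of_real
      using mult_right_mono[OF S_le[of j \<tau>], of "cmod (v j)"] by (simp add: mult_ac)
  qed (use gap_pos in auto)
  have gap_le: "1 / gap * v \<le> B / gap" if "v \<le> B" for v
    using that gap_pos by (simp add: divide_right_mono)
  have g1_le: "sob_norm K s (g1 \<tau>) \<le> 2 * B / gap" if \<tau>: "\<tau> \<in> {t..b}" for \<tau>
  proof -
    have \<tau>': "\<tau> \<in> {t..t + h}" using \<tau> by (simp add: b_def)
    have "sob_norm K s (g1 \<tau>) \<le> B + B / gap"
      unfolding g1_def
      using order_trans[OF c_mult \<phi>1_bound[OF \<tau>']]
        order_trans[OF S_mult[of "s + 1" \<tau> "\<phi> \<tau>"] gap_le[OF \<phi>_bound[OF \<tau>']]]
      by (intro order_trans[OF sob_norm_triangle] add_mono) auto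
    thus ?thesis using B_le_gap by simp
  qed
  have g2_le: "sob_norm K (s - 1) (g2 \<tau>) \<le> 4 * B / gap" if \<tau>: "\<tau> \<in> {t..b}" for \<tau>
  proof -
    have \<tau>': "\<tau> \<in> {t..t + h}" using \<tau> by (simp add: b_def)
    have "sob_norm K (s - 1) (\<lambda>j. of_real (- (mod_freq h j)\<^sup>2 * c \<tau> j) * \<phi> \<tau> j) \<le> 1 / gap * sob_norm K (s + 1) (\<phi> \<tau>)"
    proof (rule sob_norm_multiplier[where \<mu> = 2])
      fix j assume j: "j \<in> freq_idx K"
      have "\<bar>- (mod_freq h j)\<^sup>2 * c \<tau> j\<bar> \<le> (mod_freq h j)\<^sup>2 * 1"
        unfolding abs_mult using c_le by (intro mult_mono) auto
      also have "\<dots> \<le> (bracket j)\<^sup>2 / gap" using mod_freq_square_le_bracket[OF j] by simp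
      finally have "\<bar>- (mod_freq h j)\<^sup>2 * c \<tau> j\<bar> * cmod (\<phi> \<tau> j) \<le> (bracket j)\<^sup>2 / gap * cmod (\<phi> \<tau> j)"
        by (rule mult_right_mono) simp
      thus "cmod (of_real (- (mod_freq h j)\<^sup>2 * c \<tau> j) * \<phi> \<tau> j) \<le> 1 / gap * (bracket j powr 2 * cmod (\<phi> \<tau> j))"
        unfolding norm_mult norm_of_real using bracket_pos[of j] by (simp add: powr_numeral)
    qed (use gap_pos in auto)
    hence "sob_norm K (s - 1) (g2 \<tau>) \<le> (B + B / gap) + (B / gap + B / gap)"
      unfolding g2_def
      using order_trans[OF c_mult \<phi>2_bound[OF \<tau>']]
        order_trans[OF S_mult[of s \<tau> "\<phi>1 \<tau>"] gap_le[OF \<phi>1_bound[OF \<tau>']]] gap_le[OF \<phi>_bound[OF \<tau>']]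
      by (intro order_trans[OF sob_norm_triangle] add_mono) auto
    thus ?thesis using B_le_gap by simp
  qed
  define E where "E = (\<lambda>j. V b j - V t j - of_real ((b - t) / 2) * (g t j + g b j))"
  define R where "R = (\<lambda>j. of_real (h / 2 * (1 - freq_filter h j)) * (g t j + g b j))"
  have split: "velocity_defect z zd \<phi> t j = of_real (freq_filter h j) * E j - R j" if j: "j \<in> freq_idx K" for j
  proof -
    have "(sin (h * mod_freq h j))\<^sup>2 / h = freq_filter h j * S t j"
      using sin_mod_freq[OF j] h_pos by (simp add: S_def bt power2_eq_square)
    moreover have "c t j = cos (h * mod_freq h j)" "c b j = 1" "S b j = 0" by (auto simp: c_def S_def bt)
    moreover have "\<kappa> * zb + \<kappa> * \<sigma> * z0 - \<gamma> * \<kappa> * zd0 - \<eta> * (\<gamma> * p0 + pb)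
        = \<kappa> * ((1 * zb - 0 * z1) - (\<gamma> * zd0 - \<sigma> * z0) - \<eta> * (\<gamma> * p0 + 1 * pb)) - \<eta> * (1 - \<kappa>) * (\<gamma> * p0 + 1 * pb)"
      for \<kappa> \<sigma> \<gamma> \<eta> zb z0 z1 zd0 p0 pb :: complex by (simp add: algebra_simps)
    ultimately show ?thesis
      unfolding velocity_defect_def E_def R_def V_def g_def bt b_def[symmetric]
      by (simp only: of_real_mult of_real_diff of_real_1 of_real_0)
  qed
  have defect: "sob_norm K \<sigma> (velocity_defect z zd \<phi> t) \<le> sob_norm K \<sigma> E + sob_norm K \<sigma> R" for \<sigma>
  proof -
    have "sob_norm K \<sigma> (velocity_defect z zd \<phi> t) = sob_norm K \<sigma> (\<lambda>j. of_real (freq_filter h j) * E j - R j)"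
      by (rule sob_norm_cong) (rule split)
    also have "\<dots> \<le> sob_norm K \<sigma> (\<lambda>j. of_real (freq_filter h j) * E j) + sob_norm K \<sigma> R"
      by (rule sob_norm_triangle_diff)
    also have "sob_norm K \<sigma> (\<lambda>j. of_real (freq_filter h j) * E j) \<le> 1 * sob_norm K \<sigma> E"
    proof (rule sob_norm_bounded_multiplier)
      fix j assume "j \<in> freq_idx K"
      thus "cmod (of_real (freq_filter h j) * E j) \<le> 1 * cmod (E j)"
        unfolding norm_mult norm_of_real
        using freq_filter_le_1[of j] freq_filter_pos[of j] by (intro mult_right_mono) auto
    qed auto
    finally show ?thesis by simp
  qed
  have g_sum: "sob_norm K (s + 1) (\<lambda>j. g t j + g b j) \<le> 2 * B"
    using order_trans[OF sob_norm_triangle add_mono[OF order_trans[OF c_mult \<phi>_bound] order_trans[OF c_mult \<phi>_bound]], of t b t b] h_pos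
    unfolding g_def by (simp add: b_def)
  have "sob_norm K s R \<le> h * h / 2 * sob_norm K (s + 1) (\<lambda>j. g t j + g b j)"
  proof (rule sob_norm_multiplier[where \<mu> = 1])
    fix j assume j: "j \<in> freq_idx K"
    have "\<bar>h / 2 * (1 - freq_filter h j)\<bar> \<le> h / 2 * (h * bracket j)"
    proof -
      have "1 - freq_filter h j \<le> (h * freq j / 2) * (h * freq j)"
        using one_minus_freq_filter[OF j] by (simp add: power2_eq_square mult_ac)
      also have "\<dots> \<le> 1 * (h * freq j)"
        using h_freq[OF j] c0_less h_pos by (intro mult_right_mono) auto
      also have "\<dots> \<le> h * bracket j" using h_pos freq_le_bracket by simp
      finally show ?thesis using freq_filter_le_1[OF j] h_pos by (simp add: abs_mult)
    qed
    from mult_right_mono[OF this, of "cmod (g t j + g b j)"]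
    show "cmod (R j) \<le> h * h / 2 * (bracket j powr 1 * cmod (g t j + g b j))"
      unfolding R_def norm_mult norm_of_real by (simp add: mult_ac)
  qed (use h_pos in auto)
  also have "\<dots> \<le> h * h / 2 * (2 * B)" using g_sum h_pos by (intro mult_left_mono) auto
  finally have R1: "sob_norm K s R \<le> B * h\<^sup>2" by (simp add: power2_eq_square mult_ac)
  have "sob_norm K (s - 1) R \<le> h ^ 3 / 4 * sob_norm K (s + 1) (\<lambda>j. g t j + g b j)"
  proof (rule sob_norm_multiplier[where \<mu> = 2])
    fix j assume j: "j \<in> freq_idx K"
    have "\<bar>h / 2 * (1 - freq_filter h j)\<bar> \<le> h / 2 * (h\<^sup>2 * (bracket j)\<^sup>2 / 2)"
    proof -
      have "1 - freq_filter h j \<le> h\<^sup>2 * (freq j)\<^sup>2 / 2" by (rule one_minus_freq_filter[OF j])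
      also have "\<dots> \<le> h\<^sup>2 * (bracket j)\<^sup>2 / 2"
        using freq_le_bracket[of j] by (intro divide_right_mono mult_left_mono power_mono) auto
      finally show ?thesis using freq_filter_le_1[OF j] h_pos by (simp add: abs_mult)
    qed
    from mult_right_mono[OF this, of "cmod (g t j + g b j)"]
    show "cmod (R j) \<le> h ^ 3 / 4 * (bracket j powr 2 * cmod (g t j + g b j))"
      unfolding R_def norm_mult norm_of_real
      using bracket_pos[of j] by (simp add: powr_numeral power3_eq_cube power2_eq_square mult_ac)
  qed (use h_pos in auto)
  also have "\<dots> \<le> h ^ 3 / 4 * (2 * B)" using g_sum h_pos by (intro mult_left_mono) auto
  also have "\<dots> \<le> B * h ^ 3" using B_nonneg h_pos by (simp add: field_simps)
  finally have R2: "sob_norm K (s - 1) R \<le> B * h ^ 3" .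
  have gap_h: "B * h ^ n \<le> B / gap * h ^ n" for n
    using B_le_gap h_pos by (intro mult_right_mono) auto
  have "sob_norm K s E \<le> 2 * B / gap * (b - t)\<^sup>2"
    unfolding E_def by (rule trapezoidal_rule_first_order[OF dV dg g1_le tb])
  hence "sob_norm K s (velocity_defect z zd \<phi> t) \<le> 2 * B / gap * h\<^sup>2 + B / gap * h\<^sup>2"
    using defect[of s] R1 gap_h[of 2] unfolding bt by linarith
  also have "\<dots> = 3 * B / gap * h\<^sup>2" by (simp add: field_simps)
  finally show "sob_norm K s (velocity_defect z zd \<phi> t) \<le> 3 * B / gap * h\<^sup>2" .
  have "sob_norm K (s - 1) E \<le> 4 * B / gap / 2 * (b - t) ^ 3"
    unfolding E_def by (rule trapezoidal_rule_second_order[OF dV dg dg1 g2_le tb])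
  hence "sob_norm K (s - 1) (velocity_defect z zd \<phi> t) \<le> 4 * B / gap / 2 * h ^ 3 + B / gap * h ^ 3"
    using defect[of "s - 1"] R2 gap_h[of 3] unfolding bt by linarith
  also have "\<dots> = 3 * B / gap * h ^ 3" by (simp add: field_simps)
  finally show "sob_norm K (s - 1) (velocity_defect z zd \<phi> t) \<le> 3 * B / gap * h ^ 3" .
qed

end

end

section \<open>Global error of the numerical method\<close>

lemma discrete_gronwall_step:
  fixes N :: "nat \<Rightarrow> real"
  assumes "N n \<le> \<delta> * real n * q ^ n" "N (Suc n) \<le> q * N n + \<delta>" "1 \<le> q" "0 \<le> \<delta>"
  shows "N (Suc n) \<le> \<delta> * real (Suc n) * q ^ Suc n"
proof -
  have "N (Suc n) \<le> q * (\<delta> * real n * q ^ n) + \<delta>"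
    using assms(2) mult_left_mono[OF assms(1), of q] assms(3) by linarith
  also have "\<dots> \<le> q * (\<delta> * real n * q ^ n) + \<delta> * q ^ Suc n"
    using one_le_power[OF assms(3), of "Suc n"] assms(4) by (intro add_left_mono) (simp add: mult_le_cancel_left1)
  also have "\<dots> = \<delta> * real (Suc n) * q ^ Suc n" by (simp add: algebra_simps)
  finally show ?thesis .
qed

lemma discrete_gronwall_bound:
  fixes h A T c :: real
  assumes "0 < h" "0 \<le> A" "0 \<le> c" "real n * h \<le> T"
  shows "c * h ^ Suc k * real n * (1 + A * h) ^ n \<le> c * T * exp (A * T) * h ^ k"
proof -
  have "(1 + A * h) ^ n \<le> exp (A * h) ^ n"
    using exp_ge_add_one_self[of "A * h"] assms by (intro power_mono) auto
  also have "\<dots> = exp (A * (real n * h))" by (simp add: exp_of_nat_mult[symmetric] mult_ac)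
  also have "\<dots> \<le> exp (A * T)" using assms by (simp add: mult_left_mono)
  finally have "(c * h ^ k) * ((real n * h) * (1 + A * h) ^ n) \<le> (c * h ^ k) * (T * exp (A * T))"
    using assms order_trans[of 0 "real n * h" T] by (intro mult_left_mono mult_mono) auto
  thus ?thesis by (simp add: mult_ac)
qed

context resolved_step
begin

text \<open>
  Let \<open>w\<close> be the modified frequency and \<open>b = sin (h w) / h\<close>. The linear part of a step rotates the
  vector with the components \<open>b\<close> times the position and the velocity. The additional \<open>1\<close> in the
  weight is there for the zero mode, for which \<open>b\<close> vanishes.
\<close>
definition energy_weight :: "int \<Rightarrow> real" where
  "energy_weight j = sqrt ((sin (h * mod_freq h j) / h)\<^sup>2 + 1)"

definition energy_norm :: "real \<Rightarrow> (int \<Rightarrow> complex) \<Rightarrow> (int \<Rightarrow> complex) \<Rightarrow> real" where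
  "energy_norm r e \<eta> = L2_set (\<lambda>j. bracket j powr (r - 1) *
     norm (of_real (energy_weight j) * e j, \<eta> j)) (freq_idx K)"

lemma energy_weight_square: "(energy_weight j)\<^sup>2 = (sin (h * mod_freq h j) / h)\<^sup>2 + 1"
  by (simp add: energy_weight_def)

lemma energy_weight_nonneg [simp]: "0 \<le> energy_weight j"
  by (simp add: energy_weight_def)

lemma energy_weight_bounds:
  assumes j: "j \<in> freq_idx K"
  shows "bracket j \<le> 1 / gap * energy_weight j" "energy_weight j \<le> 2 * bracket j"
proof -
  let ?c = "(cos (h * mod_freq h j / 2))\<^sup>2"
  have eq: "(energy_weight j)\<^sup>2 = (freq j)\<^sup>2 * ?c + 1"
    using h_pos by (simp add: energy_weight_square power_divide sin_mod_freq_square[OF j])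
  have "gap * bracket j \<le> energy_weight j"
  proof (rule power2_le_imp_le)
    have "(gap * bracket j)\<^sup>2 \<le> gap * ((freq j)\<^sup>2 + 1)"
    proof -
      have "(gap * bracket j)\<^sup>2 = gap * (gap * (bracket j)\<^sup>2)" by (simp add: power2_eq_square)
      also have "\<dots> \<le> gap * (1 * ((freq j)\<^sup>2 + 1))"
        using gap_pos gap_le_1 bracket_square_le[of j] by (intro mult_left_mono mult_mono) auto
      finally show ?thesis by simp
    qed
    also have "\<dots> \<le> (freq j)\<^sup>2 * ?c + 1"
      using mult_right_mono[OF gap_le_cos_half_square[OF j], of "(freq j)\<^sup>2"] gap_le_1
      by (simp add: algebra_simps)
    finally show "(gap * bracket j)\<^sup>2 \<le> (energy_weight j)\<^sup>2" unfolding eq .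
  qed simp
  thus "bracket j \<le> 1 / gap * energy_weight j" using gap_pos by (simp add: field_simps)
  show "energy_weight j \<le> 2 * bracket j"
  proof (rule power2_le_imp_le)
    have "(freq j)\<^sup>2 * ?c \<le> (freq j)\<^sup>2 * 1"
      using abs_cos_le_one by (intro mult_left_mono) (auto simp: abs_square_le_1)
    also have "\<dots> \<le> (bracket j)\<^sup>2" using freq_le_bracket[of j] by (simp add: power_mono)
    finally have "(freq j)\<^sup>2 * ?c + 1 \<le> 4 * (bracket j)\<^sup>2"
      using one_le_power[OF bracket_ge_1[of j], of 2] by linarith
    thus "(energy_weight j)\<^sup>2 \<le> (2 * bracket j)\<^sup>2" unfolding eq by (simp add: power_mult_distrib)
  qed simp
qed

lemma energy_norm_nonneg [simp]: "0 \<le> energy_norm r e \<eta>"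
  by (simp add: energy_norm_def)

lemma energy_norm_triangle:
  "energy_norm r (\<lambda>j. e j + e' j) (\<lambda>j. \<eta> j + \<eta>' j) \<le> energy_norm r e \<eta> + energy_norm r e' \<eta>'"
proof -
  have "bracket j powr (r - 1) * norm (of_real (energy_weight j) * (e j + e' j), \<eta> j + \<eta>' j)
     \<le> 1 * (bracket j powr (r - 1) * norm (of_real (energy_weight j) * e j, \<eta> j))
      + 1 * (bracket j powr (r - 1) * norm (of_real (energy_weight j) * e' j, \<eta>' j))" for j
    using mult_left_mono[OF norm_triangle_ineq[of "(of_real (energy_weight j) * e j, \<eta> j)"
        "(of_real (energy_weight j) * e' j, \<eta>' j)"], of "bracket j powr (r - 1)"]
    by (simp add: distrib_left)
  from L2_set_le_combination[OF _ this] show ?thesis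
    by (simp add: energy_norm_def)
qed

lemma sob_norm_position_le_energy_norm: "sob_norm K r e \<le> 1 / gap * energy_norm r e \<eta>"
proof -
  have "L2_set (\<lambda>j. bracket j powr r * cmod (e j)) (freq_idx K)
      \<le> L2_set (\<lambda>j. 1 / gap * (bracket j powr (r - 1) * norm (of_real (energy_weight j) * e j, \<eta> j))) (freq_idx K)"
  proof (rule L2_set_mono)
    fix j assume j: "j \<in> freq_idx K"
    have "bracket j powr r * cmod (e j) = bracket j powr (r - 1) * (bracket j * cmod (e j))"
      using bracket_pos[of j] by (simp add: powr_diff)
    also have "\<dots> \<le> bracket j powr (r - 1) * ((1 / gap * energy_weight j) * cmod (e j))"
      by (intro mult_left_mono mult_right_mono energy_weight_bounds j) auto
    also have "\<dots> = 1 / gap * (bracket j powr (r - 1) * norm (of_real (energy_weight j) * e j))"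
      by (simp add: norm_mult)
    also have "\<dots> \<le> 1 / gap * (bracket j powr (r - 1) * norm (of_real (energy_weight j) * e j, \<eta> j))"
      using gap_pos by (intro mult_left_mono) (auto simp: norm_Pair)
    finally show "bracket j powr r * cmod (e j)
        \<le> 1 / gap * (bracket j powr (r - 1) * norm (of_real (energy_weight j) * e j, \<eta> j))" .
  qed simp
  also have "\<dots> = 1 / gap * energy_norm r e \<eta>"
    unfolding energy_norm_def by (rule L2_set_right_distrib[symmetric]) (use gap_pos in simp)
  finally show ?thesis unfolding sob_norm_L2_set .
qed

lemma sob_norm_velocity_le_energy_norm: "sob_norm K (r - 1) \<eta> \<le> energy_norm r e \<eta>"
  unfolding sob_norm_L2_set energy_norm_def
  by (intro L2_set_mono mult_left_mono) (auto simp: norm_Pair)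

lemma energy_norm_le: "energy_norm r e \<eta> \<le> 2 * sob_norm K r e + sob_norm K (r - 1) \<eta>"
proof -
  have "bracket j powr (r - 1) * norm (of_real (energy_weight j) * e j, \<eta> j)
      \<le> 2 * (bracket j powr r * cmod (e j)) + 1 * (bracket j powr (r - 1) * cmod (\<eta> j))"
    if j: "j \<in> freq_idx K" for j
  proof -
    have "norm (of_real (energy_weight j) * e j, \<eta> j) \<le> norm (of_real (energy_weight j) * e j) + norm (\<eta> j)"
      by (rule norm_Pair_le)
    also have "\<dots> \<le> 2 * bracket j * cmod (e j) + cmod (\<eta> j)"
      using energy_weight_bounds[OF j] by (simp add: norm_mult mult_right_mono)
    finally have "bracket j powr (r - 1) * norm (of_real (energy_weight j) * e j, \<eta> j)
        \<le> bracket j powr (r - 1) * (2 * bracket j * cmod (e j) + cmod (\<eta> j))"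
      by (rule mult_left_mono) simp
    moreover have "bracket j powr r = bracket j powr (r - 1) * bracket j"
      using bracket_pos[of j] by (simp add: powr_diff)
    ultimately show ?thesis by (simp add: algebra_simps)
  qed
  from L2_set_le_combination[OF _ this] show ?thesis
    by (simp add: energy_norm_def sob_norm_L2_set)
qed

text \<open>
  The part of the norm with \<open>b = sin (h w) / h\<close> is preserved. The rest is the modulus of the position,
  which grows at most by \<open>h\<close> times that of the velocity.
\<close>
lemma energy_norm_linear_flow:
  "energy_norm r (\<lambda>j. of_real (cos (h * mod_freq h j)) * e j + of_real h * \<eta> j)
     (\<lambda>j. of_real (cos (h * mod_freq h j)) * \<eta> j - of_real ((sin (h * mod_freq h j))\<^sup>2 / h) * e j)
   \<le> (1 + h) * energy_norm r e \<eta>"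
proof -
  have "norm (of_real (energy_weight j) * (of_real (cos (h * mod_freq h j)) * e j + of_real h * \<eta> j),
      of_real (cos (h * mod_freq h j)) * \<eta> j - of_real ((sin (h * mod_freq h j))\<^sup>2 / h) * e j)
    \<le> (1 + h) * norm (of_real (energy_weight j) * e j, \<eta> j)" (is "norm (of_real _ * ?e, ?\<eta>) \<le> _") for j
  proof (rule power2_le_imp_le)
    define c S b where "c = cos (h * mod_freq h j)" and "S = sin (h * mod_freq h j)" and "b = S / h"
    have hb: "S = h * b" using h_pos by (simp add: b_def)
    have cS: "c * c = 1 - h * b * (h * b)"
      using sin_cos_squared_add[of "h * mod_freq h j"]
      unfolding c_def[symmetric] S_def[symmetric] hb by (simp add: power2_eq_square)
    have ee: "?e = of_real c * e j + of_real h * \<eta> j" by (simp add: c_def)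
    have \<eta>\<eta>: "?\<eta> = of_real c * \<eta> j - of_real (h * b * b) * e j"
      using h_pos by (simp add: c_def b_def S_def power2_eq_square)
    have rotation: "b\<^sup>2 * (cmod ?e)\<^sup>2 + (cmod ?\<eta>)\<^sup>2 = b\<^sup>2 * (cmod (e j))\<^sup>2 + (cmod (\<eta> j))\<^sup>2"
    proof -
      have ring: "b\<^sup>2 * (c * u + h * v)\<^sup>2 + (c * v - h * b * b * u)\<^sup>2 = b\<^sup>2 * u\<^sup>2 + v\<^sup>2" for u v :: real
      proof -
        have "b\<^sup>2 * (c * u + h * v)\<^sup>2 + (c * v - h * b * b * u)\<^sup>2
            = (c * c + h * b * (h * b)) * (b\<^sup>2 * u\<^sup>2 + v\<^sup>2)"
          by (simp add: power2_eq_square algebra_simps)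
        thus ?thesis using cS by simp
      qed
      show ?thesis unfolding ee \<eta>\<eta> cmod_power2
        using ring[of "Re (e j)" "Re (\<eta> j)"] ring[of "Im (e j)" "Im (\<eta> j)"]
        by (simp add: distrib_left)
    qed
    have "cmod ?e \<le> cmod (e j) + h * cmod (\<eta> j)"
    proof -
      have "cmod ?e \<le> \<bar>c\<bar> * cmod (e j) + \<bar>h\<bar> * cmod (\<eta> j)"
        unfolding ee by (rule order_trans[OF norm_triangle_ineq]) (simp only: norm_mult norm_of_real order_refl)
      also have "\<dots> \<le> 1 * cmod (e j) + h * cmod (\<eta> j)"
        using h_pos by (intro add_mono mult_right_mono) (auto simp: c_def)
      finally show ?thesis by simp
    qed
    hence "(cmod ?e)\<^sup>2 \<le> (cmod (e j) + h * cmod (\<eta> j))\<^sup>2" by (intro power_mono) auto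
    also have "\<dots> = (cmod (e j))\<^sup>2 + h * (2 * cmod (e j) * cmod (\<eta> j)) + h\<^sup>2 * (cmod (\<eta> j))\<^sup>2"
      by (simp add: power2_eq_square algebra_simps)
    also have "\<dots> \<le> (cmod (e j))\<^sup>2 + h * ((cmod (e j))\<^sup>2 + (cmod (\<eta> j))\<^sup>2) + h\<^sup>2 * (cmod (\<eta> j))\<^sup>2"
      using h_pos sum_squares_bound by (intro add_mono mult_left_mono) auto
    finally have growth: "(cmod ?e)\<^sup>2 \<le> (cmod (e j))\<^sup>2 + h * ((cmod (e j))\<^sup>2 + (cmod (\<eta> j))\<^sup>2) + h\<^sup>2 * (cmod (\<eta> j))\<^sup>2" .
    have sq: "(norm (of_real (energy_weight j) * u, v))\<^sup>2 = (b\<^sup>2 * (cmod u)\<^sup>2 + (cmod v)\<^sup>2) + (cmod u)\<^sup>2"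
      for u v :: complex
      by (simp add: norm_Pair norm_mult power_mult_distrib energy_weight_square b_def S_def algebra_simps)
    define Q where "Q = b\<^sup>2 * (cmod (e j))\<^sup>2 + (cmod (\<eta> j))\<^sup>2 + (cmod (e j))\<^sup>2"
    have Q: "(cmod (e j))\<^sup>2 + (cmod (\<eta> j))\<^sup>2 \<le> Q" "(cmod (\<eta> j))\<^sup>2 \<le> Q" "0 \<le> Q" by (auto simp: Q_def)
    have "(norm (of_real (energy_weight j) * ?e, ?\<eta>))\<^sup>2
        \<le> Q + h * ((cmod (e j))\<^sup>2 + (cmod (\<eta> j))\<^sup>2) + h\<^sup>2 * (cmod (\<eta> j))\<^sup>2"
      unfolding sq rotation using growth by (simp add: Q_def)
    also have "\<dots> \<le> Q + h * Q + h\<^sup>2 * Q"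
      using Q h_pos by (intro add_mono mult_left_mono) auto
    also have "\<dots> \<le> (1 + h)\<^sup>2 * Q"
      using mult_nonneg_nonneg[OF less_imp_le[OF h_pos] Q(3)] by (simp add: power2_eq_square algebra_simps)
    also have "\<dots> = ((1 + h) * norm (of_real (energy_weight j) * e j, \<eta> j))\<^sup>2"
      unfolding power_mult_distrib sq Q_def ..
    finally show "(norm (of_real (energy_weight j) * ?e, ?\<eta>))\<^sup>2
        \<le> ((1 + h) * norm (of_real (energy_weight j) * e j, \<eta> j))\<^sup>2" .
  qed (use h_pos in simp)
  note pw = this
  have "energy_norm r (\<lambda>j. of_real (cos (h * mod_freq h j)) * e j + of_real h * \<eta> j)
     (\<lambda>j. of_real (cos (h * mod_freq h j)) * \<eta> j - of_real ((sin (h * mod_freq h j))\<^sup>2 / h) * e j)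
    \<le> L2_set (\<lambda>j. (1 + h) * (bracket j powr (r - 1) * norm (of_real (energy_weight j) * e j, \<eta> j))) (freq_idx K)"
    unfolding energy_norm_def
  proof (rule L2_set_mono)
    fix j
    show "bracket j powr (r - 1) * norm (of_real (energy_weight j) * (of_real (cos (h * mod_freq h j)) * e j + of_real h * \<eta> j),
      of_real (cos (h * mod_freq h j)) * \<eta> j - of_real ((sin (h * mod_freq h j))\<^sup>2 / h) * e j)
      \<le> (1 + h) * (bracket j powr (r - 1) * norm (of_real (energy_weight j) * e j, \<eta> j))"
      using mult_left_mono[OF pw[of j], of "bracket j powr (r - 1)"] by (simp only: mult_ac) simp
  qed simp
  thus ?thesis
    using h_pos by (simp add: energy_norm_def L2_set_right_distrib)
qed

text \<open>
  The position after a step does not involve the nonlinearity at the new time. It is therefore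
  controlled first, and this control is then used for the nonlinearity in the new velocity.
\<close>
lemma error_propagation:
  fixes e \<eta> e1 \<eta>1 D0 D1 d1 d2 :: "int \<Rightarrow> complex" and L \<delta> r :: real
  defines "\<Lambda> \<equiv> L / gap"
  defines "P \<equiv> (1 + (2 + 4 * \<Lambda>) * h) * energy_norm r e \<eta> + 2 * \<delta>"
  assumes e1: "\<And>j. j \<in> freq_idx K \<Longrightarrow> e1 j = of_real (cos (h * mod_freq h j)) * e j + of_real h * \<eta> j
      + of_real (h\<^sup>2 / 2) * D0 j + d1 j"
    and \<eta>1: "\<And>j. j \<in> freq_idx K \<Longrightarrow> \<eta>1 j = of_real (cos (h * mod_freq h j)) * \<eta> j
      - of_real ((sin (h * mod_freq h j))\<^sup>2 / h) * e j
      + of_real (h / 2) * (of_real (cos (h * mod_freq h j)) * D0 j + D1 j) + d2 j"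
    and D0: "sob_norm K r D0 \<le> L * sob_norm K r e"
    and d: "2 * sob_norm K r d1 + sob_norm K (r - 1) d2 \<le> \<delta>"
    and L: "0 \<le> L" and h: "h \<le> 1" "h * \<Lambda> \<le> 1"
  shows "sob_norm K r e1 \<le> P / gap"
    and "sob_norm K r D1 \<le> L * sob_norm K r e1 \<Longrightarrow> energy_norm r e1 \<eta>1 \<le> P"
proof -
  let ?c = "\<lambda>j. complex_of_real (cos (h * mod_freq h j))"
  have \<Lambda>: "0 \<le> \<Lambda>" using L gap_pos by (simp add: \<Lambda>_def)
  have \<delta>: "0 \<le> \<delta>"
    using d sob_norm_nonneg[of K r d1] sob_norm_nonneg[of K "r - 1" d2] by linarith
  define N where "N = energy_norm r e \<eta>"
  have N: "0 \<le> N" by (simp add: N_def)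
  define P0 where "P0 = (1 + (1 + 2 * \<Lambda>) * h) * N + \<delta>"
  \<comment> \<open>The new errors without the contribution of \<open>D1\<close> to the velocity.\<close>
  define x where "x = (\<lambda>j. ?c j * e j + of_real h * \<eta> j + (of_real (h\<^sup>2 / 2) * D0 j + d1 j))"
  define v where "v = (\<lambda>j. ?c j * \<eta> j - of_real ((sin (h * mod_freq h j))\<^sup>2 / h) * e j
      + (of_real (h / 2) * (?c j * D0 j) + d2 j))"
  have LN: "L * sob_norm K r e \<le> \<Lambda> * N"
    using mult_left_mono[OF sob_norm_position_le_energy_norm[of r e \<eta>] L] by (simp add: \<Lambda>_def N_def)
  have "energy_norm r x v \<le> (1 + h) * N + (energy_norm r (\<lambda>j. of_real (h\<^sup>2 / 2) * D0 j) (\<lambda>j. of_real (h / 2) * (?c j * D0 j))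
      + energy_norm r d1 d2)"
    unfolding x_def v_def N_def
    by (intro order_trans[OF energy_norm_triangle] add_mono energy_norm_linear_flow energy_norm_triangle)
  also have "energy_norm r (\<lambda>j. of_real (h\<^sup>2 / 2) * D0 j) (\<lambda>j. of_real (h / 2) * (?c j * D0 j)) \<le> 2 * \<Lambda> * h * N"
  proof -
    have "sob_norm K r (\<lambda>j. of_real (h\<^sup>2 / 2) * D0 j) = h\<^sup>2 / 2 * sob_norm K r D0"
      unfolding sob_norm_scale norm_of_real by simp
    moreover have "sob_norm K (r - 1) (\<lambda>j. of_real (h / 2) * (?c j * D0 j)) \<le> h / 2 * sob_norm K r D0"
      unfolding sob_norm_scale norm_of_real
    proof (intro mult_mono)
      show "sob_norm K (r - 1) (\<lambda>j. ?c j * D0 j) \<le> sob_norm K r D0"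
        using sob_norm_bounded_multiplier[of K "\<lambda>j. ?c j * D0 j" 1 D0 "r - 1" r]
        by (simp add: norm_mult mult_left_le_one_le)
    qed (use h_pos in auto)
    ultimately have "energy_norm r (\<lambda>j. of_real (h\<^sup>2 / 2) * D0 j) (\<lambda>j. of_real (h / 2) * (?c j * D0 j))
        \<le> 2 * (h\<^sup>2 / 2 * sob_norm K r D0) + h / 2 * sob_norm K r D0"
      using energy_norm_le[of r "\<lambda>j. of_real (h\<^sup>2 / 2) * D0 j" "\<lambda>j. of_real (h / 2) * (?c j * D0 j)"] by linarith
    also have "\<dots> = (h\<^sup>2 + h / 2) * sob_norm K r D0" by (simp add: algebra_simps)
    also have "\<dots> \<le> (2 * h) * (\<Lambda> * N)"
    proof (intro mult_mono)
      have "h\<^sup>2 \<le> h" using h_pos h by (simp add: power2_eq_square mult_left_le)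
      thus "h\<^sup>2 + h / 2 \<le> 2 * h" using h_pos by linarith
      show "sob_norm K r D0 \<le> \<Lambda> * N" using D0 LN by linarith
    qed (use h_pos in auto)
    finally show ?thesis by (simp add: mult_ac)
  qed
  also have "energy_norm r d1 d2 \<le> \<delta>" using energy_norm_le d by (rule order_trans)
  finally have xv: "energy_norm r x v \<le> P0" by (simp add: P0_def algebra_simps)
  have P0: "0 \<le> P0" using xv energy_norm_nonneg order_trans by blast
  have P: "(1 + h * \<Lambda> / 2) * P0 \<le> P"
  proof -
    have "(1 + h * \<Lambda> / 2) * P0 = (1 + (1 + 2 * \<Lambda>) * h) * N + h * \<Lambda> / 2 * N
        + (h * \<Lambda>) * ((1 + 2 * \<Lambda>) * h / 2 * N) + (1 + h * \<Lambda> / 2) * \<delta>"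
      by (simp add: P0_def algebra_simps)
    also have "\<dots> \<le> (1 + (1 + 2 * \<Lambda>) * h) * N + h * \<Lambda> / 2 * N
        + 1 * ((1 + 2 * \<Lambda>) * h / 2 * N) + 2 * \<delta>"
      using h \<Lambda> h_pos N \<delta> by (intro add_mono mult_right_mono) auto
    also have "\<dots> \<le> (1 + (2 + 4 * \<Lambda>) * h) * N + 2 * \<delta>"
    proof -
      define u v where "u = h * N" and "v = \<Lambda> * (h * N)"
      have "0 \<le> u" "0 \<le> v" using h_pos N \<Lambda> by (auto simp: u_def v_def)
      moreover have "(1 + (1 + 2 * \<Lambda>) * h) * N + h * \<Lambda> / 2 * N + 1 * ((1 + 2 * \<Lambda>) * h / 2 * N)
          = N + 3 / 2 * u + 7 / 2 * v"
        by (simp add: u_def v_def field_simps)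
      moreover have "(1 + (2 + 4 * \<Lambda>) * h) * N = N + 2 * u + 4 * v"
        by (simp add: u_def v_def algebra_simps)
      ultimately show ?thesis by linarith
    qed
    finally show ?thesis by (simp add: P_def N_def)
  qed
  have P0P: "P0 \<le> P"
    using P mult_nonneg_nonneg[OF _ P0, of "h * \<Lambda> / 2"] h_pos \<Lambda> by (simp add: distrib_right)
  have "sob_norm K r e1 = sob_norm K r x"
    by (rule sob_norm_cong) (simp add: e1 x_def)
  also have "\<dots> \<le> 1 / gap * P0"
    using sob_norm_position_le_energy_norm[of r x v] mult_left_mono[OF xv, of "1 / gap"] gap_pos by simp
  finally have e1_le: "sob_norm K r e1 \<le> P0 / gap" by simp
  also have "\<dots> \<le> P / gap" using P0P gap_pos by (simp add: divide_right_mono)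
  finally show "sob_norm K r e1 \<le> P / gap" .
  assume D1: "sob_norm K r D1 \<le> L * sob_norm K r e1"
  have "energy_norm r e1 \<eta>1 = energy_norm r (\<lambda>j. x j + 0) (\<lambda>j. v j + of_real (h / 2) * D1 j)"
    unfolding energy_norm_def
    by (rule L2_set_cong) (simp_all add: e1 \<eta>1 x_def v_def algebra_simps)
  also have "\<dots> \<le> energy_norm r x v + energy_norm r (\<lambda>j. 0) (\<lambda>j. of_real (h / 2) * D1 j)"
    by (rule energy_norm_triangle)
  also have "\<dots> \<le> P0 + h / 2 * (L * (P0 / gap))"
  proof (rule add_mono[OF xv])
    have "energy_norm r (\<lambda>j. 0) (\<lambda>j. of_real (h / 2) * D1 j) \<le> sob_norm K (r - 1) (\<lambda>j. of_real (h / 2) * D1 j)"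
      using energy_norm_le[of r "\<lambda>j. 0"] by simp
    also have "\<dots> \<le> h / 2 * sob_norm K r D1"
      unfolding sob_norm_scale norm_of_real using h_pos by (intro mult_mono sob_norm_mono) auto
    also have "\<dots> \<le> h / 2 * (L * (P0 / gap))"
      using D1 mult_left_mono[OF e1_le L] h_pos by (intro mult_left_mono) auto
    finally show "energy_norm r (\<lambda>j. 0) (\<lambda>j. of_real (h / 2) * D1 j) \<le> h / 2 * (L * (P0 / gap))" .
  qed
  also have "\<dots> = (1 + h * \<Lambda> / 2) * P0" by (simp add: \<Lambda>_def algebra_simps)
  also have "\<dots> \<le> P" by (rule P)
  finally show "energy_norm r e1 \<eta>1 \<le> P" .
qed

text \<open>
  The position update is half the sum of the two-step recursion and the definition of the
  velocity, the velocity update results from two position updates. The starting step of the method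
  is the position update for \<open>n = 0\<close>.
\<close>
lemma leapfrog_one_step:
  assumes "leapfrog K p h y0 yd0 Y Yd" and j: "j \<in> freq_idx K"
  shows "Y (Suc n) j = of_real (cos (h * mod_freq h j)) * Y n j + of_real h * Yd n j
      + of_real (h\<^sup>2 / 2) * conv_power K p (Y n) j"
    and "Yd (Suc n) j = of_real (cos (h * mod_freq h j)) * Yd n j
      - of_real ((sin (h * mod_freq h j))\<^sup>2 / h) * Y n j
      + of_real (h / 2) * (of_real (cos (h * mod_freq h j)) * conv_power K p (Y n) j
          + conv_power K p (Y (Suc n)) j)"
proof -
  let ?c = "complex_of_real (cos (h * mod_freq h j))"
  let ?F = "\<lambda>n. conv_power K p (Y n) j"
  have start: "Y 1 j = Y 0 j + of_real h * Yd 0 j - 1/2 * (of_real h)\<^sup>2 * (of_real (freq j))\<^sup>2 * Y 0 j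
                + 1/2 * (of_real h)\<^sup>2 * ?F 0"
    and two_step: "\<And>n. 1 \<le> n \<Longrightarrow> Y (n + 1) j - 2 * Y n j + Y (n - 1) j
                = - (of_real h)\<^sup>2 * (of_real (freq j))\<^sup>2 * Y n j + (of_real h)\<^sup>2 * ?F n"
    and velocity: "\<And>n. 1 \<le> n \<Longrightarrow> 2 * of_real h * Yd n j = Y (n + 1) j - Y (n - 1) j"
    using assms by (auto simp: leapfrog_def)
  have c: "2 * ?c = 2 - (of_real h)\<^sup>2 * (of_real (freq j))\<^sup>2"
    by (simp add: cos_mod_freq[OF j])
  have pos: "2 * Y (Suc n) j = 2 * ?c * Y n j + 2 * of_real h * Yd n j + (of_real h)\<^sup>2 * ?F n" for n
  proof (cases "n = 0")
    case True
    thus ?thesis using arg_cong[OF start, of "\<lambda>v. 2 * v"] unfolding c by (simp add: algebra_simps)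
  next
    case False
    hence "1 \<le> n" by simp
    have "Y (n - 1) j = Y (n + 1) j - 2 * of_real h * Yd n j"
      using velocity[OF \<open>1 \<le> n\<close>] by simp
    from two_step[OF \<open>1 \<le> n\<close>, unfolded this] show ?thesis unfolding c by (simp add: algebra_simps)
  qed
  have "2 * Y (Suc n) j / 2 = (2 * ?c * Y n j + 2 * of_real h * Yd n j + (of_real h)\<^sup>2 * ?F n) / 2"
    using pos[of n] by simp
  thus Y1: "Y (Suc n) j = ?c * Y n j + of_real h * Yd n j + of_real (h\<^sup>2 / 2) * ?F n"
    by (simp add: add_divide_distrib)
  have "2 * of_real h * Yd (Suc n) j = Y (Suc (Suc n)) j - Y n j"
    using velocity[of "Suc n"] by simp
  also have "Y (Suc (Suc n)) j = 2 * ?c * Y (Suc n) j - Y n j + (of_real h)\<^sup>2 * ?F (Suc n)"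
    using two_step[of "Suc n"] unfolding c by (simp add: algebra_simps)
  finally have "2 * of_real h * Yd (Suc n) j
      = 2 * of_real h * (?c * Yd n j) - 2 * (1 - ?c * ?c) * Y n j + (of_real h)\<^sup>2 * (?c * ?F n + ?F (Suc n))"
    unfolding Y1 by (simp add: algebra_simps)
  also have "1 - ?c * ?c = of_real ((sin (h * mod_freq h j))\<^sup>2)"
    unfolding sin_squared_eq by (simp add: power2_eq_square)
  also have "2 * of_real h * (?c * Yd n j) - 2 * of_real ((sin (h * mod_freq h j))\<^sup>2) * Y n j
        + (of_real h)\<^sup>2 * (?c * ?F n + ?F (Suc n))
      = 2 * of_real h * (?c * Yd n j - of_real ((sin (h * mod_freq h j))\<^sup>2 / h) * Y n j
      + of_real (h / 2) * (?c * ?F n + ?F (Suc n)))"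
    using h_pos unfolding of_real_divide by (simp add: distrib_left right_diff_distrib power2_eq_square)
  finally show "Yd (Suc n) j = ?c * Yd n j - of_real ((sin (h * mod_freq h j))\<^sup>2 / h) * Y n j
      + of_real (h / 2) * (?c * ?F n + ?F (Suc n))"
    using h_pos by simp
qed

text \<open>
  The Lipschitz constant of the nonlinearity is available only as long as the numerical solution
  stays below \<open>2 M\<close>. The error bound of order \<open>h\<close> without loss of derivatives keeps it there, by
  induction on the number of steps; the bound of order \<open>h\<^sup>2\<close> then needs no induction hypothesis
  on the size.
\<close>
lemma leapfrog_error:
  fixes s M T L B t0 :: real and z zd :: "real \<Rightarrow> int \<Rightarrow> complex" and Y Yd :: "nat \<Rightarrow> int \<Rightarrow> complex"
  defines "C \<equiv> 14 * B / gap * T * exp ((2 + 4 * (L / gap)) * T)"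
  defines "e \<equiv> \<lambda>n j. z (t0 + real n * h) j - Y n j"
    and "\<eta> \<equiv> \<lambda>n j. of_real (freq_filter h j) * zd (t0 + real n * h) j - Yd n j"
  assumes M: "0 \<le> M" and L: "0 \<le> L" and h: "h \<le> 1" "h * (L / gap) \<le> 1" "C * h / gap \<le> M"
    and z: "solves_wave K p (mod_freq h) t0 T z zd" and ez: "finite_energy K s M t0 T z zd"
    and leap: "leapfrog K p h y0 yd0 Y Yd"
    and init: "\<And>j. j \<in> freq_idx K \<Longrightarrow> z t0 j = y0 j \<and> of_real (freq_filter h j) * zd t0 j = yd0 j"
    and lipschitz: "\<And>r u v. r \<in> {s, s + 1} \<Longrightarrow> sob_norm K (s + 1) u \<le> 2 * M \<Longrightarrow> sob_norm K (s + 1) v \<le> 2 * M \<Longrightarrow>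
      sob_norm K r (\<lambda>j. conv_power K p u j - conv_power K p v j) \<le> L * sob_norm K r (\<lambda>j. u j - v j)"
    and B0: "\<And>\<tau>. \<tau> \<in> {t0..t0 + T} \<Longrightarrow> sob_norm K (s + 1) (conv_power K p (z \<tau>)) \<le> B"
    and B1: "\<And>\<tau>. \<tau> \<in> {t0..t0 + T} \<Longrightarrow> sob_norm K s (conv_iter_d1 K (p - 1) (z \<tau>) (zd \<tau>)) \<le> B"
    and B2: "\<And>\<tau>. \<tau> \<in> {t0..t0 + T} \<Longrightarrow> sob_norm K (s - 1) (conv_iter_d2 K (p - 1) (z \<tau>) (zd \<tau>)
      (\<lambda>j. conv_power K p (z \<tau>) j - of_real ((mod_freq h j)\<^sup>2) * z \<tau> j)) \<le> B"
    and n: "real n * h \<le> T"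
  shows "energy_norm (s + 1) (e n) (\<eta> n) \<le> C * h" "energy_norm s (e n) (\<eta> n) \<le> C * h\<^sup>2"
proof -
  define q where "q = 1 + (2 + 4 * (L / gap)) * h"
  define \<phi> where "\<phi> = (\<lambda>\<tau>. conv_power K p (z \<tau>))"
  define tt where "tt = (\<lambda>n. t0 + real n * h)"
  define D where "D = (\<lambda>n j. \<phi> (tt n) j - conv_power K p (Y n) j)"
  have T: "0 \<le> T" using n h_pos order_trans[of 0 "real n * h" T] by simp
  have B: "0 \<le> B" using B0[of t0] T order_trans[OF sob_norm_nonneg] by auto
  have q: "1 \<le> q" using L gap_pos h_pos by (simp add: q_def)
  have A: "0 \<le> 2 + 4 * (L / gap)" using L gap_pos by simp
  have tt_Suc: "tt (Suc m) = tt m + h" for m by (simp add: tt_def algebra_simps)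
  have tt_in: "tt m \<in> {t0..t0 + T}" if "real m * h \<le> T" for m using that h_pos by (simp add: tt_def)
  have prev: "real m * h \<le> T" if "real (Suc m) * h \<le> T" for m
    using that h_pos by (simp add: algebra_simps)

  define d1 where "d1 = (\<lambda>m. position_defect z zd \<phi> (tt m))"
  define d2 where "d2 = (\<lambda>m. velocity_defect z zd \<phi> (tt m))"
  have e_Suc: "e (Suc m) j = of_real (cos (h * mod_freq h j)) * e m j + of_real h * \<eta> m j
      + of_real (h\<^sup>2 / 2) * D m j + d1 m j" if "j \<in> freq_idx K" for m j
    using leapfrog_one_step(1)[OF leap that, of m]
    unfolding e_def \<eta>_def tt_def[symmetric, THEN fun_cong] tt_Suc D_def d1_def position_defect_def
    by (simp add: algebra_simps)
  have \<eta>_Suc: "\<eta> (Suc m) j = of_real (cos (h * mod_freq h j)) * \<eta> m j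
      - of_real ((sin (h * mod_freq h j))\<^sup>2 / h) * e m j
      + of_real (h / 2) * (of_real (cos (h * mod_freq h j)) * D m j + D (Suc m) j) + d2 m j"
    if "j \<in> freq_idx K" for m j
    unfolding e_def \<eta>_def tt_def[symmetric, THEN fun_cong] leapfrog_one_step(2)[OF leap that, of m]
      tt_Suc D_def d2_def velocity_defect_def
    by (simp add: algebra_simps diff_divide_distrib add_divide_distrib)
  have e0: "energy_norm r (e 0) (\<eta> 0) = 0" for r
  proof -
    have "e 0 j = 0" "\<eta> 0 j = 0" if "j \<in> freq_idx K" for j
      using init[OF that] leap that by (auto simp: e_def \<eta>_def leapfrog_def)
    thus ?thesis unfolding energy_norm_def by (intro L2_set_0') (simp add: norm_Pair)
  qed
  have defects: "2 * sob_norm K (s + 1) (d1 m) + sob_norm K s (d2 m) \<le> 7 * B / gap * h\<^sup>2"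
      "2 * sob_norm K s (d1 m) + sob_norm K (s - 1) (d2 m) \<le> 7 * B / gap * h ^ 3"
    if m: "real (Suc m) * h \<le> T" for m
  proof -
    have "{tt m..tt m + h} \<subseteq> {t0..t0 + T}"
      using tt_in[OF m] tt_in[OF prev[OF m]] by (auto simp: tt_Suc)
    hence sub: "\<tau> \<in> {t0..t0 + T}" if "\<tau> \<in> {tt m..tt m + h}" for \<tau> using that by blast
    note within = has_vector_derivative_within_subset[OF _ \<open>{tt m..tt m + h} \<subseteq> {t0..t0 + T}\<close>]
    let ?zdd = "\<lambda>\<tau> j. conv_power K p (z \<tau>) j - of_real ((mod_freq h j)\<^sup>2) * z \<tau> j"
    note dz = within[OF solves_waveD(1)[OF z sub]] and dzd = within[OF solves_waveD(2)[OF z sub]]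
    have d\<phi>: "((\<lambda>\<tau>. \<phi> \<tau> j) has_vector_derivative conv_iter_d1 K (p - 1) (z \<tau>) (zd \<tau>) j) (at \<tau> within {tt m..tt m + h})"
      and d\<phi>1: "((\<lambda>\<tau>. conv_iter_d1 K (p - 1) (z \<tau>) (zd \<tau>) j) has_vector_derivative
        conv_iter_d2 K (p - 1) (z \<tau>) (zd \<tau>) (?zdd \<tau>) j) (at \<tau> within {tt m..tt m + h})"
      if "j \<in> freq_idx K" "\<tau> \<in> {tt m..tt m + h}" for j \<tau>
      unfolding \<phi>_def conv_power_eq_conv_iter
      using dz[OF that(2)] dzd[OF that(2), unfolded conv_power_eq_conv_iter] that(1)
      by (auto intro!: has_vector_derivative_conv_iter has_vector_derivative_conv_iter_d1)
    have dzd': "((\<lambda>\<tau>. zd \<tau> j) has_vector_derivative \<phi> \<tau> j - of_real ((mod_freq h j)\<^sup>2) * z \<tau> j) (at \<tau> within {tt m..tt m + h})"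
      if "j \<in> freq_idx K" "\<tau> \<in> {tt m..tt m + h}" for j \<tau>
      unfolding \<phi>_def by (rule dzd[OF that(2,1)])
    have dz': "((\<lambda>\<tau>. z \<tau> j) has_vector_derivative zd \<tau> j) (at \<tau> within {tt m..tt m + h})"
      if "j \<in> freq_idx K" "\<tau> \<in> {tt m..tt m + h}" for j \<tau>
      by (rule dz[OF that(2,1)])
    have b0: "sob_norm K (s + 1) (\<phi> \<tau>) \<le> B" if "\<tau> \<in> {tt m..tt m + h}" for \<tau>
      unfolding \<phi>_def by (rule B0[OF sub[OF that]])
    note bounds = position_defect_bounds[OF dz' dzd' d\<phi> d\<phi>1 b0 B1[OF sub] B2[OF sub]]
      velocity_defect_bounds[OF dz' dzd' d\<phi> d\<phi>1 b0 B1[OF sub] B2[OF sub]]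
    have "2 * sob_norm K (s + 1) (d1 m) + sob_norm K s (d2 m) \<le> 2 * (2 * B / gap * h\<^sup>2) + 3 * B / gap * h\<^sup>2"
      using bounds(1,3) unfolding d1_def d2_def by linarith
    also have "\<dots> = 7 * B / gap * h\<^sup>2" by (simp add: field_simps)
    finally show "2 * sob_norm K (s + 1) (d1 m) + sob_norm K s (d2 m) \<le> 7 * B / gap * h\<^sup>2" .
    have "2 * sob_norm K s (d1 m) + sob_norm K (s - 1) (d2 m) \<le> 2 * (2 * B / gap * h ^ 3) + 3 * B / gap * h ^ 3"
      using bounds(2,4) unfolding d1_def d2_def by linarith
    also have "\<dots> = 7 * B / gap * h ^ 3" by (simp add: field_simps)
    finally show "2 * sob_norm K s (d1 m) + sob_norm K (s - 1) (d2 m) \<le> 7 * B / gap * h ^ 3" .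
  qed
  have z_le: "sob_norm K (s + 1) (z (tt m)) \<le> M" if "real m * h \<le> T" for m
    using finite_energyD(1)[OF ez tt_in[OF that]] .
  have D_le: "sob_norm K r (D m) \<le> L * sob_norm K r (e m)"
    if "r \<in> {s, s + 1}" "real m * h \<le> T" "sob_norm K (s + 1) (Y m) \<le> 2 * M" for r m
    unfolding D_def \<phi>_def e_def tt_def[symmetric, THEN fun_cong]
    using z_le[OF that(2)] M by (intro lipschitz that) auto
  have growth: "c * h ^ Suc k * real m * q ^ m \<le> c * T * exp ((2 + 4 * (L / gap)) * T) * h ^ k"
    if "0 \<le> c" "real m * h \<le> T" for c k m
    unfolding q_def by (rule discrete_gronwall_bound[OF h_pos A that])
  \<comment> \<open>Twice the bound on the defects, as required for the propagation of the error.\<close>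
  define \<delta> where "\<delta> = (\<lambda>k. 14 * B / gap * h ^ Suc k)"
  have \<delta>: "0 \<le> \<delta> k" for k using B gap_pos h_pos by (simp add: \<delta>_def)
  have \<delta>_growth: "\<delta> k * real m * q ^ m \<le> C * h ^ k" if "real m * h \<le> T" for k m
    using growth[OF _ that, of "14 * B / gap" k] B gap_pos by (simp add: \<delta>_def C_def)

  \<comment> \<open>Convergence without loss of derivatives and boundedness of the numerical solution feed each other.\<close>
  have first: "sob_norm K (s + 1) (Y m) \<le> 2 * M \<and> energy_norm (s + 1) (e m) (\<eta> m) \<le> \<delta> 1 * real m * q ^ m"
    if "real m * h \<le> T" for m
    using that
  proof (induction m)
    case 0
    have "sob_norm K (s + 1) (Y 0) = sob_norm K (s + 1) (z t0)"
      by (rule sob_norm_cong) (use init leap in \<open>auto simp: leapfrog_def\<close>)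
    thus ?case using z_le[of 0] T M e0 by (simp add: tt_def)
  next
    case (Suc m)
    note IH = Suc.IH[OF prev[OF Suc.prems]]
    define P where "P = q * energy_norm (s + 1) (e m) (\<eta> m) + \<delta> 1"
    have "2 * sob_norm K (s + 1) (d1 m) + sob_norm K (s + 1 - 1) (d2 m) \<le> 7 * B / gap * h\<^sup>2"
      using defects(1)[OF Suc.prems] by simp
    note step = error_propagation[where r = "s + 1", OF e_Suc \<eta>_Suc
        D_le[OF _ prev[OF Suc.prems] conjunct1[OF IH]] this L h(1,2)]
    have P_eq: "(1 + (2 + 4 * (L / gap)) * h) * energy_norm (s + 1) (e m) (\<eta> m) + 2 * (7 * B / gap * h\<^sup>2) = P"
      by (simp add: P_def q_def \<delta>_def power2_eq_square)
    \<comment> \<open>The induction step of Gronwall's lemma is needed for the bound \<open>P\<close>, not only for the new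
      error, whose estimate by \<open>P\<close> is available only after the new position has been bounded.\<close>
    have P: "P \<le> \<delta> 1 * real (Suc m) * q ^ Suc m"
      using discrete_gronwall_step[of "\<lambda>k. if k = Suc m then P else energy_norm (s + 1) (e m) (\<eta> m)" m "\<delta> 1" q]
        IH q \<delta> by (simp add: P_def)
    have "sob_norm K (s + 1) (e (Suc m)) \<le> P / gap" using step(1) unfolding P_eq by simp
    also have "\<dots> \<le> C * h / gap"
      using order_trans[OF P \<delta>_growth[OF Suc.prems]] gap_pos by (intro divide_right_mono) auto
    also have "\<dots> \<le> M" by (rule h(3))
    finally have "sob_norm K (s + 1) (e (Suc m)) \<le> M" .
    moreover have "Y (Suc m) = (\<lambda>j. z (tt (Suc m)) j - e (Suc m) j)" by (simp add: e_def tt_def)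
    ultimately have Y: "sob_norm K (s + 1) (Y (Suc m)) \<le> 2 * M"
      using sob_norm_triangle_diff[of K "s + 1" "z (tt (Suc m))" "e (Suc m)"] z_le[OF Suc.prems] by simp
    have "energy_norm (s + 1) (e (Suc m)) (\<eta> (Suc m)) \<le> P"
      using step(2) D_le[of "s + 1", OF _ Suc.prems Y] unfolding P_eq by simp
    with Y P show ?case by linarith
  qed
  show "energy_norm (s + 1) (e n) (\<eta> n) \<le> C * h"
    using first[OF n] \<delta>_growth[OF n, of 1] by simp

  have "energy_norm s (e m) (\<eta> m) \<le> \<delta> 2 * real m * q ^ m" if "real m * h \<le> T" for m
    using that
  proof (induction m)
    case (Suc m)
    have bounded: "sob_norm K (s + 1) (Y m) \<le> 2 * M" "sob_norm K (s + 1) (Y (Suc m)) \<le> 2 * M"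
      using first[OF prev[OF Suc.prems]] first[OF Suc.prems] by auto
    have "energy_norm s (e (Suc m)) (\<eta> (Suc m))
        \<le> (1 + (2 + 4 * (L / gap)) * h) * energy_norm s (e m) (\<eta> m) + 2 * (7 * B / gap * h ^ 3)"
      by (rule error_propagation(2)[OF e_Suc \<eta>_Suc D_le[OF _ prev[OF Suc.prems] bounded(1)]
            defects(2)[OF Suc.prems] L h(1,2) D_le[OF _ Suc.prems bounded(2)]]) auto
    also have "\<dots> = q * energy_norm s (e m) (\<eta> m) + \<delta> 2"
      by (simp add: q_def \<delta>_def power3_eq_cube power2_eq_square)
    finally show ?case
      using Suc.IH[OF prev[OF Suc.prems]] q \<delta> by (intro discrete_gronwall_step) auto
  qed (simp add: e0)
  thus "energy_norm s (e n) (\<eta> n) \<le> C * h\<^sup>2"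
    using order_trans[OF _ \<delta>_growth[OF n, of 2]] n by blast
qed

text \<open>
  Interpolation gives the order \<open>\<beta>\<close> with a loss of \<open>max 0 (\<beta> - 1)\<close> derivatives, which is at most
  \<open>3\<beta>/2\<close>.
\<close>
lemma leapfrog_error_interpolated:
  assumes "energy_norm (s + 1) e \<eta> \<le> C * h" "energy_norm s e \<eta> \<le> C * h\<^sup>2"
    and \<beta>: "0 \<le> \<beta>" "\<beta> \<le> 2" and h: "h \<le> 1"
  shows "sob_norm K (s + 1 - 3 * \<beta> / 2) e + sob_norm K (s - 3 * \<beta> / 2) \<eta> \<le> (2 * C / gap + 2 * C) * h powr \<beta>"
proof -
  define \<theta> where "\<theta> = max 0 (\<beta> - 1)"
  have \<theta>: "0 \<le> \<theta>" "\<theta> \<le> 1" "\<theta> \<le> 3 * \<beta> / 2" using \<beta> by (auto simp: \<theta>_def max_def)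
  have C: "0 \<le> C"
    using order_trans[OF energy_norm_nonneg assms(1)] h_pos by (simp add: zero_le_mult_iff)
  have h_powr: "h powr \<theta> * h \<le> h powr \<beta>"
  proof -
    have "h powr \<theta> * h = h powr (\<theta> + 1)" using h_pos by (simp add: powr_add)
    also have "\<dots> \<le> h powr \<beta>" using h_pos h by (intro powr_mono') (auto simp: \<theta>_def)
    finally show ?thesis .
  qed
  have interpolate: "sob_norm K (r - 3 * \<beta> / 2) v \<le> 2 * X * h powr \<beta>"
    if "sob_norm K r v \<le> X * h" "sob_norm K (r - 1) v \<le> X * h\<^sup>2" "0 \<le> X" for r v X
  proof -
    have "sob_norm K (r - 3 * \<beta> / 2) v \<le> sob_norm K (r - 1 + 1 - \<theta>) v"
      using \<theta> by (intro sob_norm_mono) auto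
    also have "\<dots> \<le> h powr \<theta> * (sob_norm K (r - 1 + 1) v + sob_norm K (r - 1) v / h)"
      by (rule sob_norm_interpolate[OF h_pos \<theta>(1,2)])
    also have "\<dots> \<le> h powr \<theta> * (X * h + X * h)"
    proof (intro mult_left_mono add_mono)
      show "sob_norm K (r - 1) v / h \<le> X * h"
        using that(2) h_pos by (simp add: divide_le_eq power2_eq_square mult.assoc)
    qed (use that in auto)
    also have "\<dots> = 2 * X * (h powr \<theta> * h)" by simp
    also have "\<dots> \<le> 2 * X * h powr \<beta>" using h_powr that by (intro mult_left_mono) auto
    finally show ?thesis .
  qed
  have "sob_norm K (s + 1 - 3 * \<beta> / 2) e \<le> 2 * (C / gap) * h powr \<beta>"
  proof (rule interpolate)
    have "sob_norm K r e \<le> c / gap" if "energy_norm r e \<eta> \<le> c" for r c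
    proof -
      have "sob_norm K r e \<le> 1 / gap * energy_norm r e \<eta>" by (rule sob_norm_position_le_energy_norm)
      also have "\<dots> \<le> 1 / gap * c" using that gap_pos by (intro mult_left_mono) auto
      finally show ?thesis by simp
    qed
    from this[OF assms(1)] this[OF assms(2)]
    show "sob_norm K (s + 1) e \<le> C / gap * h" "sob_norm K (s + 1 - 1) e \<le> C / gap * h\<^sup>2" by simp_all
    show "0 \<le> C / gap" using C gap_pos by simp
  qed
  moreover have "sob_norm K (s - 3 * \<beta> / 2) \<eta> \<le> 2 * C * h powr \<beta>"
  proof (rule interpolate[OF _ _ C])
    show "sob_norm K s \<eta> \<le> C * h"
      using order_trans[OF sob_norm_velocity_le_energy_norm assms(1)] by simp
    show "sob_norm K (s - 1) \<eta> \<le> C * h\<^sup>2"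
      by (rule order_trans[OF sob_norm_velocity_le_energy_norm assms(2)])
  qed
  ultimately show ?thesis by (simp add: algebra_simps)
qed

lemma filtered_velocity_error:
  assumes "0 \<le> \<beta>" "\<beta> \<le> 2"
  shows "sob_norm K (s - 3 * \<beta> / 2) (\<lambda>j. v j - of_real (freq_filter h j) * v j) \<le> h powr \<beta> * sob_norm K s v"
proof -
  have "sob_norm K (s - 3 * \<beta> / 2) (\<lambda>j. v j - of_real (freq_filter h j) * v j) \<le> 1 * h powr \<beta> * sob_norm K (s + 0) v"
  proof (rule sob_norm_trade[OF h_pos assms])
    fix j assume j: "j \<in> freq_idx K"
    have "1 - freq_filter h j \<le> h\<^sup>2 * (freq j)\<^sup>2 / 2" by (rule one_minus_freq_filter[OF j])
    also have "\<dots> \<le> h\<^sup>2 * (freq j)\<^sup>2" by simp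
    also have "\<dots> \<le> h\<^sup>2 * bracket j ^ 3"
    proof (rule mult_left_mono)
      have "(freq j)\<^sup>2 \<le> (bracket j)\<^sup>2" using freq_le_bracket by (intro power_mono) auto
      also have "\<dots> \<le> bracket j ^ 3" using bracket_ge_1 by (intro power_increasing) auto
      finally show "(freq j)\<^sup>2 \<le> bracket j ^ 3" .
    qed simp
    finally have "\<bar>1 - freq_filter h j\<bar> \<le> min 1 (h\<^sup>2 * bracket j ^ 3)"
      using freq_filter_le_1[OF j] freq_filter_pos[OF j] by auto
    hence "\<bar>1 - freq_filter h j\<bar> * cmod (v j) \<le> min 1 (h\<^sup>2 * bracket j ^ 3) * cmod (v j)"
      by (rule mult_right_mono) simp
    moreover have "v j - of_real (freq_filter h j) * v j = of_real (1 - freq_filter h j) * v j"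
      by (simp add: algebra_simps)
    ultimately show "cmod (v j - of_real (freq_filter h j) * v j)
        \<le> 1 * (min 1 (h\<^sup>2 * bracket j ^ 3) * (bracket j powr 0 * cmod (v j)))"
      using bracket_pos[of j] by (simp only: norm_mult norm_of_real) simp
  qed simp
  thus ?thesis by simp
qed

text \<open>
  With \<open>u\<close> the nonlinearity at \<open>v\<close>, this bounds the second time derivative of a solution.
\<close>
lemma sob_norm_acceleration:
  "sob_norm K (s - 1) (\<lambda>j. u j - of_real ((mod_freq h j)\<^sup>2) * v j)
    \<le> sob_norm K (s + 1) u + 1 / gap * sob_norm K (s + 1) v"
proof -
  have "sob_norm K (s - 1) (\<lambda>j. of_real ((mod_freq h j)\<^sup>2) * v j) \<le> 1 / gap * sob_norm K (s + 1) v"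
  proof (rule sob_norm_multiplier[where \<mu> = 2])
    fix j assume j: "j \<in> freq_idx K"
    have "\<bar>(mod_freq h j)\<^sup>2\<bar> * cmod (v j) \<le> (bracket j)\<^sup>2 / gap * cmod (v j)"
      using mod_freq_square_le_bracket[OF j] by (intro mult_right_mono) auto
    thus "cmod (of_real ((mod_freq h j)\<^sup>2) * v j) \<le> 1 / gap * (bracket j powr 2 * cmod (v j))"
      unfolding norm_mult norm_of_real using bracket_pos[of j] by (simp add: powr_numeral)
  qed (use gap_pos in auto)
  moreover have "sob_norm K (s - 1) u \<le> sob_norm K (s + 1) u" by (rule sob_norm_mono) simp
  ultimately show ?thesis
    using sob_norm_triangle_diff[of K "s - 1" u "\<lambda>j. of_real ((mod_freq h j)\<^sup>2) * v j"] by linarith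
qed

end

section \<open>The error bound\<close>

text \<open>
  The hypothesis on \<open>y2\<close> is the bound on the acceleration of a solution with modified frequencies,
  with \<open>g\<close> in the role of the constant \<open>gap\<close>; it is stated without reference to \<open>h\<close> because \<open>B\<close> must
  not depend on the step-size.
\<close>
lemma nonlinearity_bounds_along_solution:
  fixes s M g :: real
  assumes "0 \<le> s" "0 \<le> M" "0 < g" "g \<le> 1"
  obtains B where "0 \<le> B"
    and "\<And>K y y1 y2. \<lbrakk>1 \<le> K; sob_norm K (s + 1) y \<le> M; sob_norm K s y1 \<le> M;
        sob_norm K (s - 1) y2 \<le> sob_norm K (s + 1) (conv_power K p y) + 1 / g * sob_norm K (s + 1) y\<rbrakk> \<Longrightarrow>
      sob_norm K (s + 1) (conv_power K p y) \<le> B \<and> sob_norm K s (conv_iter_d1 K (p - 1) y y1) \<le> B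
      \<and> sob_norm K (s - 1) (conv_iter_d2 K (p - 1) y y1 y2) \<le> B"
proof -
  define B0 where "B0 = (4 * 2 powr (s + 1) * M) ^ (p - 1) * M"
  define R where "R = B0 + 1 / g * M"
  have B0: "0 \<le> B0" using assms by (simp add: B0_def)
  have "M \<le> 1 / g * M" using assms by (simp add: pos_le_divide_eq mult_left_le)
  hence R: "0 \<le> R" "M \<le> R" using B0 assms by (auto simp: R_def)
  obtain B1 where B1: "0 \<le> B1" "\<And>K y y1. 1 \<le> K \<Longrightarrow> sob_norm K (s + 1) y \<le> R \<Longrightarrow> sob_norm K s y1 \<le> R \<Longrightarrow>
      sob_norm K s (conv_iter_d1 K (p - 1) y y1) \<le> B1"
    using sob_norm_conv_iter_d1[OF assms(1) R(1), of "p - 1"] by blast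
  obtain B2 where B2: "0 \<le> B2" "\<And>K y y1 y2. 1 \<le> K \<Longrightarrow> sob_norm K (s + 1) y \<le> R \<Longrightarrow> sob_norm K s y1 \<le> R \<Longrightarrow>
      sob_norm K (s - 1) y2 \<le> R \<Longrightarrow> sob_norm K (s - 1) (conv_iter_d2 K (p - 1) y y1 y2) \<le> B2"
    using sob_norm_conv_iter_d2[OF assms(1) R(1), of "p - 1"] by blast
  show thesis
  proof (rule that[of "B0 + B1 + B2"])
    show "0 \<le> B0 + B1 + B2" using B0 B1 B2 by simp
    fix K y y1 y2
    assume K: "1 \<le> K" and y: "sob_norm K (s + 1) y \<le> M" and y1: "sob_norm K s y1 \<le> M"
      and y2: "sob_norm K (s - 1) y2 \<le> sob_norm K (s + 1) (conv_power K p y) + 1 / g * sob_norm K (s + 1) y"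
    have b0: "sob_norm K (s + 1) (conv_power K p y) \<le> B0"
      unfolding conv_power_eq_conv_iter B0_def by (rule sob_norm_conv_iter[OF K _ y]) (use assms in simp)
    have "1 / g * sob_norm K (s + 1) y \<le> 1 / g * M" using y assms by (intro mult_left_mono) auto
    hence "sob_norm K (s - 1) y2 \<le> R" using y2 b0 by (simp add: R_def)
    thus "sob_norm K (s + 1) (conv_power K p y) \<le> B0 + B1 + B2 \<and> sob_norm K s (conv_iter_d1 K (p - 1) y y1) \<le> B0 + B1 + B2
      \<and> sob_norm K (s - 1) (conv_iter_d2 K (p - 1) y y1 y2) \<le> B0 + B1 + B2"
      using b0 B0 B1(1) B1(2)[OF K, of y y1] B2(1) B2(2)[OF K, of y y1 y2] y y1 R by auto
  qed
qed

theorem theorem4p1: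
  fixes p :: nat and s M T c0 :: real
  assumes "p \<ge> 2" and "s \<ge> 0" and "M > 0" and "T > 0" and "0 < c0" and "c0 < 2"
  shows "\<exists>C h0 :: real. C > 0 \<and> h0 > 0 \<and>
    (\<forall>(\<alpha> :: real) (K :: nat) (t0 :: real)
      (y :: real \<Rightarrow> int \<Rightarrow> complex) (yd :: real \<Rightarrow> int \<Rightarrow> complex).
      - 1 \<le> \<alpha> \<longrightarrow> \<alpha> \<le> min 1 (2/3 * s + 1/3) \<longrightarrow> K \<ge> 1 \<longrightarrow>
      solves_wave K p freq t0 T y yd \<longrightarrow>
      finite_energy K s M t0 T y yd \<longrightarrow>
      (\<forall>(h :: real) (z :: real \<Rightarrow> int \<Rightarrow> complex) (zd :: real \<Rightarrow> int \<Rightarrow> complex)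
        (Y :: nat \<Rightarrow> int \<Rightarrow> complex) (Yd :: nat \<Rightarrow> int \<Rightarrow> complex).
        0 < h \<longrightarrow> h \<le> h0 \<longrightarrow> h * real K \<le> c0 \<longrightarrow>
        solves_wave K p (mod_freq h) t0 T z zd \<longrightarrow>
        (\<forall>j\<in>freq_idx K. z t0 j = y t0 j \<and>
           zd t0 j = inverse (complex_of_real (sinc (h * mod_freq h j))) * yd t0 j) \<longrightarrow>
        finite_energy K s M t0 T z zd \<longrightarrow>
        leapfrog K p h (y t0) (yd t0) Y Yd \<longrightarrow>
        (\<forall>n :: nat. real n * h \<le> T \<longrightarrow>
           sob_norm K (s + 1 - 3 * (1 + \<alpha>) / 2) (\<lambda>j. y (t0 + real n * h) j - Y n j)
           + sob_norm K (s - 3 * (1 + \<alpha>) / 2) (\<lambda>j. yd (t0 + real n * h) j - Yd n j)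
           \<le> C * h powr (1 + \<alpha>))))"
proof -
  define g where "g = 1 - c0\<^sup>2 / 4"
  have "c0\<^sup>2 < 2\<^sup>2" by (rule power_strict_mono) (use assms in auto)
  hence g: "0 < g" "g \<le> 1" by (auto simp: g_def)
  define L where "L = real (Suc (p - 1)) * (4 * 2 powr (s + 1) * (2 * M)) ^ (p - 1)"
  have L: "0 \<le> L" using assms by (simp add: L_def)
  obtain B where B: "0 \<le> B"
    "\<And>K y y1 y2. \<lbrakk>1 \<le> K; sob_norm K (s + 1) y \<le> M; sob_norm K s y1 \<le> M;
        sob_norm K (s - 1) y2 \<le> sob_norm K (s + 1) (conv_power K p y) + 1 / g * sob_norm K (s + 1) y\<rbrakk> \<Longrightarrow>
      sob_norm K (s + 1) (conv_power K p y) \<le> B \<and> sob_norm K s (conv_iter_d1 K (p - 1) y y1) \<le> B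
      \<and> sob_norm K (s - 1) (conv_iter_d2 K (p - 1) y y1 y2) \<le> B"
    using nonlinearity_bounds_along_solution[OF assms(2) less_imp_le[OF assms(3)] g] by metis
  define C1 where "C1 = 14 * B / g * T * exp ((2 + 4 * (L / g)) * T)"
  define G where "G = 2 * M * L + M / (2 * g)"
  define E where "E = sqrt (((M / g)\<^sup>2 + G\<^sup>2) * exp ((3 + 2 * L) * T))"
  define C where "C = (2 * E + 4 * M) + M + (2 * C1 / g + 2 * C1)"
  \<comment> \<open>The second entry makes the nonlinear part of a step a perturbation of the linear part, the
    third one keeps the numerical solution bounded by \<open>2 M\<close>.\<close>
  define h0 where "h0 = min 1 (min (1 / (L / g + 1)) (M * g / (C1 + 1)))"
  have C1: "0 \<le> C1" using B g assms by (simp add: C1_def)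
  have "0 < C" using C1 g assms by (simp add: C_def E_def add_nonneg_pos add_pos_nonneg)
  moreover have "0 < h0" using C1 g L assms by (simp add: h0_def add_nonneg_pos)
  moreover have "sob_norm K (s + 1 - 3 * (1 + \<alpha>) / 2) (\<lambda>j. y (t0 + real n * h) j - Y n j)
      + sob_norm K (s - 3 * (1 + \<alpha>) / 2) (\<lambda>j. yd (t0 + real n * h) j - Yd n j) \<le> C * h powr (1 + \<alpha>)"
    if \<alpha>: "- 1 \<le> \<alpha>" "\<alpha> \<le> min 1 (2/3 * s + 1/3)" and K: "K \<ge> 1"
      and y: "solves_wave K p freq t0 T y yd" and ey: "finite_energy K s M t0 T y yd"
      and h: "0 < h" "h \<le> h0" "h * real K \<le> c0"
      and z: "solves_wave K p (mod_freq h) t0 T z zd"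
      and init: "\<forall>j\<in>freq_idx K. z t0 j = y t0 j \<and>
           zd t0 j = inverse (complex_of_real (sinc (h * mod_freq h j))) * yd t0 j"
      and ez: "finite_energy K s M t0 T z zd"
      and leap: "leapfrog K p h (y t0) (yd t0) Y Yd" and n: "real n * h \<le> T"
    for \<alpha> K t0 y yd h z zd Y Yd n
  proof -
    interpret resolved_step h c0 K by unfold_locales (use h K assms in auto)
    have gap: "gap = g" by (simp add: gap_def g_def)
    define \<beta> \<sigma> where "\<beta> = 1 + \<alpha>" and "\<sigma> = s + 1 - 3 * \<beta> / 2"
    have \<beta>: "0 \<le> \<beta>" "\<beta> \<le> 2" using \<alpha> by (auto simp: \<beta>_def)
    have \<sigma>: "\<bar>\<sigma>\<bar> \<le> s + 1"
      using \<alpha> assms(2) unfolding \<sigma>_def \<beta>_def abs_le_iff by (auto simp: field_simps)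
    have h1: "h \<le> 1" "h \<le> 1 / (L / g + 1)" "h \<le> M * g / (C1 + 1)" using h(2) by (auto simp: h0_def)
    have "h * (L / g + 1) \<le> 1" using h1(2) L g by (simp add: pos_le_divide_eq add_nonneg_pos)
    hence hL: "h * (L / g) \<le> 1" using h(1) by (simp add: distrib_left)
    have "h * (C1 + 1) \<le> M * g" using h1(3) C1 by (simp add: pos_le_divide_eq)
    hence hC: "C1 * h / g \<le> M" using h(1) g by (simp add: divide_le_eq algebra_simps)
    have lipschitz: "sob_norm K r (\<lambda>j. conv_power K p u j - conv_power K p v j) \<le> L * sob_norm K r (\<lambda>j. u j - v j)"
      if "\<bar>r\<bar> \<le> s + 1" "sob_norm K (s + 1) u \<le> 2 * M" "sob_norm K (s + 1) v \<le> 2 * M" for r u v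
      unfolding conv_power_eq_conv_iter L_def
      by (rule sob_norm_conv_iter_diff[OF K _ that]) (use assms in simp)
    define t where "t = t0 + real n * h"
    have t: "t \<in> {t0..t0 + T}" using n h by (simp add: t_def)
    have bounds: "sob_norm K (s + 1) (conv_power K p (z \<tau>)) \<le> B \<and> sob_norm K s (conv_iter_d1 K (p - 1) (z \<tau>) (zd \<tau>)) \<le> B
      \<and> sob_norm K (s - 1) (conv_iter_d2 K (p - 1) (z \<tau>) (zd \<tau>)
          (\<lambda>j. conv_power K p (z \<tau>) j - of_real ((mod_freq h j)\<^sup>2) * z \<tau> j)) \<le> B"
      if "\<tau> \<in> {t0..t0 + T}" for \<tau>
      using B(2)[OF K finite_energyD[OF ez that]] sob_norm_acceleration unfolding gap by blast
    have init1: "z t0 j = y t0 j \<and> zd t0 j = inverse (complex_of_real (freq_filter h j)) * yd t0 j"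
      if "j \<in> freq_idx K" for j
      using init that by (simp add: freq_filter_def)
    have init2: "z t0 j = y t0 j \<and> of_real (freq_filter h j) * zd t0 j = yd t0 j" if "j \<in> freq_idx K" for j
      using init1[OF that] freq_filter_pos[OF that] by simp
    have modified: "sob_norm K \<sigma> (\<lambda>j. y t j - z t j) + sob_norm K (\<sigma> - 1) (\<lambda>j. yd t j - zd t j)
        \<le> (2 * E + 4 * M) * h powr \<beta>"
      unfolding E_def G_def gap[symmetric]
      by (rule modified_frequency_error[OF \<beta> \<sigma>_def L _ _ y ey z ez init1 t])
        (use assms \<sigma> in \<open>auto intro!: lipschitz\<close>)
    let ?e = "\<lambda>j. z t j - Y n j" and ?\<eta> = "\<lambda>j. of_real (freq_filter h j) * zd t j - Yd n j"
    have energy: "energy_norm (s + 1) ?e ?\<eta> \<le> C1 * h" "energy_norm s ?e ?\<eta> \<le> C1 * h\<^sup>2"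
      unfolding C1_def gap[symmetric] t_def
      by (rule leapfrog_error[OF _ L h1(1) _ _ z ez leap init2 _ _ _ _ n];
          (use assms hL hC bounds in \<open>auto simp: gap C1_def intro!: lipschitz\<close>))+
    have index: "s - 3 * \<beta> / 2 = \<sigma> - 1" by (simp add: \<sigma>_def)
    have numerical: "sob_norm K \<sigma> ?e + sob_norm K (\<sigma> - 1) ?\<eta> \<le> (2 * C1 / g + 2 * C1) * h powr \<beta>"
      using leapfrog_error_interpolated[OF energy \<beta> h1(1)] unfolding gap index \<sigma>_def[symmetric] .
    have filtered: "sob_norm K (\<sigma> - 1) (\<lambda>j. zd t j - of_real (freq_filter h j) * zd t j) \<le> M * h powr \<beta>"
      using filtered_velocity_error[OF \<beta>, of s "zd t"] mult_left_mono[OF finite_energyD(2)[OF ez t], of "h powr \<beta>"]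
      by (simp add: \<sigma>_def mult.commute)
    have "sob_norm K \<sigma> (\<lambda>j. y t j - Y n j) \<le> sob_norm K \<sigma> (\<lambda>j. y t j - z t j) + sob_norm K \<sigma> ?e"
      by (rule sob_norm_triangle_diff3)
    moreover have "sob_norm K (\<sigma> - 1) (\<lambda>j. yd t j - Yd n j) \<le> sob_norm K (\<sigma> - 1) (\<lambda>j. yd t j - zd t j)
        + (sob_norm K (\<sigma> - 1) (\<lambda>j. zd t j - of_real (freq_filter h j) * zd t j) + sob_norm K (\<sigma> - 1) ?\<eta>)"
      by (rule order_trans[OF sob_norm_triangle_diff3 add_left_mono[OF sob_norm_triangle_diff3]])
    ultimately have "sob_norm K \<sigma> (\<lambda>j. y t j - Y n j) + sob_norm K (\<sigma> - 1) (\<lambda>j. yd t j - Yd n j)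
        \<le> (2 * E + 4 * M) * h powr \<beta> + M * h powr \<beta> + (2 * C1 / g + 2 * C1) * h powr \<beta>"
      using modified filtered numerical by linarith
    also have "\<dots> = C * h powr \<beta>" by (simp add: C_def algebra_simps)
    finally show ?thesis by (simp add: \<sigma>_def \<beta>_def t_def)
  qed
  ultimately show ?thesis by blast
qed

end
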